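(* The class of ILP graphs $G(A,b,c)$ and the class of reduced ILP graphs $G'(A,b,c)$ (for data $(A,b,c)$ satisfying the assumptions, including the normalization of the rows of $(A|b)$, listed in the context) are both graph isomorphism complete.
   Context: Roughly speaking, a class $\mathcal{C}$ of graphs is graph isomorphism complete if the problem of deciding isomorphy for any two graphs in $\mathcal{C}$ is as difficult as for general graphs, up to a polynomial time transformation. The graphs below carry node labels, and isomorphisms are understood to respect them. Assumptions on the data: $A=(a_{ij})\in\mathbb{R}^{m\times n}$ has no zero rows, $b\in\mathbb{R}^m$, $c\in\mathbb{R}^n\setminus\{0\}$, the polyhedron $P(A,b)=\{x\in\mathbb{R}^n : Ax\le b\}$ is non-empty and full-dimensional, and the linear program $\max\{c^tx : x\in P(A,b)\}$ has an optimal solution. The rows of the extended matrix $(A|b)$ are normalized: each row is scaled (by a positive factor) such that its leftmost non-zero coefficient is $\pm1$ or, in the rational case, where this is more natural and is what is usually done, such that its coefficients are coprime integers; duplicate inequalities are removed, so that the rows of $(A|b)$ are in one-to-one correspondence with the affine hyperplanes $\{x : a_{i,\cdot}x=b_i\}$ of the associated arrangement. The reduced (restricted) ILP graph $G'(A,b,c)$ is the undirected simple graph with the following nodes: a position node $\alpha_{ij}$ for each $(i,j)\in[m]\times[n]$, a row node $\rho_i$ for each $i\in[m]$, a column node $\zeta_j$ for each $j\in[n]$, a node $\kappa_u$ for each distinct coefficient $u$ of $A$, a node $\lambda_v$ for each distinct coefficient $v$ of $b$, and a node $\mu_w$ for each distinct coefficient $w$ of $c$. Labels: all position nodes share one label,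 all row nodes share a second label, all column nodes share a third label, and each of the coefficient nodes $\kappa_u,\lambda_v,\mu_w$ has its own individual label. Edges: $\alpha_{ij}$ is adjacent to $\rho_i$, $\zeta_j$ and $\kappa_{a_{ij}}$; $\rho_i$ is adjacent to $\lambda_{b_i}$; $\zeta_j$ is adjacent to $\mu_{c_j}$. The ILP graph $G(A,b,c)$ is obtained from $G'(A,b,c)$ as follows. Each column node $\zeta_j$ gets a twin node $\hat\zeta_j$, and each position node $\alpha_{ij}$ with $a_{ij}\ne0$ gets a twin node $\hat\alpha_{ij}$; for $a_{ij}=0$ we set $\hat\alpha_{ij}=\alpha_{ij}$. Nodes $\kappa_{-u}$ for the non-zero coefficients $u$ of $A$ and $\mu_{-w}$ for the non-zero coefficients $w$ of $c$ are added unless they already exist. Added edges: $\hat\alpha_{ij}$ is adjacent to $\rho_i$ and $\hat\zeta_j$ for all $i,j$; $\hat\zeta_j$ is adjacent to $\mu_{-c_j}$; $\hat\alpha_{ij}$ is adjacent to $\kappa_{-a_{ij}}$; $\alpha_{ij}$ is adjacent to $\hat\alpha_{ij}$ whenever $a_{ij}\neq 0$; and $\zeta_j$ is adjacent to $\hat\zeta_j$. Twins share the same label, and the new coefficient nodes receive new individual labels. *)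

theory Defs
  imports
    "HOL-Library.Log_Nat"
    "HOL-Computational_Algebra.Polynomial"
    "Jordan_Normal_Form.Matrix"
    "Jordan_Normal_Form.VS_Connect"
begin

section \<open>Polynomial time\<close>

text \<open>
  The machine model is a structured random access machine under the logarithmic cost criterion.
  Memory consists of arrays of natural numbers (\<open>s a i\<close> is the cell with index \<open>i\<close> of array \<open>a\<close>);
  a program mentions only finitely many arrays, and indirect addressing is by computed index.
  Every evaluated subexpression, addresses included, is charged one plus its binary length,
  so that this model and multi-tape Turing machines simulate each other with polynomial overhead.
\<close>

type_synonym memory = "nat \<Rightarrow> nat \<Rightarrow> nat"

datatype aexp =
    Const nat
  | Cell nat aexp
  | Add aexp aexp
  | Sub aexp aexp
  | Mult aexp aexp
  | Div aexp aexp

fun val :: "aexp \<Rightarrow> memory \<Rightarrow> nat" where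
  "val (Const k) s = k"
| "val (Cell a e) s = s a (val e s)"
| "val (Add e1 e2) s = val e1 s + val e2 s"
| "val (Sub e1 e2) s = val e1 s - val e2 s"
| "val (Mult e1 e2) s = val e1 s * val e2 s"
| "val (Div e1 e2) s = val e1 s div val e2 s"

definition log_size :: "nat \<Rightarrow> nat" where
  "log_size k = 1 + floorlog 2 k"

fun eval_cost :: "aexp \<Rightarrow> memory \<Rightarrow> nat" where
  "eval_cost (Const k) s = log_size k"
| "eval_cost (Cell a e) s = eval_cost e s + log_size (val (Cell a e) s)"
| "eval_cost (Add e1 e2) s = eval_cost e1 s + eval_cost e2 s + log_size (val (Add e1 e2) s)"
| "eval_cost (Sub e1 e2) s = eval_cost e1 s + eval_cost e2 s + log_size (val (Sub e1 e2) s)"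
| "eval_cost (Mult e1 e2) s = eval_cost e1 s + eval_cost e2 s + log_size (val (Mult e1 e2) s)"
| "eval_cost (Div e1 e2) s = eval_cost e1 s + eval_cost e2 s + log_size (val (Div e1 e2) s)"

datatype cmd =
    Skip
  | Store nat aexp aexp
  | Seq cmd cmd
  | Cond aexp cmd cmd
  | While aexp cmd

text \<open>
  \<open>exec p s t s'\<close>: program \<open>p\<close> started in memory \<open>s\<close> halts at cost \<open>t\<close> in memory \<open>s'\<close>.
  A condition counts as true iff its value is nonzero.
\<close>

inductive exec :: "cmd \<Rightarrow> memory \<Rightarrow> nat \<Rightarrow> memory \<Rightarrow> bool" where
  exec_Skip: "exec Skip s 1 s"
| exec_Store: "exec (Store a i e) s (1 + eval_cost i s + eval_cost e s)
    (s(a := (s a)(val i s := val e s)))"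
| exec_Seq: "exec p s t s' \<Longrightarrow> exec q s' t' s'' \<Longrightarrow> exec (Seq p q) s (t + t') s''"
| exec_Cond_True: "val e s \<noteq> 0 \<Longrightarrow> exec p s t s' \<Longrightarrow> exec (Cond e p q) s (1 + eval_cost e s + t) s'"
| exec_Cond_False: "val e s = 0 \<Longrightarrow> exec q s t s' \<Longrightarrow> exec (Cond e p q) s (1 + eval_cost e s + t) s'"
| exec_While_False: "val e s = 0 \<Longrightarrow> exec (While e p) s (1 + eval_cost e s) s"
| exec_While_True: "val e s \<noteq> 0 \<Longrightarrow> exec p s t s' \<Longrightarrow> exec (While e p) s' t' s'' \<Longrightarrow>
    exec (While e p) s (1 + eval_cost e s + t + t') s''"

text \<open>Input in array 0 and output in array 1, each preceded by its length in the cell with index 0.\<close>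

definition init_memory :: "nat list \<Rightarrow> memory" where
  "init_memory w = (\<lambda>a i. if a = 0 \<and> i \<le> length w then (length w # w) ! i else 0)"

definition read_output :: "memory \<Rightarrow> nat list" where
  "read_output s = map (\<lambda>i. s 1 (Suc i)) [0..<s 1 0]"

definition word_size :: "nat list \<Rightarrow> nat" where
  "word_size w = (\<Sum>k\<leftarrow>w. log_size k)"

text \<open>
  The size of the output is charged as well: since unwritten cells read as 0, a program could
  otherwise announce an exponentially long output merely by writing its length.
\<close>

definition poly_time_computable :: "(nat list \<Rightarrow> nat list) \<Rightarrow> bool" where
  "poly_time_computable f \<longleftrightarrow> (\<exists>(p :: cmd) (q :: nat poly). \<forall>w. \<exists>t s.
     exec p (init_memory w) t s \<and> read_output s = f w \<and> t + word_size (f w) \<le> poly q (word_size w))"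

text \<open>A promise problem is a pair of its set of instances and its subset of yes-instances.\<close>

type_synonym problem = "nat list set \<times> nat list set"

definition poly_reducible :: "problem \<Rightarrow> problem \<Rightarrow> bool" where
  "poly_reducible P Q \<longleftrightarrow> (\<exists>f. poly_time_computable f \<and>
     (\<forall>w \<in> fst P. f w \<in> fst Q \<and> (f w \<in> snd Q \<longleftrightarrow> w \<in> snd P)))"


section \<open>Graphs and isomorphism problems\<close>

record 'v graph =
  nodes :: "'v set"
  edges :: "'v set set"

record ('v, 'l) lgraph = "'v graph" +
  label :: "'v \<Rightarrow> 'l"

definition simple_graph :: "('v, 'z) graph_scheme \<Rightarrow> bool" where
  "simple_graph G \<longleftrightarrow> finite (nodes G) \<and> edges G \<subseteq> {e. e \<subseteq> nodes G \<and> card e = 2}"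

definition is_graph_iso ::
  "('v \<Rightarrow> 'w) \<Rightarrow> ('v, 'y) graph_scheme \<Rightarrow> ('w, 'z) graph_scheme \<Rightarrow> bool" where
  "is_graph_iso f G H \<longleftrightarrow> bij_betw f (nodes G) (nodes H) \<and>
     (\<forall>x \<in> nodes G. \<forall>y \<in> nodes G. {f x, f y} \<in> edges H \<longleftrightarrow> {x, y} \<in> edges G)"

definition graph_isomorphic :: "'v graph \<Rightarrow> 'w graph \<Rightarrow> bool" where
  "graph_isomorphic G H \<longleftrightarrow> (\<exists>f. is_graph_iso f G H)"

definition lgraph_isomorphic :: "('v, 'l) lgraph \<Rightarrow> ('w, 'l) lgraph \<Rightarrow> bool" where
  "lgraph_isomorphic G H \<longleftrightarrow>
     (\<exists>f. is_graph_iso f G H \<and> (\<forall>x \<in> nodes G. label H (f x) = label G x))"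

text \<open>
  Words describing a graph: number of nodes and adjacency matrix with respect to some listing of
  the nodes; for labelled graphs followed by the list of labels.
\<close>

definition numbering :: "'v list \<Rightarrow> ('v, 'z) graph_scheme \<Rightarrow> bool" where
  "numbering xs G \<longleftrightarrow> distinct xs \<and> set xs = nodes G"

definition adjacency_word :: "('v, 'z) graph_scheme \<Rightarrow> 'v list \<Rightarrow> nat list" where
  "adjacency_word G xs = length xs # [of_bool ({x, y} \<in> edges G). x \<leftarrow> xs, y \<leftarrow> xs]"

definition graph_words :: "'v graph \<Rightarrow> nat list set" where
  "graph_words G = {adjacency_word G xs | xs. numbering xs G}"

definition lgraph_words :: "('l \<Rightarrow> nat) \<Rightarrow> ('v, 'l) lgraph \<Rightarrow> nat list set" where
  "lgraph_words \<phi> G = {adjacency_word G xs @ map (\<lambda>x. \<phi> (label G x)) xs | xs. numbering xs G}"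

definition graph_isomorphism_problem :: problem where
  "graph_isomorphism_problem =
    ({u @ v | u v. \<exists>(G :: nat graph) (H :: nat graph). simple_graph G \<and> simple_graph H \<and>
        u \<in> graph_words G \<and> v \<in> graph_words H},
     {u @ v | u v. \<exists>(G :: nat graph) (H :: nat graph). simple_graph G \<and> simple_graph H \<and>
        u \<in> graph_words G \<and> v \<in> graph_words H \<and> graph_isomorphic G H})"

text \<open>
  Labels only matter up to equality, so an instance presents them by arbitrary names in the natural
  numbers (the labels themselves may be real numbers). Both graphs of an instance use the
  same names, as isomorphisms have to respect labels.
\<close>

definition lgraph_pair_word ::
  "('v, 'l) lgraph \<Rightarrow> ('v, 'l) lgraph \<Rightarrow> nat list \<Rightarrow> bool" where
  "lgraph_pair_word G H w \<longleftrightarrow> (\<exists>\<phi> u v. inj_on \<phi> (label G ` nodes G \<union> label H ` nodes H) \<and>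
     u \<in> lgraph_words \<phi> G \<and> v \<in> lgraph_words \<phi> H \<and> w = u @ v)"

definition isomorphism_problem_on :: "('v, 'l) lgraph set \<Rightarrow> problem" where
  "isomorphism_problem_on C =
    ({w. \<exists>G \<in> C. \<exists>H \<in> C. lgraph_pair_word G H w},
     {w. \<exists>G \<in> C. \<exists>H \<in> C. lgraph_pair_word G H w \<and> lgraph_isomorphic G H})"

definition graph_isomorphism_complete :: "('v, 'l) lgraph set \<Rightarrow> bool" where
  "graph_isomorphism_complete C \<longleftrightarrow>
     poly_reducible (isomorphism_problem_on C) graph_isomorphism_problem \<and>
     poly_reducible graph_isomorphism_problem (isomorphism_problem_on C)"


section \<open>Data of integer linear programs\<close>

definition polyhedron :: "real mat \<Rightarrow> real vec \<Rightarrow> real vec set" where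
  "polyhedron A b = {x \<in> carrier_vec (dim_col A). A *\<^sub>v x \<le> b}"

text \<open>The affine hull of \<open>P\<close> has dimension \<open>n\<close>, i.e. its direction space is all of \<open>\<real>\<^sup>n\<close>.\<close>

definition full_dimensional :: "nat \<Rightarrow> real vec set \<Rightarrow> bool" where
  "full_dimensional n P \<longleftrightarrow> P \<subseteq> carrier_vec n \<and> (\<exists>p \<in> P.
     LinearCombinations.module.span class_ring (module_vec TYPE(real) n) {x - p | x. x \<in> P}
       = carrier_vec n)"

definition has_optimal_solution :: "real mat \<Rightarrow> real vec \<Rightarrow> real vec \<Rightarrow> bool" where
  "has_optimal_solution A b c \<longleftrightarrow>
     (\<exists>x \<in> polyhedron A b. \<forall>y \<in> polyhedron A b. c \<bullet> y \<le> c \<bullet> x)"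

definition ext_coeff :: "real mat \<Rightarrow> real vec \<Rightarrow> nat \<Rightarrow> nat \<Rightarrow> real" where
  "ext_coeff A b i j = (if j < dim_col A then A $$ (i, j) else b $ i)"

definition leading_unit_rows :: "real mat \<Rightarrow> real vec \<Rightarrow> bool" where
  "leading_unit_rows A b \<longleftrightarrow> (\<forall>i < dim_row A. \<exists>j \<le> dim_col A.
     \<bar>ext_coeff A b i j\<bar> = 1 \<and> (\<forall>k < j. ext_coeff A b i k = 0))"

definition coprime_integral_rows :: "real mat \<Rightarrow> real vec \<Rightarrow> bool" where
  "coprime_integral_rows A b \<longleftrightarrow> (\<forall>i < dim_row A. \<exists>z :: nat \<Rightarrow> int.
     (\<forall>j \<le> dim_col A. ext_coeff A b i j = of_int (z j)) \<and> Gcd (z ` {..dim_col A}) = 1)"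

text \<open>The first argument is the convention by which the rows of \<open>(A|b)\<close> are normalized.\<close>

definition admissible_data ::
  "(real mat \<Rightarrow> real vec \<Rightarrow> bool) \<Rightarrow> real mat \<Rightarrow> real vec \<Rightarrow> real vec \<Rightarrow> bool" where
  "admissible_data normalized A b c \<longleftrightarrow>
     dim_vec b = dim_row A \<and> dim_vec c = dim_col A \<and>
     (\<forall>i < dim_row A. row A i \<noteq> 0\<^sub>v (dim_col A)) \<and>
     c \<noteq> 0\<^sub>v (dim_col A) \<and>
     polyhedron A b \<noteq> {} \<and>
     full_dimensional (dim_col A) (polyhedron A b) \<and>
     has_optimal_solution A b c \<and>
     normalized A b \<and>
     (\<forall>i < dim_row A. \<forall>k < dim_row A. row A i = row A k \<and> b $ i = b $ k \<longrightarrow> i = k)"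


section \<open>ILP graphs\<close>

datatype ilp_node =
    Position nat nat
  | Position_Twin nat nat
  | Row nat
  | Column nat
  | Column_Twin nat
  | Coeff_A real
  | Coeff_b real
  | Coeff_c real

datatype ilp_label =
    Position_Label
  | Row_Label
  | Column_Label
  | Coeff_A_Label real
  | Coeff_b_Label real
  | Coeff_c_Label real

fun ilp_node_label :: "ilp_node \<Rightarrow> ilp_label" where
  "ilp_node_label (Position i j) = Position_Label"
| "ilp_node_label (Position_Twin i j) = Position_Label"
| "ilp_node_label (Row i) = Row_Label"
| "ilp_node_label (Column j) = Column_Label"
| "ilp_node_label (Column_Twin j) = Column_Label"
| "ilp_node_label (Coeff_A u) = Coeff_A_Label u"
| "ilp_node_label (Coeff_b v) = Coeff_b_Label v"
| "ilp_node_label (Coeff_c w) = Coeff_c_Label w"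

definition reduced_ilp_graph ::
  "real mat \<Rightarrow> real vec \<Rightarrow> real vec \<Rightarrow> (ilp_node, ilp_label) lgraph" where
  "reduced_ilp_graph A b c = (let m = dim_row A; n = dim_col A in
    \<lparr> nodes =
        {Position i j | i j. i < m \<and> j < n} \<union> {Row i | i. i < m} \<union> {Column j | j. j < n} \<union>
        {Coeff_A (A $$ (i, j)) | i j. i < m \<and> j < n} \<union>
        {Coeff_b (b $ i) | i. i < m} \<union> {Coeff_c (c $ j) | j. j < n},
      edges =
        {{Position i j, Row i} | i j. i < m \<and> j < n} \<union>
        {{Position i j, Column j} | i j. i < m \<and> j < n} \<union>
        {{Position i j, Coeff_A (A $$ (i, j))} | i j. i < m \<and> j < n} \<union>
        {{Row i, Coeff_b (b $ i)} | i. i < m} \<union>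
        {{Column j, Coeff_c (c $ j)} | j. j < n},
      label = ilp_node_label \<rparr>)"

definition hat_position :: "real mat \<Rightarrow> nat \<Rightarrow> nat \<Rightarrow> ilp_node" where
  "hat_position A i j = (if A $$ (i, j) = 0 then Position i j else Position_Twin i j)"

definition ilp_graph ::
  "real mat \<Rightarrow> real vec \<Rightarrow> real vec \<Rightarrow> (ilp_node, ilp_label) lgraph" where
  "ilp_graph A b c = (let m = dim_row A; n = dim_col A; G' = reduced_ilp_graph A b c in
    \<lparr> nodes = nodes G' \<union>
        {hat_position A i j | i j. i < m \<and> j < n} \<union> {Column_Twin j | j. j < n} \<union>
        {Coeff_A (- A $$ (i, j)) | i j. i < m \<and> j < n \<and> A $$ (i, j) \<noteq> 0} \<union>
        {Coeff_c (- c $ j) | j. j < n \<and> c $ j \<noteq> 0},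
      edges = edges G' \<union>
        {{hat_position A i j, Row i} | i j. i < m \<and> j < n} \<union>
        {{hat_position A i j, Column_Twin j} | i j. i < m \<and> j < n} \<union>
        {{hat_position A i j, Coeff_A (- A $$ (i, j))} | i j. i < m \<and> j < n} \<union>
        {{Position i j, hat_position A i j} | i j. i < m \<and> j < n \<and> A $$ (i, j) \<noteq> 0} \<union>
        {{Column_Twin j, Coeff_c (- c $ j)} | j. j < n} \<union>
        {{Column j, Column_Twin j} | j. j < n},
      label = ilp_node_label \<rparr>)"

definition ilp_graphs ::
  "(real mat \<Rightarrow> real vec \<Rightarrow> bool) \<Rightarrow> (ilp_node, ilp_label) lgraph set" where
  "ilp_graphs normalized = {ilp_graph A b c | A b c. admissible_data normalized A b c}"

definition reduced_ilp_graphs ::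
  "(real mat \<Rightarrow> real vec \<Rightarrow> bool) \<Rightarrow> (ilp_node, ilp_label) lgraph set" where
  "reduced_ilp_graphs normalized =
     {reduced_ilp_graph A b c | A b c. admissible_data normalized A b c}"

end

theory Submission
  imports Defs
begin

text \<open>
  \<^bold>\<open>From ILP graphs to graphs.\<close>  Labels are replaced by pendant nodes: the labels of both graphs of an
  instance are listed jointly, and a node whose label occurs last at position \<open>r\<close> of this list receives
  \<open>r + 2\<close> pendant neighbours.  Original nodes are then recognisable by having degree at least two, and
  their labels by the number of neighbours of smaller degree.  This only uses that the graphs
  have no loops.

  \<^bold>\<open>From graphs to ILP graphs.\<close>  A graph on \<open>n\<close> nodes is encoded in an \<open>(n + 2) \<times> (n + 2)\<close> matrix whose
  lower right block holds \<open>1\<close> for a non-edge, \<open>2\<close> for an edge and \<open>3\<close> on the diagonal.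
  The first column consists of ones, so the rows are normalised in either sense; the first
  row equals \<open>c\<close> and has right hand side \<open>1\<close>, so the first unit vector is optimal.
  The second row and column make every coefficient occur even for \<open>n = 0\<close>, so that the number of
  nodes and the set of labels of the ILP graph depend on \<open>n\<close> only.
  An isomorphism of (reduced) ILP graphs permutes rows and columns and preserves coefficients
  up to sign, hence exactly, as they are positive.  It fixes row 0 because of \<open>b\<close> and column 1 because
  of \<open>c\<close>, and the entries \<open>3\<close> force it to permute rows and columns in the same way.
\<close>

section \<open>Timed execution\<close>

text \<open>Label names are arbitrary numbers, possibly exponential in the size of the word, so a
  name cannot itself serve as a number of pendant nodes. Its rank in the joint list is bounded by
  the number of nodes and can still be compared across the two graphs. The summand 2 gives even an
  isolated original node degree at least two.

  In the gadget, an isomorphism could a priori permute rows and columns independently, as nothing in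
  the graph of a matrix ties row \<open>i\<close> to column \<open>i\<close>; this is the obstacle
  that the diagonal overcomes. The corner must be 1 like the rest of the first column, so row 0
  carries no 3 and needs \<open>b\<close> to single it out; row 1 is pinned only indirectly, through
  column 1 and the entry 3 that they share. Positivity of all data also puts the whole nonpositive
  orthant into the polyhedron.

  Both reductions are programs that must halt in polynomial time on every word, instance or not,
  hence the guards on announced sizes. Since a yes-instance only asserts that some pair of graphs
  fits the word, the word must moreover be shown to determine the answer.\<close>

definition bounded_memory :: "nat \<Rightarrow> memory \<Rightarrow> bool" where
  "bounded_memory K s \<longleftrightarrow> 0 < K \<and> (\<forall>a i. log_size (s a i) \<le> K)"

text \<open>The costs of the operands dominate the binary length of the result, whence the factor 2.
  A cell adds only 1, since \<open>bounded_memory\<close> limits stored values; intermediate values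
  are not assumed to obey that limit.\<close>

fun cost_weight :: "aexp \<Rightarrow> nat" where
  "cost_weight (Const k) = log_size k"
| "cost_weight (Cell a e) = cost_weight e + 1"
| "cost_weight (Add e1 e2) = 2 * (cost_weight e1 + cost_weight e2)"
| "cost_weight (Sub e1 e2) = 2 * (cost_weight e1 + cost_weight e2)"
| "cost_weight (Mult e1 e2) = 2 * (cost_weight e1 + cost_weight e2)"
| "cost_weight (Div e1 e2) = 2 * (cost_weight e1 + cost_weight e2)"

text \<open>The bound for \<open>While\<close> is only valid for loops with at most \<open>K\<close> iterations.\<close>

fun time_bound :: "cmd \<Rightarrow> nat \<Rightarrow> nat" where
  "time_bound Skip K = 1"
| "time_bound (Store a i e) K = 1 + cost_weight i * K + cost_weight e * K"
| "time_bound (Seq p q) K = time_bound p K + time_bound q K"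
| "time_bound (Cond e p q) K = 1 + cost_weight e * K + time_bound p K + time_bound q K"
| "time_bound (While e p) K = (K + 1) * (1 + cost_weight e * K + time_bound p K)"

lemma time_bound_poly: "\<exists>q :: nat poly. \<forall>K. time_bound p K = poly q K"
proof (induction p)
  case Skip
  then show ?case by (intro exI[of _ 1]) simp
next
  case (Store a i e)
  then show ?case
    by (intro exI[of _ "[:1, cost_weight i + cost_weight e:]"]) (simp add: algebra_simps)
next
  case (Seq p q)
  then obtain P Q :: "nat poly" where "\<forall>K. time_bound p K = poly P K" "\<forall>K. time_bound q K = poly Q K"
    by auto
  then show ?case by (intro exI[of _ "P + Q"]) simp
next
  case (Cond e p q)
  then obtain P Q :: "nat poly" where "\<forall>K. time_bound p K = poly P K" "\<forall>K. time_bound q K = poly Q K"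
    by auto
  then show ?case by (intro exI[of _ "[:1, cost_weight e:] + P + Q"]) (simp add: algebra_simps)
next
  case (While e p)
  then obtain P :: "nat poly" where "\<forall>K. time_bound p K = poly P K"
    by auto
  then show ?case by (intro exI[of _ "[:1, 1:] * ([:1, cost_weight e:] + P)"]) (simp add: algebra_simps)
qed

section \<open>Binary length and evaluation cost\<close>

lemma log_size_mono: "x \<le> y \<Longrightarrow> log_size x \<le> log_size y"
  by (simp add: log_size_def floorlog_mono)

lemma log_size_le_Suc: "log_size x \<le> Suc x"
proof -
  have "x < 2 ^ x" by (rule less_exp)
  then have "floorlog 2 x \<le> x" by (simp add: floorlog_le_iff)
  then show ?thesis by (simp add: log_size_def)
qed

text \<open>The possible carry bit is paid for by the extra \<open>1\<close> that
  \<open>log_size\<close> grants to each of the two operands.\<close>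

lemma log_size_add: "log_size (x + y) \<le> log_size x + log_size y"
proof -
  have "x < 2 ^ floorlog 2 x" "y < 2 ^ floorlog 2 y"
    using floorlog_leD[of 2 x "floorlog 2 x"] floorlog_leD[of 2 y "floorlog 2 y"] by auto
  moreover have "(2::nat) ^ floorlog 2 x \<le> 2 ^ (floorlog 2 x + floorlog 2 y)"
    "(2::nat) ^ floorlog 2 y \<le> 2 ^ (floorlog 2 x + floorlog 2 y)"
    by (simp_all add: power_increasing)
  ultimately have "x + y < 2 * 2 ^ (floorlog 2 x + floorlog 2 y)"
    by linarith
  then have "x + y < 2 ^ (floorlog 2 x + floorlog 2 y + 1)"
    by simp
  then have "floorlog 2 (x + y) \<le> floorlog 2 x + floorlog 2 y + 1"
    by (simp add: floorlog_le_iff)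
  then show ?thesis by (simp add: log_size_def)
qed

lemma log_size_mult: "log_size (x * y) \<le> log_size x + log_size y"
proof -
  have "x < 2 ^ floorlog 2 x" "y < 2 ^ floorlog 2 y"
    using floorlog_leD[of 2 x "floorlog 2 x"] floorlog_leD[of 2 y "floorlog 2 y"] by auto
  then have "x * y < 2 ^ (floorlog 2 x + floorlog 2 y)"
    unfolding power_add by (simp add: mult_strict_mono)
  then have "floorlog 2 (x * y) \<le> floorlog 2 x + floorlog 2 y"
    by (simp add: floorlog_le_iff)
  then show ?thesis by (simp add: log_size_def)
qed

lemma log_size_val_le: "log_size (val e s) \<le> eval_cost e s"
  by (cases e) auto

lemma eval_cost_le:
  assumes "bounded_memory K s"
  shows "eval_cost e s \<le> cost_weight e * K"
proof (induction e)
  case (Const k)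
  then show ?case using assms by (simp add: bounded_memory_def)
next
  case (Cell a e)
  have "log_size (s a (val e s)) \<le> K" using assms by (simp add: bounded_memory_def)
  then show ?case using Cell by simp
next
  case (Add e1 e2)
  then show ?case
    using log_size_add[of "val e1 s" "val e2 s"] log_size_val_le[of e1 s] log_size_val_le[of e2 s]
    by (simp add: algebra_simps)
next
  case (Sub e1 e2)
  then show ?case
    using log_size_mono[of "val e1 s - val e2 s" "val e1 s"] log_size_val_le[of e1 s]
    by (simp add: algebra_simps)
next
  case (Mult e1 e2)
  then show ?case
    using log_size_mult[of "val e1 s" "val e2 s"] log_size_val_le[of e1 s] log_size_val_le[of e2 s]
    by (simp add: algebra_simps)
next
  case (Div e1 e2)
  then show ?case
    using log_size_mono[of "val e1 s div val e2 s" "val e1 s"] log_size_val_le[of e1 s]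
    by (simp add: algebra_simps)
qed

text \<open>A total-correctness triple. The memory bound is part of the postcondition because
  \<open>eval_cost_le\<close> needs it for the next command; the same \<open>K\<close> limits the
  iterations counted in \<open>time_bound\<close>.\<close>

definition timed :: "nat \<Rightarrow> cmd \<Rightarrow> memory \<Rightarrow> (memory \<Rightarrow> bool) \<Rightarrow> bool" where
  "timed K p s Q \<longleftrightarrow> (\<exists>t s'. exec p s t s' \<and> t \<le> time_bound p K \<and> bounded_memory K s' \<and> Q s')"

lemma timed_mono: "timed K p s Q \<Longrightarrow> (\<And>s'. bounded_memory K s' \<Longrightarrow> Q s' \<Longrightarrow> R s') \<Longrightarrow> timed K p s R"
  unfolding timed_def by blast

lemma timed_Skip: "bounded_memory K s \<Longrightarrow> Q s \<Longrightarrow> timed K Skip s Q"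
  unfolding timed_def by (intro exI[of _ 1] exI[of _ s]) (use exec_Skip[of s] in simp)

lemma bounded_memory_upd:
  "bounded_memory K s \<Longrightarrow> log_size x \<le> K \<Longrightarrow> bounded_memory K (s(a := (s a)(i := x)))"
  by (auto simp: bounded_memory_def)

lemma timed_Store:
  assumes "bounded_memory K s" "log_size (val e s) \<le> K" "Q (s(a := (s a)(val i s := val e s)))"
  shows "timed K (Store a i e) s Q"
  unfolding timed_def
proof (intro exI conjI)
  show "exec (Store a i e) s (1 + eval_cost i s + eval_cost e s) (s(a := (s a)(val i s := val e s)))"
    by (rule exec_Store)
  show "1 + eval_cost i s + eval_cost e s \<le> time_bound (Store a i e) K"
    using eval_cost_le[OF assms(1), of i] eval_cost_le[OF assms(1), of e] by simp
qed (use assms bounded_memory_upd in auto)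

lemma timed_Seq:
  assumes "timed K p s P" "\<And>s'. bounded_memory K s' \<Longrightarrow> P s' \<Longrightarrow> timed K q s' Q"
  shows "timed K (Seq p q) s Q"
proof -
  obtain t s' where 1: "exec p s t s'" "t \<le> time_bound p K" "bounded_memory K s'" "P s'"
    using assms(1) unfolding timed_def by blast
  obtain t' s'' where 2: "exec q s' t' s''" "t' \<le> time_bound q K" "bounded_memory K s''" "Q s''"
    using assms(2)[OF 1(3,4)] unfolding timed_def by blast
  show ?thesis unfolding timed_def
    by (intro exI[of _ "t + t'"] exI[of _ s'']) (use 1 2 exec_Seq in auto)
qed

lemma timed_Cond:
  assumes "bounded_memory K s"
    "val e s \<noteq> 0 \<Longrightarrow> timed K p s Q" "val e s = 0 \<Longrightarrow> timed K q s Q"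
  shows "timed K (Cond e p q) s Q"
proof (cases "val e s = 0")
  case True
  then obtain t s' where "exec q s t s'" "t \<le> time_bound q K" "bounded_memory K s'" "Q s'"
    using assms(3) unfolding timed_def by blast
  then show ?thesis unfolding timed_def
    using exec_Cond_False[OF True, of q t s' p] eval_cost_le[OF assms(1), of e]
    by (intro exI[of _ "1 + eval_cost e s + t"] exI[of _ s']) auto
next
  case False
  then obtain t s' where "exec p s t s'" "t \<le> time_bound p K" "bounded_memory K s'" "Q s'"
    using assms(2) unfolding timed_def by blast
  then show ?thesis unfolding timed_def
    using exec_Cond_True[OF False, of p t s' q] eval_cost_le[OF assms(1), of e]
    by (intro exI[of _ "1 + eval_cost e s + t"] exI[of _ s']) auto
qed

text \<open>The invariant is indexed by the completed rounds and decides the loop condition, so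
  exactly \<open>N\<close> rounds take place.\<close>

lemma timed_While:
  assumes "bounded_memory K s" "I 0 s" "N \<le> K"
    and "\<And>k s. k \<le> N \<Longrightarrow> bounded_memory K s \<Longrightarrow> I k s \<Longrightarrow> val e s \<noteq> 0 \<longleftrightarrow> k < N"
    and "\<And>k s. k < N \<Longrightarrow> bounded_memory K s \<Longrightarrow> I k s \<Longrightarrow> timed K p s (I (Suc k))"
  shows "timed K (While e p) s (I N)"
proof -
  let ?b = "1 + cost_weight e * K + time_bound p K"
  \<comment> \<open>Induction on the number \<open>d\<close> of remaining rounds;
    \<open>d + 1\<close> also counts the final failing test.\<close>
  have "\<exists>t s'. exec (While e p) s t s' \<and> t \<le> (d + 1) * ?b \<and> bounded_memory K s' \<and> I N s'"
    if "d + k = N" "bounded_memory K s" "I k s" for d k s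
    using that
  proof (induction d arbitrary: k s)
    case 0
    then have "val e s = 0" using assms(4)[of k s] by simp
    then show ?case
      using 0 eval_cost_le[of K s e] exec_While_False[of e s p]
      by (intro exI[of _ "1 + eval_cost e s"] exI[of _ s]) auto
  next
    case (Suc d)
    then have ne: "val e s \<noteq> 0" using assms(4)[of k s] by simp
    obtain t s' where 1: "exec p s t s'" "t \<le> time_bound p K" "bounded_memory K s'" "I (Suc k) s'"
      using assms(5)[of k s] Suc.prems unfolding timed_def by auto
    obtain t' s'' where 2: "exec (While e p) s' t' s''" "t' \<le> (d + 1) * ?b" "bounded_memory K s''" "I N s''"
      using Suc.IH[of "Suc k" s'] Suc.prems(1) 1 by auto
    have "1 + eval_cost e s + t + t' \<le> (Suc d + 1) * ?b"
      using eval_cost_le[OF Suc.prems(2), of e] 1(2) 2(2) by simp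
    then show ?case using exec_While_True[OF ne 1(1) 2(1)] 2 by blast
  qed
  from this[of N 0 s] assms(1,2) obtain t s' where
    r: "exec (While e p) s t s'" "t \<le> (N + 1) * ?b" "bounded_memory K s'" "I N s'" by auto
  have "(N + 1) * ?b \<le> time_bound (While e p) K"
    using assms(3) by (simp only: time_bound.simps) (intro mult_right_mono, auto)
  then show ?thesis using r unfolding timed_def by (meson order_trans)
qed

section \<open>Counted loops and lists stored in arrays\<close>

abbreviation Scalar :: "nat \<Rightarrow> aexp" where
  "Scalar v \<equiv> Cell v (Const 0)"

abbreviation assign :: "nat \<Rightarrow> aexp \<Rightarrow> cmd" where
  "assign v \<equiv> Store v (Const 0)"

text \<open>Truncated subtraction makes the condition nonzero exactly while the counter is below
  \<open>cnt\<close>. The bound is evaluated anew in every round, so the body has to leave its value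
  unchanged.\<close>

definition for_loop :: "nat \<Rightarrow> aexp \<Rightarrow> cmd \<Rightarrow> cmd" where
  "for_loop v cnt p = Seq (assign v (Const 0))
     (While (Sub cnt (Scalar v)) (Seq p (assign v (Add (Scalar v) (Const 1)))))"

definition list_at :: "nat \<Rightarrow> memory \<Rightarrow> nat list" where
  "list_at a s = map (\<lambda>i. s a (Suc i)) [0..<s a 0]"

text \<open>The entry is written before the length is raised, as its address is computed from the
  old length. Cell 0 holds the length, so entry \<open>i\<close> lives in cell
  \<open>i + 1\<close>.\<close>

definition append_to :: "nat \<Rightarrow> aexp \<Rightarrow> cmd" where
  "append_to a e = Seq (Store a (Add (Scalar a) (Const 1)) e) (assign a (Add (Scalar a) (Const 1)))"

definition agree_except :: "nat set \<Rightarrow> memory \<Rightarrow> memory \<Rightarrow> bool" where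
  "agree_except V s s' \<longleftrightarrow> (\<forall>a. a \<notin> V \<longrightarrow> s' a = s a)"

lemma agree_exceptD: "agree_except V s s' \<Longrightarrow> a \<notin> V \<Longrightarrow> s' a = s a"
  by (simp add: agree_except_def)

lemma length_list_at [simp]: "length (list_at a s) = s a 0"
  by (simp add: list_at_def)

lemma nth_list_at: "i < s a 0 \<Longrightarrow> s a (Suc i) = list_at a s ! i"
  by (simp add: list_at_def)

lemma timed_append:
  assumes "bounded_memory K s" "log_size (val e s) \<le> K" "s a 0 + 1 < K"
    and "\<And>s'. agree_except {a} s s' \<Longrightarrow> list_at a s' = list_at a s @ [val e s] \<Longrightarrow> Q s'"
  shows "timed K (append_to a e) s Q"
  unfolding append_to_def
proof (rule timed_Seq)
  let ?s1 = "s(a := (s a)(Suc (s a 0) := val e s))"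
  show "timed K (Store a (Add (Scalar a) (Const 1)) e) s (\<lambda>s'. s' = ?s1)"
    by (rule timed_Store) (use assms in auto)
  fix s' assume b: "bounded_memory K s'" and s': "s' = ?s1"
  show "timed K (assign a (Add (Scalar a) (Const 1))) s' Q"
  proof (rule timed_Store)
    show "log_size (val (Add (Scalar a) (Const 1)) s') \<le> K"
      using log_size_le_Suc[of "Suc (s a 0)"] assms(3) by (simp add: s')
    show "Q (s'(a := (s' a)(val (Const 0) s' := val (Add (Scalar a) (Const 1)) s')))"
      by (rule assms(4)) (auto simp: s' agree_except_def list_at_def)
  qed fact
qed

text \<open>The body is specified by the invariant as it stands after the increment, so that the
  invariant may mention the counter itself.\<close>

lemma timed_for_loop:
  assumes "bounded_memory K s" "N + 1 < K" "I 0 (s(v := (s v)(0 := 0)))"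
    and "\<And>k s. k \<le> N \<Longrightarrow> I k s \<Longrightarrow> s v 0 = k \<and> val cnt s = N"
    and "\<And>k s. k < N \<Longrightarrow> bounded_memory K s \<Longrightarrow> I k s \<Longrightarrow>
           timed K p s (\<lambda>s'. s' v 0 = k \<and> I (Suc k) (s'(v := (s' v)(0 := Suc k))))"
  shows "timed K (for_loop v cnt p) s (I N)"
  unfolding for_loop_def
proof (rule timed_Seq)
  let ?s1 = "s(v := (s v)(0 := 0))"
  show "timed K (assign v (Const 0)) s (\<lambda>s'. s' = ?s1)"
    by (rule timed_Store) (use assms(1,2) log_size_le_Suc[of 0] in auto)
  fix s' assume b: "bounded_memory K s'" and s': "s' = ?s1"
  show "timed K (While (Sub cnt (Scalar v)) (Seq p (assign v (Add (Scalar v) (Const 1))))) s' (I N)"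
  proof (rule timed_While)
    show "I 0 s'" using assms(3) s' by simp
    show "N \<le> K" using assms(2) by simp
    show "(val (Sub cnt (Scalar v)) s \<noteq> 0) = (k < N)" if "k \<le> N" "I k s" for k s
      using assms(4)[OF that] that(1) by auto
    show "timed K (Seq p (assign v (Add (Scalar v) (Const 1)))) s (I (Suc k))"
      if k: "k < N" "bounded_memory K s" "I k s" for k s
    proof (rule timed_Seq[OF assms(5)[OF k]])
      fix s' assume "bounded_memory K s'" "s' v 0 = k \<and> I (Suc k) (s'(v := (s' v)(0 := Suc k)))"
      then show "timed K (assign v (Add (Scalar v) (Const 1))) s' (I (Suc k))"
        using k(1) assms(2) log_size_le_Suc[of "Suc k"] by (intro timed_Store) auto
    qed
  qed fact
qed

text \<open>The list may be read while it grows, hence the hypothesis on \<open>list_at a s'\<close>.\<close>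

lemma timed_filter_loop:
  assumes "bounded_memory K s" "N + 1 < K" "s a 0 + N + 1 < K" "a \<noteq> v"
    and cnt: "\<And>s'. agree_except {a, v} s s' \<Longrightarrow> val cnt s' = N"
    and e: "\<And>k s'. k < N \<Longrightarrow> agree_except {a, v} s s' \<Longrightarrow> s' v 0 = k \<Longrightarrow>
        list_at a s' = list_at a s @ map F (filter P [0..<k]) \<Longrightarrow>
        (val g s' \<noteq> 0 \<longleftrightarrow> P k) \<and> (P k \<longrightarrow> val e s' = F k \<and> log_size (F k) \<le> K)"
    and Q: "\<And>s'. agree_except {a, v} s s' \<Longrightarrow>
        list_at a s' = list_at a s @ map F (filter P [0..<N]) \<Longrightarrow> Q s'"
  shows "timed K (for_loop v cnt (Cond g (append_to a e) Skip)) s Q"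
proof (rule timed_mono)
  let ?I = "\<lambda>k s'. agree_except {a, v} s s' \<and> s' v 0 = k \<and>
    list_at a s' = list_at a s @ map F (filter P [0..<k])"
  show "timed K (for_loop v cnt (Cond g (append_to a e) Skip)) s (?I N)"
  proof (rule timed_for_loop)
    show "?I 0 (s(v := (s v)(0 := 0)))"
      using assms(4) by (auto simp: agree_except_def list_at_def)
    fix k s' assume k: "k < N" and b: "bounded_memory K s'" and I: "?I k s'"
    have v: "(val g s' \<noteq> 0 \<longleftrightarrow> P k) \<and> (P k \<longrightarrow> val e s' = F k \<and> log_size (F k) \<le> K)"
      by (rule e) (use k I in auto)
    have upd: "agree_except {a, v} s (s''(v := (s'' v)(0 := Suc k)))" if "agree_except {a} s' s''" for s''
      using that I by (auto simp: agree_except_def)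
    have upd2: "list_at a (s''(v := (s'' v)(0 := Suc k))) = list_at a s''" for s''
      using assms(4) by (simp add: list_at_def)
    \<comment> \<open>At most one entry is appended per round, which keeps the length cell within
      the memory bound.\<close>
    have "s' a 0 = length (list_at a s')" by simp
    also have "\<dots> = s a 0 + length (filter P [0..<k])" using I by simp
    also have "\<dots> \<le> s a 0 + k" using length_filter_le[of P "[0..<k]"] by simp
    finally have len: "s' a 0 + 1 < K" using k assms(3) by simp
    show "timed K (Cond g (append_to a e) Skip) s'
      (\<lambda>s'. s' v 0 = k \<and> ?I (Suc k) (s'(v := (s' v)(0 := Suc k))))"
    proof (rule timed_Cond)
      assume "val g s' \<noteq> 0"
      with v have P: "P k" "val e s' = F k" "log_size (F k) \<le> K" by auto
      show "timed K (append_to a e) s' (\<lambda>s'. s' v 0 = k \<and> ?I (Suc k) (s'(v := (s' v)(0 := Suc k))))"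
      proof (rule timed_append)
        fix s'' assume s'': "agree_except {a} s' s''" "list_at a s'' = list_at a s' @ [val e s']"
        have "s'' v 0 = k" using s''(1) I assms(4) by (simp add: agree_except_def)
        then show "s'' v 0 = k \<and> ?I (Suc k) (s''(v := (s'' v)(0 := Suc k)))"
          using upd[OF s''(1)] upd2[of s''] s''(2) I P by simp
      qed (use b P len in auto)
    next
      assume "val g s' = 0"
      then have "\<not> P k" using v by simp
      then show "timed K Skip s' (\<lambda>s'. s' v 0 = k \<and> ?I (Suc k) (s'(v := (s' v)(0 := Suc k))))"
        using upd[of s'] upd2[of s'] I b by (intro timed_Skip) (auto simp: agree_except_def)
    qed fact
  qed (use assms(1,2) cnt in auto)
qed (use Q in auto)

lemma timed_append_loop:
  assumes "bounded_memory K s" "s a 0 + N + 1 < K" "a \<noteq> v"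
    and "\<And>s'. agree_except {a, v} s s' \<Longrightarrow> val cnt s' = N"
    and "\<And>k s'. k < N \<Longrightarrow> agree_except {a, v} s s' \<Longrightarrow> s' v 0 = k \<Longrightarrow>
        list_at a s' = list_at a s @ map F [0..<k] \<Longrightarrow> val e s' = F k \<and> log_size (F k) \<le> K"
    and "\<And>s'. agree_except {a, v} s s' \<Longrightarrow> list_at a s' = list_at a s @ map F [0..<N] \<Longrightarrow> Q s'"
  shows "timed K (for_loop v cnt (Cond (Const 1) (append_to a e) Skip)) s Q"
  by (rule timed_filter_loop[where P = "\<lambda>_. True" and N = N and F = F]) (use assms in auto)

subsection \<open>Programs running in polynomial time\<close>

lemma read_output_eq: "read_output s = list_at 1 s"
  by (simp add: read_output_def list_at_def)

lemma log_size_nth_le_word_size: "i < length w \<Longrightarrow> log_size (w ! i) \<le> word_size w"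
  unfolding word_size_def by (rule member_le_sum_list) auto

lemma length_le_word_size: "length w \<le> word_size w"
proof -
  have "(\<Sum>k\<leftarrow>w. 1) \<le> (\<Sum>k\<leftarrow>w. log_size k)"
    by (rule sum_list_mono) (simp add: log_size_def)
  then show ?thesis by (simp add: word_size_def sum_list_triv)
qed

lemma bounded_init_memory:
  assumes "word_size w < K"
  shows "bounded_memory K (init_memory w)"
  unfolding bounded_memory_def
proof (intro conjI allI)
  show "0 < K" using assms by simp
  fix a i
  have "log_size (length w) \<le> K" using log_size_le_Suc[of "length w"] length_le_word_size[of w] assms by simp
  moreover have "log_size (w ! j) \<le> K" if "j < length w" for j
    using log_size_nth_le_word_size[OF that] assms by simp
  moreover have "log_size 0 \<le> K" using log_size_le_Suc[of 0] assms by simp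
  ultimately show "log_size (init_memory w a i) \<le> K"
    by (auto simp: init_memory_def nth_Cons split: nat.split)
qed

text \<open>The value of \<open>k\<close> is the memory bound \<open>K\<close>. The running time is
  then polynomial in \<open>K\<close>, and the output consists of at most \<open>K\<close> cells of
  binary length at most \<open>K\<close>, whence the polynomial
  \<open>pcompose q k + k * k\<close>.\<close>

lemma poly_time_computableI:
  fixes k :: "nat poly"
  assumes "\<And>w. word_size w < poly k (word_size w)"
    and "\<And>w. timed (poly k (word_size w)) p (init_memory w)
      (\<lambda>s. list_at 1 s = f w \<and> s 1 0 \<le> poly k (word_size w))"
  shows "poly_time_computable f"
proof -
  obtain q :: "nat poly" where q: "\<And>K. time_bound p K = poly q K"
    using time_bound_poly by blast
  show ?thesis unfolding poly_time_computable_def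
  proof (rule exI[of _ p], rule exI[of _ "pcompose q k + k * k"], rule allI)
    fix w
    let ?K = "poly k (word_size w)"
    obtain t s where ts: "exec p (init_memory w) t s" "t \<le> poly q ?K" "bounded_memory ?K s"
      "list_at 1 s = f w" "s 1 0 \<le> ?K"
      using assms(2)[of w] unfolding timed_def q by blast
    have "word_size (f w) \<le> (\<Sum>x\<leftarrow>f w. ?K)"
      unfolding word_size_def[of "f w"]
    proof (rule sum_list_mono)
      fix x assume "x \<in> set (f w)"
      then show "log_size x \<le> ?K"
        using ts(3) by (auto simp: ts(4)[symmetric] list_at_def bounded_memory_def)
    qed
    also have "\<dots> = length (f w) * ?K" by (simp add: sum_list_triv)
    also have "\<dots> \<le> ?K * ?K" using ts(5) by (simp add: ts(4)[symmetric])
    finally have "t + word_size (f w) \<le> poly (pcompose q k + k * k) (word_size w)"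
      using ts(2) by (simp add: poly_pcompose)
    then show "\<exists>t s. exec p (init_memory w) t s \<and> read_output s = f w \<and>
        t + word_size (f w) \<le> poly (pcompose q k + k * k) (word_size w)"
      using ts by (auto simp: read_output_eq)
  qed
qed

section \<open>Expressions\<close>

definition EMod :: "aexp \<Rightarrow> aexp \<Rightarrow> aexp" where
  "EMod e1 e2 = Sub e1 (Mult (Div e1 e2) e2)"

definition ENot :: "aexp \<Rightarrow> aexp" where
  "ENot e = Sub (Const 1) e"

definition ELeq :: "aexp \<Rightarrow> aexp \<Rightarrow> aexp" where
  "ELeq e1 e2 = ENot (Sub e1 e2)"

definition EEq :: "aexp \<Rightarrow> aexp \<Rightarrow> aexp" where
  "EEq e1 e2 = ENot (Add (Sub e1 e2) (Sub e2 e1))"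

abbreviation EAnd :: "aexp \<Rightarrow> aexp \<Rightarrow> aexp" where
  "EAnd \<equiv> Mult"

text \<open>The double negation normalizes the value to 0 or 1, so that it can be written to the
  output as a matrix entry.\<close>

definition EOr :: "aexp \<Rightarrow> aexp \<Rightarrow> aexp" where
  "EOr e1 e2 = ENot (ENot (Add e1 e2))"

definition EIf :: "aexp \<Rightarrow> aexp \<Rightarrow> aexp \<Rightarrow> aexp" where
  "EIf c e1 e2 = Add (Mult (ENot (ENot c)) e1) (Mult (ENot c) e2)"

lemma val_EMod [simp]: "val (EMod e1 e2) s = val e1 s mod val e2 s"
  by (simp add: EMod_def minus_div_mult_eq_mod)

lemma val_ENot [simp]: "val (ENot e) s = of_bool (val e s = 0)"
  by (simp add: ENot_def)

lemma val_ELeq [simp]: "val (ELeq e1 e2) s = of_bool (val e1 s \<le> val e2 s)"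
  by (simp add: ELeq_def)

lemma val_EEq [simp]: "val (EEq e1 e2) s = of_bool (val e1 s = val e2 s)"
  by (auto simp: EEq_def)

lemma val_EOr [simp]: "val (EOr e1 e2) s = of_bool (val e1 s \<noteq> 0 \<or> val e2 s \<noteq> 0)"
  by (auto simp: EOr_def)

lemma val_EIf [simp]:
  "val (EIf c e1 e2) s = (if val c s \<noteq> 0 then val e1 s else val e2 s)"
  by (auto simp: EIf_def)

section \<open>Isomorphism in terms of numberings\<close>

lemma numbering_bij:
  "numbering xs G \<Longrightarrow> bij_betw ((!) xs) {..<length xs} (nodes G)"
  by (simp add: numbering_def bij_betw_nth)

abbreviation edge_at :: "('v, 'z) graph_scheme \<Rightarrow> 'v list \<Rightarrow> nat \<Rightarrow> nat \<Rightarrow> bool" where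
  "edge_at G xs i j \<equiv> {xs ! i, xs ! j} \<in> edges G"

text \<open>Isomorphism in the form visible in a word: a bijection between positions of two
  listings. Unlabelled graphs are covered by the constant label \<open>()\<close>.\<close>

definition index_isomorphic ::
  "nat \<Rightarrow> (nat \<Rightarrow> nat \<Rightarrow> bool) \<Rightarrow> (nat \<Rightarrow> 'l) \<Rightarrow> nat \<Rightarrow> (nat \<Rightarrow> nat \<Rightarrow> bool) \<Rightarrow> (nat \<Rightarrow> 'l) \<Rightarrow> bool" where
  "index_isomorphic n E l n' E' l' \<longleftrightarrow> (\<exists>\<pi>. bij_betw \<pi> {..<n} {..<n'} \<and>
     (\<forall>i<n. \<forall>j<n. E' (\<pi> i) (\<pi> j) \<longleftrightarrow> E i j) \<and> (\<forall>i<n. l' (\<pi> i) = l i))"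

lemma index_isomorphicI:
  assumes xs: "numbering xs G" and ys: "numbering ys H" and f: "is_graph_iso f G H"
    and l: "\<forall>x \<in> nodes G. l' (f x) = l x"
  shows "index_isomorphic (length xs) (edge_at G xs) (\<lambda>i. l (xs ! i))
    (length ys) (edge_at H ys) (\<lambda>i. l' (ys ! i))"
proof -
  let ?\<pi> = "inv_into {..<length ys} ((!) ys) \<circ> f \<circ> (!) xs"
  have yb: "bij_betw ((!) ys) {..<length ys} (nodes H)" by (rule numbering_bij[OF ys])
  have bf: "bij_betw f (nodes G) (nodes H)" using f by (simp add: is_graph_iso_def)
  have bij: "bij_betw ?\<pi> {..<length xs} {..<length ys}"
    using bij_betw_trans[OF bij_betw_trans[OF numbering_bij[OF xs] bf] bij_betw_inv_into[OF yb]]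
    by (simp add: comp_assoc)
  have x: "xs ! i \<in> nodes G" if "i < length xs" for i
    using bij_betw_apply[OF numbering_bij[OF xs]] that by simp
  have ys_nth: "ys ! ?\<pi> i = f (xs ! i)" if "i < length xs" for i
    using bij_betw_inv_into_right[OF yb bij_betw_apply[OF bf x[OF that]]] by simp
  have "edge_at H ys (?\<pi> i) (?\<pi> j) \<longleftrightarrow> edge_at G xs i j" if "i < length xs" "j < length xs" for i j
    using that f x by (simp only: is_graph_iso_def ys_nth)
  moreover have "l' (ys ! ?\<pi> i) = l (xs ! i)" if "i < length xs" for i
    using ys_nth[OF that] l x[OF that] by simp
  ultimately show ?thesis
    unfolding index_isomorphic_def using bij by blast
qed

lemma index_isomorphicD:
  assumes xs: "numbering xs G" and ys: "numbering ys H"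
    and iso: "index_isomorphic (length xs) (edge_at G xs) (\<lambda>i. l (xs ! i))
      (length ys) (edge_at H ys) (\<lambda>i. l' (ys ! i))"
  obtains f where "is_graph_iso f G H" "\<forall>x \<in> nodes G. l' (f x) = l x"
proof -
  obtain \<pi> where bij: "bij_betw \<pi> {..<length xs} {..<length ys}"
    and E: "\<And>i j. i < length xs \<Longrightarrow> j < length xs \<Longrightarrow> edge_at H ys (\<pi> i) (\<pi> j) \<longleftrightarrow> edge_at G xs i j"
    and L: "\<And>i. i < length xs \<Longrightarrow> l' (ys ! \<pi> i) = l (xs ! i)"
    using iso unfolding index_isomorphic_def by blast
  let ?h = "inv_into {..<length xs} ((!) xs)"
  let ?f = "(!) ys \<circ> \<pi> \<circ> ?h"
  have bx: "bij_betw ((!) xs) {..<length xs} (nodes G)" by (rule numbering_bij[OF xs])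
  have bij: "bij_betw ?f (nodes G) (nodes H)"
    using bij_betw_trans[OF bij_betw_inv_into[OF bx] bij_betw_trans[OF bij numbering_bij[OF ys]]]
    by (simp add: comp_assoc)
  have h: "?h x < length xs" "xs ! ?h x = x" if "x \<in> nodes G" for x
    using bij_betw_apply[OF bij_betw_inv_into[OF bx] that] bij_betw_inv_into_right[OF bx that] by auto
  show thesis
  proof (rule that)
    show "is_graph_iso ?f G H"
      unfolding is_graph_iso_def using bij E[OF h(1) h(1)] h(2) by simp
    show "\<forall>x \<in> nodes G. l' (?f x) = l x" using L[OF h(1)] h(2) by simp
  qed
qed

lemma graph_isomorphic_iff_index:
  assumes "numbering xs G" "numbering ys H"
  shows "graph_isomorphic G H \<longleftrightarrow> index_isomorphic (length xs) (edge_at G xs) (\<lambda>_. ())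
    (length ys) (edge_at H ys) (\<lambda>_. ())"
  unfolding graph_isomorphic_def
  using index_isomorphicI[OF assms, where l = "\<lambda>_. ()" and l' = "\<lambda>_. ()"]
    index_isomorphicD[OF assms, where l = "\<lambda>_. ()" and l' = "\<lambda>_. ()"] by auto

text \<open>Injectivity on the labels of both graphs together lets equality of names across the
  graphs stand for equality of labels.\<close>

lemma lgraph_isomorphic_iff_index:
  assumes "numbering xs G" "numbering ys H" and inj: "inj_on \<phi> (label G ` nodes G \<union> label H ` nodes H)"
  shows "lgraph_isomorphic G H \<longleftrightarrow>
    index_isomorphic (length xs) (edge_at G xs) (\<lambda>i. map (\<lambda>x. \<phi> (label G x)) xs ! i)
      (length ys) (edge_at H ys) (\<lambda>i. map (\<lambda>x. \<phi> (label H x)) ys ! i)" (is "_ \<longleftrightarrow> ?I")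
proof -
  let ?J = "index_isomorphic (length xs) (edge_at G xs) (\<lambda>i. \<phi> (label G (xs ! i)))
      (length ys) (edge_at H ys) (\<lambda>i. \<phi> (label H (ys ! i)))"
  have IJ: "?I \<longleftrightarrow> ?J"
    unfolding index_isomorphic_def
    by (intro arg_cong[where f = Ex] ext conj_cong refl) (auto dest!: bij_betwE)
  have lab: "\<phi> (label H (f x)) = \<phi> (label G x) \<longleftrightarrow> label H (f x) = label G x"
    if "is_graph_iso f G H" "x \<in> nodes G" for f x
  proof -
    have "f x \<in> nodes H" using that bij_betw_apply by (fastforce simp: is_graph_iso_def)
    then show ?thesis using inj_on_eq_iff[OF inj, of "label H (f x)" "label G x"] that(2) by blast
  qed
  show ?thesis
    unfolding IJ lgraph_isomorphic_def
  proof
    assume "\<exists>f. is_graph_iso f G H \<and> (\<forall>x\<in>nodes G. label H (f x) = label G x)"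
    then obtain f where "is_graph_iso f G H" "\<forall>x\<in>nodes G. label H (f x) = label G x" by blast
    then show ?J
      by (intro index_isomorphicI[OF assms(1,2), where l = "\<lambda>x. \<phi> (label G x)"
            and l' = "\<lambda>x. \<phi> (label H x)"]) auto
  next
    assume ?J
    then obtain f where f: "is_graph_iso f G H" "\<forall>x\<in>nodes G. \<phi> (label H (f x)) = \<phi> (label G x)"
      by (rule index_isomorphicD[OF assms(1,2), where l = "\<lambda>x. \<phi> (label G x)"
            and l' = "\<lambda>x. \<phi> (label H x)"])
    then show "\<exists>f. is_graph_iso f G H \<and> (\<forall>x\<in>nodes G. label H (f x) = label G x)"
      using lab by auto
  qed
qed

section \<open>Words determine graphs up to isomorphism\<close>

lemma product_upt_eq: "[f i j. i \<leftarrow> [0..<n], j \<leftarrow> [0..<m]] = map (\<lambda>k. f (k div m) (k mod m)) [0..<n * m]"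
proof (induction n)
  case (Suc n)
  have "map (\<lambda>k. f (k div m) (k mod m)) [n * m..<n * m + m] = map (\<lambda>j. f n j) [0..<m]"
    by (rule nth_equalityI) auto
  then show ?case
    using Suc upt_add_eq_append[of 0 "n * m" m] by (simp add: add.commute)
qed simp

lemma product_nth_eq:
  "[f x y. x \<leftarrow> xs, y \<leftarrow> ys] =
    map (\<lambda>k. f (xs ! (k div length ys)) (ys ! (k mod length ys))) [0..<length xs * length ys]"
proof -
  have "[f x y. x \<leftarrow> xs, y \<leftarrow> ys] =
      [f x y. x \<leftarrow> map ((!) xs) [0..<length xs], y \<leftarrow> map ((!) ys) [0..<length ys]]"
    by (simp only: map_nth)
  also have "\<dots> = [f (xs ! i) (ys ! j). i \<leftarrow> [0..<length xs], j \<leftarrow> [0..<length ys]]"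
    by (simp add: comp_def)
  finally show ?thesis using product_upt_eq[of "\<lambda>i j. f (xs ! i) (ys ! j)"] by simp
qed

lemma adjacency_word_eq:
  "adjacency_word G xs = length xs # map (\<lambda>k. of_bool (edge_at G xs (k div length xs) (k mod length xs)))
     [0..<length xs * length xs]"
  unfolding adjacency_word_def product_nth_eq ..

lemma length_adjacency_word [simp]: "length (adjacency_word G xs) = Suc (length xs * length xs)"
  by (simp add: adjacency_word_eq)

lemma adjacency_word_nth_0 [simp]: "adjacency_word G xs ! 0 = length xs"
  by (simp add: adjacency_word_eq)

lemma index_pair_less: "i < n \<Longrightarrow> j < n \<Longrightarrow> i * n + j < n * (n :: nat)"
proof -
  assume "i < n" "j < n"
  then have "i * n + j < Suc i * n" "Suc i * n \<le> n * n" by (simp, intro mult_right_mono) auto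
  then show ?thesis by linarith
qed

lemma index_pair_div: "j < n \<Longrightarrow> (i * n + j) div n = i \<and> (i * n + j) mod n = (j :: nat)"
  by (cases "n = 0") auto

lemma div_mod_less: "k < n * n \<Longrightarrow> k div n < n \<and> k mod n < (n :: nat)"
  by (cases "n = 0") (auto simp: less_mult_imp_div_less)

lemma adjacency_word_nth:
  assumes "i < length xs" "j < length xs"
  shows "adjacency_word G xs ! Suc (i * length xs + j) = of_bool (edge_at G xs i j)"
  using index_pair_less[OF assms] index_pair_div[OF assms(2)] by (simp add: adjacency_word_eq)

text \<open>The leading node count fixes the length of an adjacency word, so it can be split off a
  concatenation in only one way.\<close>

lemma adjacency_words_append_eq:
  assumes "adjacency_word G xs @ u = adjacency_word G' xs' @ u'"
  shows "length xs = length xs'" "u = u'"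
    "i < length xs \<Longrightarrow> j < length xs \<Longrightarrow> edge_at G xs i j \<longleftrightarrow> edge_at G' xs' i j"
proof -
  from assms show len: "length xs = length xs'"
    by (simp add: adjacency_word_eq)
  with assms have *: "adjacency_word G xs = adjacency_word G' xs'" "u = u'"
    by (simp_all add: append_eq_append_conv)
  then show "u = u'" by simp
  assume "i < length xs" "j < length xs"
  then have "(of_bool (edge_at G xs i j) :: nat) = of_bool (edge_at G' xs' i j)"
    using adjacency_word_nth[of i xs j G] adjacency_word_nth[of i xs' j G'] * len by simp
  then show "edge_at G xs i j \<longleftrightarrow> edge_at G' xs' i j" by (simp add: of_bool_eq_iff)
qed

text \<open>Labels are only compared across the two sides, so anything that preserves these
  comparisons may replace them; this is how ranks take the place of names.\<close>

lemma index_isomorphic_cong: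
  assumes "\<And>i j. i < n \<Longrightarrow> j < n \<Longrightarrow> E i j \<longleftrightarrow> F i j"
    and "\<And>i j. i < n' \<Longrightarrow> j < n' \<Longrightarrow> E' i j \<longleftrightarrow> F' i j"
    and "\<And>i j. i < n \<Longrightarrow> j < n' \<Longrightarrow> l' j = l i \<longleftrightarrow> k' j = k i"
  shows "index_isomorphic n E l n' E' l' \<longleftrightarrow> index_isomorphic n F k n' F' k'"
  unfolding index_isomorphic_def
  by (intro arg_cong[where f = Ex] ext conj_cong refl) (use assms in \<open>auto dest!: bij_betwE\<close>)

text \<open>Being a yes-instance only asserts that some isomorphic pair yields the word; by this
  lemma every pair yielding the word gives the same answer.\<close>

lemma graph_isomorphic_cong_word:
  assumes "numbering xs G" "numbering ys H" "numbering xs' G'" "numbering ys' H'"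
    and w: "adjacency_word G xs @ adjacency_word H ys = adjacency_word G' xs' @ adjacency_word H' ys'"
  shows "graph_isomorphic G H \<longleftrightarrow> graph_isomorphic G' H'"
proof -
  note 1 = adjacency_words_append_eq[OF w]
  have "adjacency_word H ys @ [] = adjacency_word H' ys' @ []" using 1(2) by simp
  note 2 = adjacency_words_append_eq[OF this]
  show ?thesis
    unfolding graph_isomorphic_iff_index[OF assms(1,2)] graph_isomorphic_iff_index[OF assms(3,4)]
      1(1)[symmetric] 2(1)[symmetric]
    by (rule index_isomorphic_cong) (use 1(3) 2(3) in auto)
qed

text \<open>The graph isomorphism problem is stated for nodes in \<open>nat\<close>. Graphs over
  other types, such as pendant graphs on pairs, enter it through the positions of their
  nodes.\<close>

lemma nat_graph_of_word:
  fixes G :: "'v graph"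
  assumes "simple_graph G" "numbering xs G"
  obtains G' :: "nat graph" where "simple_graph G'" "numbering [0..<length xs] G'"
    "adjacency_word G' [0..<length xs] = adjacency_word G xs"
proof -
  let ?n = "length xs"
  define G' :: "nat graph" where
    "G' = \<lparr>nodes = {..<?n}, edges = {{i, j} | i j. i < ?n \<and> j < ?n \<and> edge_at G xs i j}\<rparr>"
  have ne: "\<not> edge_at G xs i i" for i
    using assms(1) by (auto simp: simple_graph_def)
  then have "i \<noteq> j" if "edge_at G xs i j" for i j
    using that by metis
  then have s: "simple_graph G'"
    unfolding simple_graph_def G'_def by auto
  have "{i, j} \<in> edges G' \<longleftrightarrow> edge_at G xs i j" if "i < ?n" "j < ?n" for i j
    using that by (auto simp: G'_def doubleton_eq_iff insert_commute)
  then have "edge_at G' [0..<?n] (k div ?n) (k mod ?n) \<longleftrightarrow> edge_at G xs (k div ?n) (k mod ?n)"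
    if "k < ?n * ?n" for k
    using div_mod_less[OF that] by simp
  then have w: "adjacency_word G' [0..<?n] = adjacency_word G xs"
    unfolding adjacency_word_eq by simp
  have "numbering [0..<?n] G'"
    by (auto simp: numbering_def G'_def)
  then show thesis using s w that by blast
qed

lemma graph_isomorphism_problem_word:
  fixes G :: "'v graph" and H :: "'w graph"
  assumes "simple_graph G" "numbering xs G" "simple_graph H" "numbering ys H"
  shows "adjacency_word G xs @ adjacency_word H ys \<in> fst graph_isomorphism_problem"
    and "adjacency_word G xs @ adjacency_word H ys \<in> snd graph_isomorphism_problem \<longleftrightarrow>
      graph_isomorphic G H"
proof -
  let ?w = "adjacency_word G xs @ adjacency_word H ys"
  obtain G' :: "nat graph" where G': "simple_graph G'" "numbering [0..<length xs] G'"
    "adjacency_word G' [0..<length xs] = adjacency_word G xs"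
    using nat_graph_of_word[OF assms(1,2)] .
  obtain H' :: "nat graph" where H': "simple_graph H'" "numbering [0..<length ys] H'"
    "adjacency_word H' [0..<length ys] = adjacency_word H ys"
    using nat_graph_of_word[OF assms(3,4)] .
  have gw: "adjacency_word G xs \<in> graph_words G'" "adjacency_word H ys \<in> graph_words H'"
    using G' H' unfolding graph_words_def by (metis (mono_tags, lifting) mem_Collect_eq)+
  then show "?w \<in> fst graph_isomorphism_problem"
    unfolding graph_isomorphism_problem_def fst_conv using G'(1) H'(1) by blast
  have iso: "graph_isomorphic G H \<longleftrightarrow> graph_isomorphic G' H'"
    by (rule graph_isomorphic_cong_word[OF assms(2,4) G'(2) H'(2)]) (simp add: G'(3) H'(3))
  show "?w \<in> snd graph_isomorphism_problem \<longleftrightarrow> graph_isomorphic G H"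
  proof
    assume "graph_isomorphic G H"
    then have "graph_isomorphic G' H'" using iso by simp
    then show "?w \<in> snd graph_isomorphism_problem"
      unfolding graph_isomorphism_problem_def snd_conv using G'(1) H'(1) gw by blast
  next
    assume "?w \<in> snd graph_isomorphism_problem"
    then obtain G2 H2 :: "nat graph" and u v where 2: "graph_isomorphic G2 H2" "?w = u @ v"
      "u \<in> graph_words G2" "v \<in> graph_words H2"
      unfolding graph_isomorphism_problem_def snd_conv by blast
    then obtain xs2 ys2 where "numbering xs2 G2" "numbering ys2 H2"
      "u = adjacency_word G2 xs2" "v = adjacency_word H2 ys2"
      unfolding graph_words_def by blast
    with 2 have "numbering xs2 G2" "numbering ys2 H2"
      "?w = adjacency_word G2 xs2 @ adjacency_word H2 ys2" "graph_isomorphic G2 H2"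
      by simp_all
    then show "graph_isomorphic G H"
      using graph_isomorphic_cong_word[OF assms(2,4), of xs2 G2 ys2 H2] by simp
  qed
qed

lemma graph_isomorphism_problem_instance:
  assumes "w \<in> fst graph_isomorphism_problem"
  obtains G H :: "nat graph" and xs ys where "simple_graph G" "numbering xs G" "simple_graph H"
    "numbering ys H" "w = adjacency_word G xs @ adjacency_word H ys"
proof -
  obtain G H :: "nat graph" and u v where *: "w = u @ v" "simple_graph G" "simple_graph H"
    "u \<in> graph_words G" "v \<in> graph_words H"
    using assms unfolding graph_isomorphism_problem_def by auto
  then obtain xs ys where "numbering xs G" "numbering ys H"
    "u = adjacency_word G xs" "v = adjacency_word H ys"
    unfolding graph_words_def by auto
  then show thesis using * that by blast
qed

definition lgraph_word :: "('l \<Rightarrow> nat) \<Rightarrow> ('v, 'l) lgraph \<Rightarrow> 'v list \<Rightarrow> nat list" where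
  "lgraph_word \<phi> G xs = adjacency_word G xs @ map (\<lambda>x. \<phi> (label G x)) xs"

lemma lgraph_pair_word_iff:
  "lgraph_pair_word G H w \<longleftrightarrow> (\<exists>\<phi> xs ys. inj_on \<phi> (label G ` nodes G \<union> label H ` nodes H) \<and>
     numbering xs G \<and> numbering ys H \<and> w = lgraph_word \<phi> G xs @ lgraph_word \<phi> H ys)"
  unfolding lgraph_pair_word_def lgraph_words_def lgraph_word_def by blast

text \<open>The two readings may use different namings, but each is injective on its own labels and
  both produce the same list of numbers, so they agree on which labels coincide.\<close>

lemma lgraph_isomorphic_cong_word:
  assumes "lgraph_pair_word G H w" "lgraph_pair_word G' H' w"
  shows "lgraph_isomorphic G H \<longleftrightarrow> lgraph_isomorphic G' H'"
proof -
  obtain \<phi> xs ys where a: "numbering xs G" "numbering ys H"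
    "inj_on \<phi> (label G ` nodes G \<union> label H ` nodes H)" "w = lgraph_word \<phi> G xs @ lgraph_word \<phi> H ys"
    using assms(1) unfolding lgraph_pair_word_iff by blast
  obtain \<phi>' xs' ys' where b: "numbering xs' G'" "numbering ys' H'"
    "inj_on \<phi>' (label G' ` nodes G' \<union> label H' ` nodes H')"
    "w = lgraph_word \<phi>' G' xs' @ lgraph_word \<phi>' H' ys'"
    using assms(2) unfolding lgraph_pair_word_iff by blast
  have "adjacency_word G xs @ (map (\<lambda>x. \<phi> (label G x)) xs @ lgraph_word \<phi> H ys) =
    adjacency_word G' xs' @ (map (\<lambda>x. \<phi>' (label G' x)) xs' @ lgraph_word \<phi>' H' ys')"
    using a(4) b(4) by (simp add: lgraph_word_def)
  note 1 = adjacency_words_append_eq[OF this]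
  have l1: "map (\<lambda>x. \<phi> (label G x)) xs = map (\<lambda>x. \<phi>' (label G' x)) xs'"
    and w2: "lgraph_word \<phi> H ys = lgraph_word \<phi>' H' ys'"
    using 1(1,2) by (simp_all add: append_eq_append_conv)
  note 2 = adjacency_words_append_eq[OF w2[unfolded lgraph_word_def]]
  show ?thesis
    unfolding lgraph_isomorphic_iff_index[OF a(1-3)] lgraph_isomorphic_iff_index[OF b(1-3)]
      1(1)[symmetric] 2(1)[symmetric] l1 2(2)
    by (rule index_isomorphic_cong) (use 1(3) 2(3) in auto)
qed

lemma isomorphism_problem_on_word:
  assumes "G \<in> C" "H \<in> C" "lgraph_pair_word G H w"
  shows "w \<in> fst (isomorphism_problem_on C)"
    and "w \<in> snd (isomorphism_problem_on C) \<longleftrightarrow> lgraph_isomorphic G H"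
  using assms lgraph_isomorphic_cong_word[of G H w] unfolding isomorphism_problem_on_def by auto

section \<open>Encoding labels by pendant nodes\<close>

definition neighbours :: "('v, 'z) graph_scheme \<Rightarrow> 'v \<Rightarrow> 'v set" where
  "neighbours G p = {q \<in> nodes G. {p, q} \<in> edges G}"

lemma iso_neighbours:
  assumes "is_graph_iso f G H" "p \<in> nodes G"
  shows "f ` neighbours G p = neighbours H (f p)"
proof -
  have H: "nodes H = f ` nodes G" using assms(1) by (simp add: is_graph_iso_def bij_betw_def)
  have "{f p, f q} \<in> edges H \<longleftrightarrow> {p, q} \<in> edges G" if "q \<in> nodes G" for q
    using assms that by (simp add: is_graph_iso_def)
  then show ?thesis unfolding neighbours_def H by auto
qed

text \<open>Degrees are invariant under isomorphism, hence so is this set. In a pendant graph it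
  recovers the original nodes, and their neighbours outside it are the pendants encoding the
  label.\<close>

definition core :: "('v, 'z) graph_scheme \<Rightarrow> 'v set" where
  "core G = {p \<in> nodes G. 2 \<le> card (neighbours G p)}"

lemma iso_core:
  assumes f: "is_graph_iso f G H"
  shows "f ` core G = core H" "bij_betw f (core G) (core H)"
    "p \<in> core G \<Longrightarrow> card (neighbours H (f p) - core H) = card (neighbours G p - core G)"
proof -
  have b: "f ` nodes G = nodes H" "inj_on f (nodes G)"
    using f by (auto simp: is_graph_iso_def bij_betw_def)
  have inj: "inj_on f (neighbours G p)" for p
    by (rule inj_on_subset[OF b(2)]) (auto simp: neighbours_def)
  have "card (neighbours H (f p)) = card (neighbours G p)" if "p \<in> nodes G" for p
    using card_image[OF inj] iso_neighbours[OF f that] by metis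
  then show core: "f ` core G = core H" unfolding core_def b(1)[symmetric] by auto
  have sub: "core G \<subseteq> nodes G" by (auto simp: core_def)
  show "bij_betw f (core G) (core H)"
    using core inj_on_subset[OF b(2) sub] by (simp add: bij_betw_def)
  assume "p \<in> core G"
  then have p: "p \<in> nodes G" using sub by auto
  have "f ` (neighbours G p - core G) = neighbours H (f p) - core H"
    unfolding iso_neighbours[OF f p, symmetric] core[symmetric]
    by (rule inj_on_image_set_diff[OF b(2)]) (use sub in \<open>auto simp: neighbours_def\<close>)
  then show "card (neighbours H (f p) - core H) = card (neighbours G p - core G)"
    using card_image[OF inj_on_subset[OF inj[of p], of "neighbours G p - core G"]] by simp
qed

text \<open>Pendant graphs and gadgets both present their edges by arcs listed in one direction;
  adjacency is the symmetric closure.\<close>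

lemma doubleton_mem_iff:
  "p \<in> N \<Longrightarrow> q \<in> N \<Longrightarrow> {p, q} \<in> {{p, q} | p q. p \<in> N \<and> q \<in> N \<and> A p q} \<longleftrightarrow> A p q \<or> A q p"
proof
  assume "{p, q} \<in> {{p, q} | p q. p \<in> N \<and> q \<in> N \<and> A p q}"
  then obtain p' q' where "{p, q} = {p', q'}" "A p' q'" by blast
  then show "A p q \<or> A q p" by (metis doubleton_eq_iff)
qed (use insert_commute in blast)

fun pendant_arc :: "(nat \<Rightarrow> nat \<Rightarrow> bool) \<Rightarrow> (nat \<Rightarrow> nat) \<Rightarrow> nat \<times> nat \<Rightarrow> nat \<times> nat \<Rightarrow> bool" where
  "pendant_arc E t (x, k) (y, l) \<longleftrightarrow> k = 0 \<and> l = 0 \<and> E x y \<or> x = y \<and> k = 0 \<and> 0 < l \<and> l \<le> t x"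

text \<open>The pairs \<open>(x, k)\<close> with \<open>t x < k\<close> are isolated; they make the node set a product,
  hence easy to number.\<close>

definition pendant_graph ::
  "nat \<Rightarrow> (nat \<Rightarrow> nat \<Rightarrow> bool) \<Rightarrow> (nat \<Rightarrow> nat) \<Rightarrow> nat \<Rightarrow> (nat \<times> nat) graph" where
  "pendant_graph n E t R = \<lparr>nodes = {..<n} \<times> {..<R},
     edges = {{p, q} | p q. p \<in> {..<n} \<times> {..<R} \<and> q \<in> {..<n} \<times> {..<R} \<and> pendant_arc E t p q}\<rparr>"

text \<open>With \<open>2 \<le> t x\<close> every original node has degree at least two, even an
  isolated one; \<open>t x < R\<close> leaves room for the pendants \<open>(x, 1)\<close> to
  \<open>(x, t x)\<close> in the product.\<close>

locale pendant =
  fixes n :: nat and E :: "nat \<Rightarrow> nat \<Rightarrow> bool" and t :: "nat \<Rightarrow> nat" and R :: nat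
  assumes E_sym: "x < n \<Longrightarrow> y < n \<Longrightarrow> E x y \<longleftrightarrow> E y x"
    and E_irrefl: "x < n \<Longrightarrow> \<not> E x x"
    and t_ge: "x < n \<Longrightarrow> 2 \<le> t x" and t_less: "x < n \<Longrightarrow> t x < R"
begin

abbreviation "G \<equiv> pendant_graph n E t R"

lemma edge_iff:
  "(x, k) \<in> nodes G \<Longrightarrow> (y, l) \<in> nodes G \<Longrightarrow> {(x, k), (y, l)} \<in> edges G \<longleftrightarrow>
    k = 0 \<and> l = 0 \<and> E x y \<or> x = y \<and> (k = 0 \<and> 0 < l \<and> l \<le> t x \<or> l = 0 \<and> 0 < k \<and> k \<le> t x)"
proof -
  assume N: "(x, k) \<in> nodes G" "(y, l) \<in> nodes G"
  then have "{(x, k), (y, l)} \<in> edges G \<longleftrightarrow>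
      pendant_arc E t (x, k) (y, l) \<or> pendant_arc E t (y, l) (x, k)"
    unfolding pendant_graph_def graph.simps by (rule doubleton_mem_iff)
  moreover have "x < n" "y < n" using N by (auto simp: pendant_graph_def)
  ultimately show ?thesis
    using E_sym[of x y] by (cases "x = y"; cases "k = 0"; cases "l = 0"; simp)
qed

lemma simple: "simple_graph G"
proof -
  have "p \<noteq> q" if "p \<in> {..<n} \<times> {..<R}" "pendant_arc E t p q" for p q
    using that E_irrefl by (cases p; cases q) auto
  then have "card {p, q} = 2" if "p \<in> {..<n} \<times> {..<R}" "pendant_arc E t p q" for p q
    using that by (simp add: card_insert_if)
  then show ?thesis
    unfolding simple_graph_def pendant_graph_def graph.simps by blast
qed

lemma neighbours_leaf: "(x, k) \<in> nodes G \<Longrightarrow> 0 < k \<Longrightarrow> neighbours G (x, k) \<subseteq> {(x, 0)}"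
proof
  fix q assume "(x, k) \<in> nodes G" "0 < k" "q \<in> neighbours G (x, k)"
  moreover obtain y l where "q = (y, l)" by fastforce
  ultimately show "q \<in> {(x, 0)}"
    using edge_iff[of x k y l] by (simp add: neighbours_def)
qed

lemma leaves_subset: "x < n \<Longrightarrow> {x} \<times> {1..t x} \<subseteq> neighbours G (x, 0)"
proof -
  assume x: "x < n"
  then have N: "(x, l) \<in> nodes G" if "l \<le> t x" for l
    using that t_less[OF x] by (simp add: pendant_graph_def)
  show ?thesis
    using edge_iff[OF N N] N by (auto simp: neighbours_def)
qed

lemma core_eq: "core G = {..<n} \<times> {0}"
proof -
  have fin: "finite (neighbours G p)" for p
    by (rule finite_subset[of _ "nodes G"]) (auto simp: neighbours_def pendant_graph_def)
  have "2 \<le> card (neighbours G (x, 0))" if "x < n" for x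
    using card_mono[OF fin leaves_subset[OF that]] t_ge[OF that] by simp
  moreover have "\<not> 2 \<le> card (neighbours G (x, k))" if "(x, k) \<in> nodes G" "0 < k" for x k
    using card_mono[OF _ neighbours_leaf[OF that]] by simp
  moreover have "(x, 0) \<in> nodes G" if "x < n" for x
    using that t_less[OF that] by (simp add: pendant_graph_def)
  ultimately show ?thesis
    unfolding core_def by (auto simp: pendant_graph_def)
qed

lemma card_leaves: "x < n \<Longrightarrow> card (neighbours G (x, 0) - core G) = t x"
proof -
  assume x: "x < n"
  have N0: "(x, 0) \<in> nodes G" using x t_less[OF x] by (simp add: pendant_graph_def)
  have "neighbours G (x, 0) - core G \<subseteq> {x} \<times> {1..t x}"
  proof
    fix q assume q: "q \<in> neighbours G (x, 0) - core G"
    obtain y l where yl: "q = (y, l)" by fastforce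
    then have N: "(y, l) \<in> nodes G" and e: "{(x, 0), (y, l)} \<in> edges G"
      using q by (simp_all add: neighbours_def)
    have "y < n" using N by (simp add: pendant_graph_def)
    then have "0 < l" using q unfolding core_eq yl by auto
    then show "q \<in> {x} \<times> {1..t x}"
      using e edge_iff[OF N0 N] unfolding yl by auto
  qed
  moreover have "{x} \<times> {1..t x} \<subseteq> neighbours G (x, 0) - core G"
    using leaves_subset[OF x] unfolding core_eq by auto
  ultimately have "neighbours G (x, 0) - core G = {x} \<times> {1..t x}" by blast
  then show ?thesis by simp
qed

end

text \<open>One direction restricts an isomorphism to the cores and counts pendants. The other acts
  on first components only; the common \<open>R\<close> makes the pendants and isolated pairs of
  both graphs correspond.\<close>

lemma pendant_graph_isomorphic_iff:
  assumes "pendant n E t R" "pendant n' E' t' R"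
  shows "graph_isomorphic (pendant_graph n E t R) (pendant_graph n' E' t' R) \<longleftrightarrow>
    index_isomorphic n E t n' E' t'"
proof
  interpret P: pendant n E t R by fact
  interpret Q: pendant n' E' t' R by fact
  assume "graph_isomorphic (pendant_graph n E t R) (pendant_graph n' E' t' R)"
  then obtain f where f: "is_graph_iso f P.G Q.G" by (auto simp: graph_isomorphic_def)
  note fc = iso_core[OF f, unfolded P.core_eq Q.core_eq]
  define \<pi> where "\<pi> x = fst (f (x, 0))" for x
  have fx: "f (x, 0) = (\<pi> x, 0)" "\<pi> x < n'" if "x < n" for x
  proof -
    have "f (x, 0) \<in> f ` ({..<n} \<times> {0})" using that by (intro imageI) simp
    then have "f (x, 0) \<in> {..<n'} \<times> {0}" unfolding fc(1) .
    then show "f (x, 0) = (\<pi> x, 0)" "\<pi> x < n'" by (cases "f (x, 0)"; simp add: \<pi>_def)+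
  qed
  have b: "bij_betw \<pi> {..<n} {..<n'}"
  proof -
    have "bij_betw (\<lambda>x. (x, 0)) {..<m} ({..<m} \<times> {0})" for m :: nat
      by (auto simp: bij_betw_def inj_on_def)
    moreover have "bij_betw fst ({..<n'} \<times> {0 :: nat}) {..<n'}"
      by (auto simp: bij_betw_def inj_on_def)
    ultimately have "bij_betw (fst \<circ> (f \<circ> (\<lambda>x. (x, 0)))) {..<n} {..<n'}"
      using fc(2) by (blast intro: bij_betw_trans)
    then show ?thesis by (simp add: \<pi>_def[abs_def] comp_def)
  qed
  have nodes: "(x, 0) \<in> nodes P.G" if "x < n" for x
  proof -
    have "(x, 0) \<in> core P.G" unfolding P.core_eq using that by simp
    then show ?thesis by (simp add: core_def)
  qed
  have nodes': "(x, 0) \<in> nodes Q.G" if "x < n'" for x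
  proof -
    have "(x, 0) \<in> core Q.G" unfolding Q.core_eq using that by simp
    then show ?thesis by (simp add: core_def)
  qed
  have "E' (\<pi> x) (\<pi> y) \<longleftrightarrow> E x y" if "x < n" "y < n" for x y
  proof -
    have "{f (x, 0), f (y, 0)} \<in> edges Q.G \<longleftrightarrow> {(x, 0), (y, 0)} \<in> edges P.G"
      using f nodes that by (simp add: is_graph_iso_def)
    then show ?thesis
      using P.edge_iff[OF nodes nodes, OF that]
        Q.edge_iff[OF nodes' nodes', OF fx(2) fx(2), OF that] fx(1)[OF that(1)] fx(1)[OF that(2)]
      by simp
  qed
  moreover have "t' (\<pi> x) = t x" if "x < n" for x
    using iso_core(3)[OF f, of "(x, 0)"] that P.core_eq fx[OF that]
      P.card_leaves[OF that] Q.card_leaves[OF fx(2)[OF that]] by simp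
  ultimately show "index_isomorphic n E t n' E' t'"
    unfolding index_isomorphic_def using b by blast
next
  interpret P: pendant n E t R by fact
  interpret Q: pendant n' E' t' R by fact
  assume "index_isomorphic n E t n' E' t'"
  then obtain \<pi> where b: "bij_betw \<pi> {..<n} {..<n'}"
    and E: "\<And>i j. i < n \<Longrightarrow> j < n \<Longrightarrow> E' (\<pi> i) (\<pi> j) \<longleftrightarrow> E i j"
    and T: "\<And>i. i < n \<Longrightarrow> t' (\<pi> i) = t i"
    unfolding index_isomorphic_def by blast
  let ?f = "map_prod \<pi> id :: nat \<times> nat \<Rightarrow> _"
  have bf: "bij_betw ?f (nodes P.G) (nodes Q.G)"
    unfolding pendant_graph_def using b by (auto intro!: bij_betw_map_prod)
  have inj: "\<pi> x = \<pi> y \<longleftrightarrow> x = y" if "x < n" "y < n" for x y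
    using b that by (auto simp: bij_betw_def inj_on_def)
  have "{?f p, ?f q} \<in> edges Q.G \<longleftrightarrow> {p, q} \<in> edges P.G" if "p \<in> nodes P.G" "q \<in> nodes P.G" for p q
  proof -
    obtain x k y l where pq: "p = (x, k)" "q = (y, l)" by fastforce
    have xy: "x < n" "y < n" using that by (auto simp: pq pendant_graph_def)
    have "?f p \<in> nodes Q.G" "?f q \<in> nodes Q.G" using that by (auto intro: bij_betw_apply[OF bf])
    then show ?thesis
      using that P.edge_iff[of x k y l] Q.edge_iff[of "\<pi> x" k "\<pi> y" l] E[OF xy] T[OF xy(1)] inj[OF xy]
      by (simp add: pq)
  qed
  then show "graph_isomorphic (pendant_graph n E t R) (pendant_graph n' E' t' R)"
    unfolding graph_isomorphic_def is_graph_iso_def using bf by blast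
qed

section \<open>Ranking labels\<close>

text \<open>\<open>last_match L k\<close> scans the pairs \<open>(x, y)\<close> encoded by \<open>0, \<dots>, k\<close> for matching entries and
  returns \<open>y\<close> for the last one.  At the end of row \<open>x\<close> this is the last position holding
  the same entry as position \<open>x\<close>.\<close>

fun last_match :: "nat list \<Rightarrow> nat \<Rightarrow> nat" where
  "last_match L k = (if L ! (k div length L) = L ! (k mod length L) then k mod length L
     else if k = 0 then 0 else last_match L (k - 1))"

declare last_match.simps [simp del]

definition rank :: "nat list \<Rightarrow> nat \<Rightarrow> nat" where
  "rank L x = last_match L (x * length L + (length L - 1))"

text \<open>From the pair \<open>(x, x)\<close> on, row \<open>x\<close> has met at least the match
  of \<open>x\<close> with itself, so no value carried over from earlier rows survives.\<close>

lemma last_match_row: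
  assumes "x \<le> y" "y < length L"
  shows "last_match L (x * length L + y) = Max {z. z \<le> y \<and> L ! z = L ! x}"
  using assms
proof (induction y rule: dec_induct)
  case base
  have "Max {z. z \<le> x \<and> L ! z = L ! x} = x" by (rule Max_eqI) auto
  then show ?case using index_pair_div[of x "length L" x] base by (subst last_match.simps) simp
next
  case (step y)
  then have y: "Suc y < length L" by simp
  show ?case
  proof (cases "L ! Suc y = L ! x")
    case True
    then have "Max {z. z \<le> Suc y \<and> L ! z = L ! x} = Suc y" by (intro Max_eqI) auto
    then show ?thesis using True index_pair_div[OF y, of x]
      by (subst last_match.simps) (simp del: add_Suc_right)
  next
    case False
    then have "{z. z \<le> Suc y \<and> L ! z = L ! x} = {z. z \<le> y \<and> L ! z = L ! x}"
      by (auto simp: le_Suc_eq)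
    moreover have "last_match L (x * length L + Suc y) = last_match L (x * length L + y)"
      using False index_pair_div[OF y, of x] by (subst last_match.simps) (simp del: add_Suc_right)
    ultimately show ?thesis using step by simp
  qed
qed

lemma rank_eq: "x < length L \<Longrightarrow> rank L x = Max {z. z < length L \<and> L ! z = L ! x}"
proof -
  assume x: "x < length L"
  then have "z \<le> length L - 1 \<longleftrightarrow> z < length L" for z by auto
  then show ?thesis unfolding rank_def using x last_match_row[of x "length L - 1" L] by simp
qed

lemma rank_less: "x < length L \<Longrightarrow> rank L x < length L"
  and nth_rank: "x < length L \<Longrightarrow> L ! rank L x = L ! x"
proof -
  assume x: "x < length L"
  have "rank L x \<in> {z. z < length L \<and> L ! z = L ! x}"
    unfolding rank_eq[OF x] by (rule Max_in) (use x in auto)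
  then show "rank L x < length L" "L ! rank L x = L ! x" by auto
qed

text \<open>The rank is a canonical position among those with the same entry: it depends on the
  entry only, and it holds that entry itself.\<close>

lemma rank_eq_iff: "x < length L \<Longrightarrow> y < length L \<Longrightarrow> rank L x = rank L y \<longleftrightarrow> L ! x = L ! y"
proof
  assume x: "x < length L" and y: "y < length L"
  show "L ! x = L ! y" if "rank L x = rank L y"
    using nth_rank[OF x] nth_rank[OF y] that by simp
  show "rank L x = rank L y" if "L ! x = L ! y"
    unfolding rank_eq[OF x] rank_eq[OF y] that ..
qed

section \<open>Integer programs encoding graphs\<close>

text \<open>Indices 0 and 1 form a frame, so node \<open>i\<close> of the graph sits at index
  \<open>i + 2\<close>. The \<open>2\<close> at \<open>(0, 1)\<close> makes row 0 agree with
  \<open>gadget_obj\<close>; the corner is exempt from the diagonal \<open>3\<close> because the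
  first column consists of ones.\<close>

definition gadget_coeff :: "(nat \<Rightarrow> nat \<Rightarrow> bool) \<Rightarrow> nat \<Rightarrow> nat \<Rightarrow> nat" where
  "gadget_coeff a i j = (if i = j \<and> i \<noteq> 0 then 3
     else if i = 0 \<and> j = 1 \<or> 2 \<le> i \<and> 2 \<le> j \<and> a (i - 2) (j - 2) then 2 else 1)"

definition gadget_rhs :: "nat \<Rightarrow> nat" where
  "gadget_rhs i = (if i = 0 then 1 else 2)"

definition gadget_obj :: "nat \<Rightarrow> nat" where
  "gadget_obj j = (if j = 1 then 2 else 1)"

definition gadget_A :: "nat \<Rightarrow> (nat \<Rightarrow> nat \<Rightarrow> bool) \<Rightarrow> real mat" where
  "gadget_A m a = mat m m (\<lambda>(i, j). real (gadget_coeff a i j))"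

definition gadget_b :: "nat \<Rightarrow> real vec" where
  "gadget_b m = vec m (\<lambda>i. real (gadget_rhs i))"

definition gadget_c :: "nat \<Rightarrow> real vec" where
  "gadget_c m = vec m (\<lambda>j. real (gadget_obj j))"

lemma gadget_coeff_eq_3_iff: "gadget_coeff a i j = 3 \<longleftrightarrow> i = j \<and> i \<noteq> 0"
  by (simp add: gadget_coeff_def)

lemma gadget_coeff_0_right: "gadget_coeff a i 0 = 1"
  by (auto simp add: gadget_coeff_def)

lemma gadget_coeff_0_left: "gadget_coeff a 0 j = gadget_obj j"
  by (simp add: gadget_coeff_def gadget_obj_def)

lemma gadget_coeff_range: "gadget_coeff a i j \<in> {1, 2, 3}"
  by (simp add: gadget_coeff_def)

lemma gadget_coeff_pos: "0 < gadget_coeff a i j"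
  by (simp add: gadget_coeff_def)

lemma gadget_A_mult:
  assumes "x \<in> carrier_vec m" "i < m"
  shows "(gadget_A m a *\<^sub>v x) $ i = (\<Sum>j<m. real (gadget_coeff a i j) * x $ j)"
  using assms by (simp add: gadget_A_def scalar_prod_def atLeast0LessThan)

lemma polyhedron_gadget_iff:
  "x \<in> polyhedron (gadget_A m a) (gadget_b m) \<longleftrightarrow> x \<in> carrier_vec m \<and>
    (\<forall>i<m. (\<Sum>j<m. real (gadget_coeff a i j) * x $ j) \<le> real (gadget_rhs i))"
proof -
  have dims: "dim_row (gadget_A m a) = m" "dim_col (gadget_A m a) = m" "dim_vec (gadget_b m) = m"
    by (simp_all add: gadget_A_def gadget_b_def)
  have "gadget_A m a *\<^sub>v x \<le> gadget_b m \<longleftrightarrow>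
      (\<forall>i<m. (\<Sum>j<m. real (gadget_coeff a i j) * x $ j) \<le> real (gadget_rhs i))"
    if "x \<in> carrier_vec m"
    unfolding less_eq_vec_def
    by (simp add: dims gadget_A_mult[OF that] gadget_b_def del: index_mult_mat_vec)
  then show ?thesis
    unfolding polyhedron_def by (auto simp: dims)
qed

text \<open>Coefficients and right hand sides are positive, so nonpositive vectors are feasible.
  Raising one coordinate of the all \<open>-1\<close> vector \<open>p\<close> to 0 stays feasible
  and differs from \<open>p\<close> by a unit vector.\<close>

lemma full_dimensional_gadget:
  "full_dimensional m (polyhedron (gadget_A m a) (gadget_b m))"
proof -
  let ?P = "polyhedron (gadget_A m a) (gadget_b m)"
  define p :: "real vec" where "p = vec m (\<lambda>_. - 1)"
  have pe: "vec m f \<in> ?P" if "\<And>j. f j \<le> 0" for f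
    unfolding polyhedron_gadget_iff
    using that by (auto intro!: order_trans[OF sum_nonpos] mult_nonneg_nonpos)
  have p: "p \<in> ?P" unfolding p_def by (rule pe) simp
  have sub: "?P \<subseteq> carrier_vec m" by (auto simp: polyhedron_gadget_iff)
  have "unit_vec m j \<in> {x - p | x. x \<in> ?P}" if "j < m" for j
  proof -
    have "vec m (\<lambda>k. if k = j then 0 else - 1) \<in> ?P" by (rule pe) simp
    moreover have "unit_vec m j = vec m (\<lambda>k. if k = j then 0 else - 1) - p"
      by (rule eq_vecI) (auto simp: p_def unit_vec_def)
    ultimately show ?thesis by blast
  qed
  then have units: "set (unit_vecs m) \<subseteq> {x - p | x. x \<in> ?P}"
    by (auto simp: unit_vecs_def)
  interpret vec_space "TYPE(real)" m .
  have D: "{x - p | x. x \<in> ?P} \<subseteq> carrier_vec m"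
    using sub p by (auto intro!: minus_carrier_vec)
  have "span {x - p | x. x \<in> ?P} = carrier_vec m"
    using span_is_monotone[OF units] span_closed[OF D] unfolding span_unit_vecs_is_carrier by blast
  then show ?thesis
    unfolding full_dimensional_def using sub p by blast
qed

lemma sum_unit_vec:
  fixes f :: "nat \<Rightarrow> real"
  shows "0 < m \<Longrightarrow> (\<Sum>j<m. f j * unit_vec m 0 $ j) = f 0"
  by (subst sum.remove[of _ 0]) (auto simp: unit_vec_def intro!: sum.neutral)

text \<open>Constraint 0 says that the objective is at most 1. The first unit vector attains this,
  and it is feasible because column 0 consists of ones and no right hand side is below 1.\<close>

lemma has_optimal_solution_gadget:
  assumes "0 < m"
  shows "has_optimal_solution (gadget_A m a) (gadget_b m) (gadget_c m)"
  unfolding has_optimal_solution_def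
proof (intro bexI ballI)
  let ?e = "unit_vec m 0 :: real vec"
  show "?e \<in> polyhedron (gadget_A m a) (gadget_b m)"
    unfolding polyhedron_gadget_iff
    by (simp add: sum_unit_vec[OF assms] gadget_coeff_0_right gadget_rhs_def del: index_unit_vec)
  have c: "gadget_c m \<bullet> x = (\<Sum>j<m. real (gadget_coeff a 0 j) * x $ j)"
    if "x \<in> carrier_vec m" for x
    using that by (simp add: gadget_c_def gadget_coeff_0_left scalar_prod_def atLeast0LessThan)
  fix y assume "y \<in> polyhedron (gadget_A m a) (gadget_b m)"
  then have y: "y \<in> carrier_vec m"
    and "(\<Sum>j<m. real (gadget_coeff a 0 j) * y $ j) \<le> real (gadget_rhs 0)"
    using assms unfolding polyhedron_gadget_iff by auto
  then have "gadget_c m \<bullet> y \<le> 1"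
    unfolding c[OF y] by (simp add: gadget_rhs_def)
  also have "1 = gadget_c m \<bullet> ?e"
    by (subst c) (simp_all add: sum_unit_vec[OF assms] gadget_coeff_0_right del: index_unit_vec)
  finally show "gadget_c m \<bullet> y \<le> gadget_c m \<bullet> ?e" .
qed

lemma admissible_data_gadget:
  assumes "normalized \<in> {leading_unit_rows, coprime_integral_rows,
    \<lambda>A b. leading_unit_rows A b \<or> coprime_integral_rows A b}" and "0 < m"
  shows "admissible_data normalized (gadget_A m a) (gadget_b m) (gadget_c m)"
proof -
  let ?A = "gadget_A m a" and ?b = "gadget_b m"
  have dims [simp]: "dim_row ?A = m" "dim_col ?A = m" "dim_vec ?b = m" "dim_vec (gadget_c m) = m"
    by (simp_all add: gadget_A_def gadget_b_def gadget_c_def)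
  have A: "?A $$ (i, j) = real (gadget_coeff a i j)" if "i < m" "j < m" for i j
    using that by (simp add: gadget_A_def)
  have row: "row ?A i $ j = real (gadget_coeff a i j)" if "i < m" "j < m" for i j
    using that by (simp add: gadget_A_def)
  have 1: "leading_unit_rows ?A ?b"
    unfolding leading_unit_rows_def
    using assms(2) by (auto intro!: exI[of _ 0] simp: ext_coeff_def A gadget_coeff_0_right)
  have 2: "coprime_integral_rows ?A ?b"
    unfolding coprime_integral_rows_def
  proof (intro allI impI)
    fix i assume i: "i < dim_row ?A"
    let ?z = "\<lambda>j. if j < m then int (gadget_coeff a i j) else int (gadget_rhs i)"
    have "?z 0 = 1" using assms(2) by (simp add: gadget_coeff_0_right)
    then have "1 \<in> ?z ` {..dim_col ?A}" by (intro image_eqI[of _ _ 0]) simp_all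
    then have "Gcd (?z ` {..dim_col ?A}) = 1"
      by (rule Gcd_eq_1_I[rotated]) simp
    moreover have "ext_coeff ?A ?b i j = of_int (?z j)" for j
      using i by (auto simp: ext_coeff_def A gadget_b_def)
    ultimately show "\<exists>z :: nat \<Rightarrow> int. (\<forall>j\<le>dim_col ?A. ext_coeff ?A ?b i j = of_int (z j)) \<and>
        Gcd (z ` {..dim_col ?A}) = 1" by (intro exI[of _ ?z]) simp
  qed
  have "normalized ?A ?b" using assms(1) 1 2 by auto
  moreover have "row ?A i \<noteq> 0\<^sub>v (dim_col ?A)" if "i < m" for i
    using row[OF that assms(2)] assms(2) gadget_coeff_pos[of a i 0] by auto
  moreover have "gadget_c m \<noteq> 0\<^sub>v (dim_col ?A)"
  proof
    assume "gadget_c m = 0\<^sub>v (dim_col ?A)"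
    then have "gadget_c m $ 0 = 0\<^sub>v (dim_col ?A) $ 0" by simp
    then show False using assms(2) by (simp add: gadget_c_def gadget_obj_def)
  qed
  moreover have "polyhedron ?A ?b \<noteq> {}"
    using has_optimal_solution_gadget[OF assms(2), of a] unfolding has_optimal_solution_def by blast
  \<comment> \<open>A nonzero index is recognised by the column of the \<open>3\<close> in its row.
    Both columns \<open>i\<close> and \<open>k\<close> are consulted, since one of the indices may
    be 0.\<close>
  moreover have "i = k" if "i < m" "k < m" "row ?A i = row ?A k" for i k
  proof -
    have "gadget_coeff a i j = gadget_coeff a k j" if "j < m" for j
      using row[OF \<open>i < m\<close> that] row[OF \<open>k < m\<close> that] \<open>row ?A i = row ?A k\<close> by simp
    from this[of i] this[of k] show ?thesis
      using that(1,2) gadget_coeff_eq_3_iff[of a i i] gadget_coeff_eq_3_iff[of a k i]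
        gadget_coeff_eq_3_iff[of a k k] gadget_coeff_eq_3_iff[of a i k] by metis
  qed
  ultimately show ?thesis
    unfolding admissible_data_def
    using full_dimensional_gadget[of m a] has_optimal_solution_gadget[OF assms(2), of a] by auto
qed

subsection \<open>The ILP graphs of these integer programs\<close>

text \<open>The flag \<open>S\<close> distinguishes the ILP graph from the reduced ILP graph, which lacks the twins.\<close>

fun gadget_node :: "bool \<Rightarrow> nat \<Rightarrow> ilp_node \<Rightarrow> bool" where
  "gadget_node S m (Position i j) \<longleftrightarrow> i < m \<and> j < m"
| "gadget_node S m (Position_Twin i j) \<longleftrightarrow> S \<and> i < m \<and> j < m"
| "gadget_node S m (Row i) \<longleftrightarrow> i < m"
| "gadget_node S m (Column j) \<longleftrightarrow> j < m"
| "gadget_node S m (Column_Twin j) \<longleftrightarrow> S \<and> j < m"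
| "gadget_node S m (Coeff_A u) \<longleftrightarrow> u \<in> {1, 2, 3} \<or> S \<and> u \<in> {-1, -2, -3}"
| "gadget_node S m (Coeff_b v) \<longleftrightarrow> v \<in> {1, 2}"
| "gadget_node S m (Coeff_c w) \<longleftrightarrow> w \<in> {1, 2} \<or> S \<and> w \<in> {-1, -2}"

text \<open>Each edge is listed in one direction only. Arcs at twins are present for either value of
  \<open>S\<close>; the flag acts through \<open>gadget_node\<close>.\<close>

fun gadget_arc :: "(nat \<Rightarrow> nat \<Rightarrow> bool) \<Rightarrow> ilp_node \<Rightarrow> ilp_node \<Rightarrow> bool" where
  "gadget_arc a (Position i j) (Row i') \<longleftrightarrow> i = i'"
| "gadget_arc a (Position i j) (Column j') \<longleftrightarrow> j = j'"
| "gadget_arc a (Position i j) (Coeff_A u) \<longleftrightarrow> u = real (gadget_coeff a i j)"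
| "gadget_arc a (Position i j) (Position_Twin i' j') \<longleftrightarrow> i = i' \<and> j = j'"
| "gadget_arc a (Position_Twin i j) (Row i') \<longleftrightarrow> i = i'"
| "gadget_arc a (Position_Twin i j) (Column_Twin j') \<longleftrightarrow> j = j'"
| "gadget_arc a (Position_Twin i j) (Coeff_A u) \<longleftrightarrow> u = - real (gadget_coeff a i j)"
| "gadget_arc a (Row i) (Coeff_b v) \<longleftrightarrow> v = real (gadget_rhs i)"
| "gadget_arc a (Column j) (Coeff_c w) \<longleftrightarrow> w = real (gadget_obj j)"
| "gadget_arc a (Column_Twin j) (Coeff_c w) \<longleftrightarrow> w = - real (gadget_obj j)"
| "gadget_arc a (Column j) (Column_Twin j') \<longleftrightarrow> j = j'"
| "gadget_arc a _ _ \<longleftrightarrow> False"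

definition gadget_adj :: "(nat \<Rightarrow> nat \<Rightarrow> bool) \<Rightarrow> ilp_node \<Rightarrow> ilp_node \<Rightarrow> bool" where
  "gadget_adj a x y \<longleftrightarrow> gadget_arc a x y \<or> gadget_arc a y x"

definition gadget_graph :: "bool \<Rightarrow> nat \<Rightarrow> (nat \<Rightarrow> nat \<Rightarrow> bool) \<Rightarrow> (ilp_node, ilp_label) lgraph" where
  "gadget_graph S m a = (if S then ilp_graph else reduced_ilp_graph) (gadget_A m a) (gadget_b m) (gadget_c m)"

lemma label_gadget_graph: "label (gadget_graph S m a) = ilp_node_label"
  by (simp add: gadget_graph_def ilp_graph_def reduced_ilp_graph_def Let_def)

text \<open>The frame formed by rows and columns 0 and 1 already exhibits all coefficients.\<close>

lemma gadget_coeff_cases: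
  assumes "2 \<le> m"
  shows "(\<exists>i<m. \<exists>j<m. gadget_coeff a i j = k) \<longleftrightarrow> k \<in> {1, 2, 3}"
    and "(\<exists>i<m. gadget_rhs i = k) \<longleftrightarrow> k \<in> {1, 2}" and "(\<exists>j<m. gadget_obj j = k) \<longleftrightarrow> k \<in> {1, 2}"
proof -
  have "gadget_coeff a 0 0 = 1" "gadget_coeff a 0 1 = 2" "gadget_coeff a 1 1 = 3"
    "gadget_rhs 0 = 1" "gadget_rhs 1 = 2" "gadget_obj 0 = 1" "gadget_obj 1 = 2" "0 < m" "1 < m"
    using assms by (auto simp: gadget_coeff_def gadget_rhs_def gadget_obj_def)
  then show "(\<exists>i<m. \<exists>j<m. gadget_coeff a i j = k) \<longleftrightarrow> k \<in> {1, 2, 3}"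
    "(\<exists>i<m. gadget_rhs i = k) \<longleftrightarrow> k \<in> {1, 2}" "(\<exists>j<m. gadget_obj j = k) \<longleftrightarrow> k \<in> {1, 2}"
    using gadget_coeff_range[of a] by (blast, auto simp: gadget_rhs_def gadget_obj_def)
qed

lemma gadget_coeff_sets:
  assumes "2 \<le> m"
  shows "{f (real (gadget_coeff a i j)) | i j. i < m \<and> j < m} = {f 1, f 2, f 3}"
    and "{g (real (gadget_rhs i)) | i. i < m} = {g 1, g 2}"
    and "{h (real (gadget_obj j)) | j. j < m} = {h 1, h 2}"
proof -
  have "{f (real (gadget_coeff a i j)) | i j. i < m \<and> j < m} =
      (\<lambda>k. f (real k)) ` {k. \<exists>i<m. \<exists>j<m. gadget_coeff a i j = k}" by blast
  then show "{f (real (gadget_coeff a i j)) | i j. i < m \<and> j < m} = {f 1, f 2, f 3}"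
    unfolding gadget_coeff_cases(1)[OF assms] Collect_mem_eq by simp
  have "{g (real (gadget_rhs i)) | i. i < m} = (\<lambda>k. g (real k)) ` {k. \<exists>i<m. gadget_rhs i = k}" by blast
  then show "{g (real (gadget_rhs i)) | i. i < m} = {g 1, g 2}"
    unfolding gadget_coeff_cases(2)[OF assms] Collect_mem_eq by simp
  have "{h (real (gadget_obj j)) | j. j < m} = (\<lambda>k. h (real k)) ` {k. \<exists>j<m. gadget_obj j = k}" by blast
  then show "{h (real (gadget_obj j)) | j. j < m} = {h 1, h 2}"
    unfolding gadget_coeff_cases(3)[OF assms] Collect_mem_eq by simp
qed

text \<open>No coefficient is zero, so the case of a position being its own twin does not
  arise.\<close>

lemma hat_position_gadget: "i < m \<Longrightarrow> j < m \<Longrightarrow> hat_position (gadget_A m a) i j = Position_Twin i j"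
  using gadget_coeff_pos[of a i j] by (simp add: hat_position_def gadget_A_def)

lemma Collect_cong1: "(\<And>i. P i \<Longrightarrow> f i = g i) \<Longrightarrow> {f i | i. P i} = {g i | i. P i}"
  by metis

lemma Collect_cong2:
  "(\<And>i j. P i j \<Longrightarrow> f i j = g i j) \<Longrightarrow> {f i j | i j. P i j} = {g i j | i j. P i j}"
  by metis

lemma reduced_gadget_eq:
  assumes "2 \<le> m"
  shows "nodes (gadget_graph False m a) =
      {Position i j | i j. i < m \<and> j < m} \<union> {Row i | i. i < m} \<union> {Column j | j. j < m} \<union>
      {Coeff_A 1, Coeff_A 2, Coeff_A 3} \<union> {Coeff_b 1, Coeff_b 2} \<union> {Coeff_c 1, Coeff_c 2}"
    and "edges (gadget_graph False m a) =
      {{Position i j, Row i} | i j. i < m \<and> j < m} \<union>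
      {{Position i j, Column j} | i j. i < m \<and> j < m} \<union>
      {{Position i j, Coeff_A (real (gadget_coeff a i j))} | i j. i < m \<and> j < m} \<union>
      {{Row i, Coeff_b (real (gadget_rhs i))} | i. i < m} \<union>
      {{Column j, Coeff_c (real (gadget_obj j))} | j. j < m}"
proof -
  have dims: "dim_row (gadget_A m a) = m" "dim_col (gadget_A m a) = m"
    by (simp_all add: gadget_A_def)
  have A: "{f i j (gadget_A m a $$ (i, j)) | i j. i < m \<and> j < m} =
      {f i j (real (gadget_coeff a i j)) | i j. i < m \<and> j < m}" for f :: "nat \<Rightarrow> nat \<Rightarrow> real \<Rightarrow> 'z"
    by (rule Collect_cong2) (simp add: gadget_A_def)
  have b: "{f i (gadget_b m $ i) | i. i < m} = {f i (real (gadget_rhs i)) | i. i < m}"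
    for f :: "nat \<Rightarrow> real \<Rightarrow> 'z"
    by (rule Collect_cong1) (simp add: gadget_b_def)
  have c: "{f j (gadget_c m $ j) | j. j < m} = {f j (real (gadget_obj j)) | j. j < m}"
    for f :: "nat \<Rightarrow> real \<Rightarrow> 'z"
    by (rule Collect_cong1) (simp add: gadget_c_def)
  have red: "gadget_graph False m a = reduced_ilp_graph (gadget_A m a) (gadget_b m) (gadget_c m)"
    by (simp add: gadget_graph_def)
  show "nodes (gadget_graph False m a) =
      {Position i j | i j. i < m \<and> j < m} \<union> {Row i | i. i < m} \<union> {Column j | j. j < m} \<union>
      {Coeff_A 1, Coeff_A 2, Coeff_A 3} \<union> {Coeff_b 1, Coeff_b 2} \<union> {Coeff_c 1, Coeff_c 2}"
    unfolding red reduced_ilp_graph_def Let_def dims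
    using A[of "\<lambda>i j. Coeff_A"] b[of "\<lambda>i. Coeff_b"] c[of "\<lambda>j. Coeff_c"]
    by (simp add: gadget_coeff_sets[OF assms])
  show "edges (gadget_graph False m a) =
      {{Position i j, Row i} | i j. i < m \<and> j < m} \<union>
      {{Position i j, Column j} | i j. i < m \<and> j < m} \<union>
      {{Position i j, Coeff_A (real (gadget_coeff a i j))} | i j. i < m \<and> j < m} \<union>
      {{Row i, Coeff_b (real (gadget_rhs i))} | i. i < m} \<union>
      {{Column j, Coeff_c (real (gadget_obj j))} | j. j < m}"
    unfolding red reduced_ilp_graph_def Let_def dims
    using A[of "\<lambda>i j u. {Position i j, Coeff_A u}"] b[of "\<lambda>i v. {Row i, Coeff_b v}"]
      c[of "\<lambda>j w. {Column j, Coeff_c w}"] by simp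
qed

lemma ilp_gadget_eq:
  assumes "2 \<le> m"
  shows "nodes (gadget_graph True m a) = nodes (gadget_graph False m a) \<union>
      {Position_Twin i j | i j. i < m \<and> j < m} \<union> {Column_Twin j | j. j < m} \<union>
      {Coeff_A (-1), Coeff_A (-2), Coeff_A (-3)} \<union> {Coeff_c (-1), Coeff_c (-2)}"
    and "edges (gadget_graph True m a) = edges (gadget_graph False m a) \<union>
      {{Position_Twin i j, Row i} | i j. i < m \<and> j < m} \<union>
      {{Position_Twin i j, Column_Twin j} | i j. i < m \<and> j < m} \<union>
      {{Position_Twin i j, Coeff_A (- real (gadget_coeff a i j))} | i j. i < m \<and> j < m} \<union>
      {{Position i j, Position_Twin i j} | i j. i < m \<and> j < m} \<union>
      {{Column_Twin j, Coeff_c (- real (gadget_obj j))} | j. j < m} \<union>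
      {{Column j, Column_Twin j} | j. j < m}"
proof -
  have dims: "dim_row (gadget_A m a) = m" "dim_col (gadget_A m a) = m"
    by (simp_all add: gadget_A_def)
  have A: "{f i j (gadget_A m a $$ (i, j)) (hat_position (gadget_A m a) i j) | i j. i < m \<and> j < m} =
      {f i j (real (gadget_coeff a i j)) (Position_Twin i j) | i j. i < m \<and> j < m}"
    for f :: "nat \<Rightarrow> nat \<Rightarrow> real \<Rightarrow> ilp_node \<Rightarrow> 'z"
    by (rule Collect_cong2) (simp add: gadget_A_def hat_position_gadget[unfolded gadget_A_def])
  have nz: "i < m \<and> j < m \<and> gadget_A m a $$ (i, j) \<noteq> 0 \<longleftrightarrow> i < m \<and> j < m" for i j
    using gadget_coeff_pos[of a i j] by (auto simp: gadget_A_def)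
  have nzc: "j < m \<and> gadget_c m $ j \<noteq> 0 \<longleftrightarrow> j < m" for j
    by (auto simp: gadget_c_def gadget_obj_def split: if_splits)
  have c: "{f j (gadget_c m $ j) | j. j < m} = {f j (real (gadget_obj j)) | j. j < m}"
    for f :: "nat \<Rightarrow> real \<Rightarrow> 'z"
    by (rule Collect_cong1) (simp add: gadget_c_def)
  have red: "gadget_graph False m a = reduced_ilp_graph (gadget_A m a) (gadget_b m) (gadget_c m)"
    by (simp add: gadget_graph_def)
  have full: "gadget_graph True m a = ilp_graph (gadget_A m a) (gadget_b m) (gadget_c m)"
    by (simp add: gadget_graph_def)
  show "nodes (gadget_graph True m a) = nodes (gadget_graph False m a) \<union>
      {Position_Twin i j | i j. i < m \<and> j < m} \<union> {Column_Twin j | j. j < m} \<union>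
      {Coeff_A (-1), Coeff_A (-2), Coeff_A (-3)} \<union> {Coeff_c (-1), Coeff_c (-2)}"
    unfolding red full ilp_graph_def Let_def dims nz nzc
    using A[of "\<lambda>i j u h. h"] A[of "\<lambda>i j u h. Coeff_A (- u)"] c[of "\<lambda>j w. Coeff_c (- w)"]
    by (simp add: gadget_coeff_sets(1)[OF assms, where f = "\<lambda>u. Coeff_A (- u)"]
        gadget_coeff_sets(3)[OF assms, where h = "\<lambda>u. Coeff_c (- u)"])
  show "edges (gadget_graph True m a) = edges (gadget_graph False m a) \<union>
      {{Position_Twin i j, Row i} | i j. i < m \<and> j < m} \<union>
      {{Position_Twin i j, Column_Twin j} | i j. i < m \<and> j < m} \<union>
      {{Position_Twin i j, Coeff_A (- real (gadget_coeff a i j))} | i j. i < m \<and> j < m} \<union>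
      {{Position i j, Position_Twin i j} | i j. i < m \<and> j < m} \<union>
      {{Column_Twin j, Coeff_c (- real (gadget_obj j))} | j. j < m} \<union>
      {{Column j, Column_Twin j} | j. j < m}"
    unfolding red full ilp_graph_def Let_def dims nz nzc
    using A[of "\<lambda>i j u h. {h, Row i}"] A[of "\<lambda>i j u h. {h, Column_Twin j}"]
      A[of "\<lambda>i j u h. {h, Coeff_A (- u)}"] A[of "\<lambda>i j u h. {Position i j, h}"]
      c[of "\<lambda>j w. {Column_Twin j, Coeff_c (- w)}"] by simp
qed

lemma nodes_gadget_graph:
  assumes "2 \<le> m"
  shows "nodes (gadget_graph S m a) = Collect (gadget_node S m)"
proof (rule Set.set_eqI)
  fix x
  show "x \<in> nodes (gadget_graph S m a) \<longleftrightarrow> x \<in> Collect (gadget_node S m)"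
    by (cases S; cases x) (auto simp: ilp_gadget_eq[OF assms] reduced_gadget_eq[OF assms])
qed

lemma edges_gadget_graph:
  assumes "2 \<le> m"
  shows "edges (gadget_graph S m a) =
    {{x, y} | x y. x \<in> Collect (gadget_node S m) \<and> y \<in> Collect (gadget_node S m) \<and> gadget_arc a x y}"
    (is "_ = ?R")
proof
  let ?E = "edges (gadget_graph S m a)"
  have I: "{x, y} \<in> ?R" if "gadget_node S m x" "gadget_node S m y" "gadget_arc a x y" for x y
    using that by blast
  have A: "real (gadget_coeff a i j) \<in> {1, 2, 3}" "- real (gadget_coeff a i j) \<in> {-1, -2, -3}" for i j
    using gadget_coeff_range[of a i j] by auto
  have b: "real (gadget_rhs i) \<in> {1, 2}" for i by (simp add: gadget_rhs_def)
  have c: "real (gadget_obj j) \<in> {1, 2}" "- real (gadget_obj j) \<in> {-1, -2}" for j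
    by (simp_all add: gadget_obj_def)
  have 0: "edges (gadget_graph False m a) \<subseteq> ?R"
    unfolding reduced_gadget_eq[OF assms]
    by (intro Un_least subsetI; elim CollectE exE conjE; hypsubst; rule I; insert A b c; simp)
  show "?E \<subseteq> ?R"
  proof (cases S)
    case True
    have *: "edges (gadget_graph True m a) \<subseteq> ?R"
      unfolding ilp_gadget_eq[OF assms]
      by (intro Un_least; (rule 0)?; intro subsetI; elim CollectE exE conjE; hypsubst;
          rule I; insert A b c True; simp)
    then show ?thesis using True by simp
  qed (use 0 in simp)
  show "?R \<subseteq> ?E"
  proof
    fix e assume "e \<in> ?R"
    then obtain x y where e: "e = {x, y}" and xy: "gadget_node S m x" "gadget_node S m y" "gadget_arc a x y"
      by blast
    have "{x, y} \<in> edges (gadget_graph False m a)"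
      if "gadget_node False m x" "gadget_node False m y" "gadget_arc a x y"
      using that unfolding reduced_gadget_eq[OF assms]
      by (cases x; cases y; simp add: doubleton_eq_iff)
    moreover have "{x, y} \<in> edges (gadget_graph True m a)"
      if "gadget_node True m x" "gadget_node True m y" "gadget_arc a x y"
      using that unfolding ilp_gadget_eq[OF assms] reduced_gadget_eq[OF assms]
      by (cases x; cases y; simp add: doubleton_eq_iff)
    ultimately show "e \<in> ?E"
      using xy unfolding e by (cases S) simp_all
  qed
qed

lemma edge_gadget_graph_iff:
  assumes "2 \<le> m" "gadget_node S m x" "gadget_node S m y"
  shows "{x, y} \<in> edges (gadget_graph S m a) \<longleftrightarrow> gadget_adj a x y"
  unfolding edges_gadget_graph[OF assms(1)] gadget_adj_def
  by (rule doubleton_mem_iff) (use assms in auto)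

section \<open>Isomorphisms between gadget graphs\<close>

fun node_index :: "ilp_node \<Rightarrow> nat" where
  "node_index (Row i) = i"
| "node_index (Column j) = j"
| "node_index (Column_Twin j) = j"
| "node_index _ = 0"

text \<open>Irreflexivity enters because the matrix does not record \<open>a i i\<close>: its
  diagonal entries in the block are 3 in any case.\<close>

lemma gadget_iso_imp_index_isomorphic:
  assumes irrefl: "\<And>i. i < n \<Longrightarrow> \<not> a i i" "\<And>i. i < n' \<Longrightarrow> \<not> a' i i"
    and iso: "lgraph_isomorphic (gadget_graph S (n + 2) a) (gadget_graph S (n' + 2) a')"
  shows "index_isomorphic n a (\<lambda>_. ()) n' a' (\<lambda>_. ())"
proof -
  define m where "m = n + 2"
  define m' where "m' = n' + 2"
  have m: "2 \<le> m" "2 \<le> m'" by (simp_all add: m_def m'_def)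
  let ?N = "gadget_node S m" and ?N' = "gadget_node S m'"
  obtain f where f: "is_graph_iso f (gadget_graph S m a) (gadget_graph S m' a')"
    and L: "\<And>x. ?N x \<Longrightarrow> ilp_node_label (f x) = ilp_node_label x"
    using iso unfolding lgraph_isomorphic_def m_def[symmetric] m'_def[symmetric]
    by (auto simp: label_gadget_graph nodes_gadget_graph[OF m(1)])
  have bij: "bij_betw f (Collect ?N) (Collect ?N')"
    using f by (simp add: is_graph_iso_def nodes_gadget_graph m)
  have fN: "?N' (f x)" if "?N x" for x
    using bij_betw_apply[OF bij] that by simp
  have adj: "gadget_adj a' (f x) (f y) \<longleftrightarrow> gadget_adj a x y" if "?N x" "?N y" for x y
  proof -
    have "{f x, f y} \<in> edges (gadget_graph S m' a') \<longleftrightarrow> {x, y} \<in> edges (gadget_graph S m a)"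
      using f that by (simp add: is_graph_iso_def nodes_gadget_graph m)
    then show ?thesis using that fN by (simp add: edge_gadget_graph_iff m)
  qed
  define \<sigma> where "\<sigma> i = node_index (f (Row i))" for i
  define \<tau> where "\<tau> j = node_index (f (Column j))" for j
  have row: "f (Row i) = Row (\<sigma> i)" "\<sigma> i < m'" if "i < m" for i
    using L[of "Row i"] fN[of "Row i"] that by (cases "f (Row i)"; simp add: \<sigma>_def)+
  have column: "f (Column j) = Column (\<tau> j) \<or> f (Column j) = Column_Twin (\<tau> j)" if "j < m" for j
    using L[of "Column j"] that by (cases "f (Column j)"; simp add: \<tau>_def)
  have A: "f (Coeff_A u) = Coeff_A u" if "?N (Coeff_A u)" for u
    using L[OF that] by (cases "f (Coeff_A u)") simp_all
  have b: "f (Coeff_b u) = Coeff_b u" if "?N (Coeff_b u)" for u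
    using L[OF that] by (cases "f (Coeff_b u)") simp_all
  have c: "f (Coeff_c u) = Coeff_c u" if "?N (Coeff_c u)" for u
    using L[OF that] by (cases "f (Coeff_c u)") simp_all
  \<comment> \<open>The image of a position is adjacent to a positive coefficient node, so it is not
    a twin. A position that is not a twin is adjacent to a column but to no column twin, hence the
    image has exactly the indices \<open>\<sigma> i\<close> and \<open>\<tau> j\<close>.\<close>
  have coeff: "gadget_coeff a' (\<sigma> i) (\<tau> j) = gadget_coeff a i j" if ij: "i < m" "j < m" for i j
  proof -
    let ?u = "real (gadget_coeff a i j)"
    have u: "?N (Coeff_A ?u)" using gadget_coeff_range[of a i j] by auto
    have "gadget_adj a' (f (Position i j)) (Row (\<sigma> i))"
      using adj[of "Position i j" "Row i"] ij row by (simp add: gadget_adj_def)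
    moreover have "gadget_adj a' (f (Position i j)) (f (Column j))"
      using adj[of "Position i j" "Column j"] ij by (simp add: gadget_adj_def)
    moreover have "gadget_adj a' (f (Position i j)) (Coeff_A ?u)"
      using adj[of "Position i j" "Coeff_A ?u"] ij u A[OF u] by (simp add: gadget_adj_def)
    moreover have "ilp_node_label (f (Position i j)) = Position_Label"
      using L[of "Position i j"] ij by simp
    ultimately show ?thesis
      using column[OF ij(2)] gadget_coeff_pos[of a i j]
      by (cases "f (Position i j)") (auto simp: gadget_adj_def)
  qed
  \<comment> \<open>Labels fix the nodes of the right hand sides, and the value 1 belongs to row 0
    alone.\<close>
  have \<sigma>0: "\<sigma> i = 0 \<longleftrightarrow> i = 0" if "i < m" for i
  proof -
    let ?v = "real (gadget_rhs i)"
    have "?N (Coeff_b ?v)" by (simp add: gadget_rhs_def)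
    then have "gadget_adj a' (Row (\<sigma> i)) (Coeff_b ?v)"
      using adj[of "Row i" "Coeff_b ?v"] b[of ?v] that row by (simp add: gadget_adj_def)
    then show ?thesis by (simp add: gadget_adj_def gadget_rhs_def split: if_splits)
  qed
  have \<tau>1: "\<tau> 1 = 1"
  proof -
    have "?N (Coeff_c 2)" "1 < m" using m by auto
    then have "gadget_adj a' (f (Column 1)) (Coeff_c 2)"
      using adj[of "Column 1" "Coeff_c 2"] c[of 2] by (simp add: gadget_adj_def gadget_obj_def)
    then show ?thesis
      using column[OF \<open>1 < m\<close>] by (auto simp: gadget_adj_def gadget_obj_def split: if_splits)
  qed
  \<comment> \<open>The entry at \<open>(\<sigma> i, \<tau> i)\<close> is again 3, and 3 occurs on
    the diagonal only.\<close>
  have \<sigma>\<tau>: "\<sigma> i = \<tau> i" if "i < m" "i \<noteq> 0" for i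
    using coeff[OF that(1,1)] that(2) gadget_coeff_eq_3_iff[of a i i]
      gadget_coeff_eq_3_iff[of a' "\<sigma> i" "\<tau> i"] by simp
  have inj: "inj_on \<sigma> {..<m}"
  proof (rule inj_onI)
    fix i k assume ik: "i \<in> {..<m}" "k \<in> {..<m}" "\<sigma> i = \<sigma> k"
    then have "f (Row i) = f (Row k)" by (simp add: row)
    then have "Row i = Row k" using bij ik by (auto simp: bij_betw_def dest!: inj_onD)
    then show "i = k" by simp
  qed
  \<comment> \<open>Row 1 is pinned by column 1 through their common entry 3. With row 0 fixed as
    well, the remaining rows, those of graph nodes, are permuted among themselves.\<close>
  have \<sigma>2: "2 \<le> \<sigma> i \<longleftrightarrow> 2 \<le> i" if "i < m" for i
  proof -
    have "\<sigma> i = 1 \<longleftrightarrow> i = 1"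
      using inj_on_eq_iff[OF inj, of i 1] that m \<sigma>\<tau>[of 1] \<tau>1 by simp
    then show ?thesis using \<sigma>0[OF that] by linarith
  qed
  have surj: "\<exists>i<m. \<sigma> i = k" if k: "k < m'" for k
  proof -
    have "Row k \<in> f ` Collect ?N" using bij k by (simp add: bij_betw_def)
    then obtain x where x: "?N x" "f x = Row k" by auto
    then show ?thesis using L[OF x(1)] by (cases x) (auto simp: \<sigma>_def)
  qed
  define \<pi> where "\<pi> i = \<sigma> (i + 2) - 2" for i
  have \<pi>: "\<sigma> (i + 2) = \<pi> i + 2" "\<pi> i < n'" if "i < n" for i
    using \<sigma>2[of "i + 2"] row(2)[of "i + 2"] that by (simp_all add: \<pi>_def m_def m'_def)
  have "bij_betw \<pi> {..<n} {..<n'}"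
    unfolding bij_betw_def
  proof
    show "inj_on \<pi> {..<n}"
    proof (rule inj_onI)
      fix i k assume ik: "i \<in> {..<n}" "k \<in> {..<n}" "\<pi> i = \<pi> k"
      then have "\<sigma> (i + 2) = \<sigma> (k + 2)" using \<pi>(1)[of i] \<pi>(1)[of k] by simp
      then show "i = k" using inj_on_eq_iff[OF inj, of "i + 2" "k + 2"] ik by (simp add: m_def)
    qed
    show "\<pi> ` {..<n} = {..<n'}"
    proof
      show "\<pi> ` {..<n} \<subseteq> {..<n'}" using \<pi>(2) by auto
      show "{..<n'} \<subseteq> \<pi> ` {..<n}"
      proof
        fix k assume "k \<in> {..<n'}"
        then obtain i where i: "i < m" "\<sigma> i = k + 2" using surj[of "k + 2"] by (auto simp: m'_def)
        then have "2 \<le> i" using \<sigma>2[OF i(1)] by simp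
        then have "i - 2 + 2 = i" by simp
        then have "\<pi> (i - 2) = k" "i - 2 < n"
          using i by (simp_all only: \<pi>_def m_def)
        then show "k \<in> \<pi> ` {..<n}" by blast
      qed
    qed
  qed
  moreover have "a' (\<pi> i) (\<pi> j) \<longleftrightarrow> a i j" if ij: "i < n" "j < n" for i j
  proof (cases "i = j")
    case True
    then show ?thesis using irrefl(1)[OF ij(1)] irrefl(2)[OF \<pi>(2)[OF ij(1)]] by simp
  next
    case False
    then have ne: "\<pi> i \<noteq> \<pi> j"
      using inj_on_eq_iff[OF inj, of "i + 2" "j + 2"] \<pi>(1)[OF ij(1)] \<pi>(1)[OF ij(2)] ij
      by (auto simp: m_def)
    have "gadget_coeff a' (\<pi> i + 2) (\<pi> j + 2) = gadget_coeff a (i + 2) (j + 2)"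
      using coeff[of "i + 2" "j + 2"] \<sigma>\<tau>[of "j + 2"] \<pi>(1)[OF ij(1)] \<pi>(1)[OF ij(2)] ij
      by (simp add: m_def)
    then show ?thesis using False ne by (simp add: gadget_coeff_def split: if_splits)
  qed
  ultimately show ?thesis unfolding index_isomorphic_def by auto
qed

text \<open>The diagonal requires one permutation to act on rows and columns alike; coefficient
  nodes cannot move, as their labels are individual.\<close>

fun map_indices :: "(nat \<Rightarrow> nat) \<Rightarrow> ilp_node \<Rightarrow> ilp_node" where
  "map_indices p (Position i j) = Position (p i) (p j)"
| "map_indices p (Position_Twin i j) = Position_Twin (p i) (p j)"
| "map_indices p (Row i) = Row (p i)"
| "map_indices p (Column j) = Column (p j)"
| "map_indices p (Column_Twin j) = Column_Twin (p j)"
| "map_indices p x = x"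

lemma index_isomorphic_imp_gadget_iso:
  assumes "index_isomorphic n a (\<lambda>_. ()) n' a' (\<lambda>_. ())"
  shows "lgraph_isomorphic (gadget_graph S (n + 2) a) (gadget_graph S (n' + 2) a')"
proof -
  obtain \<pi> where bij: "bij_betw \<pi> {..<n} {..<n'}"
    and E: "\<And>i j. i < n \<Longrightarrow> j < n \<Longrightarrow> a' (\<pi> i) (\<pi> j) \<longleftrightarrow> a i j"
    using assms unfolding index_isomorphic_def by blast
  define m where "m = n + 2"
  define m' where "m' = n' + 2"
  have m: "2 \<le> m" "2 \<le> m'" by (simp_all add: m_def m'_def)
  let ?N = "gadget_node S m" and ?N' = "gadget_node S m'"
  define p where "p i = (if i < 2 then i else \<pi> (i - 2) + 2)" for i
  have \<pi>: "\<pi> i < n'" if "i < n" for i using bij_betw_apply[OF bij] that by simp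
  have inj\<pi>: "\<pi> i = \<pi> k \<longleftrightarrow> i = k" if "i < n" "k < n" for i k
    using inj_on_eq_iff[OF bij_betw_imp_inj_on[OF bij]] that by simp
  have p: "p i < m'" if "i < m" for i
    using \<pi>[of "i - 2"] that by (auto simp: p_def m_def m'_def)
  have inj: "p i = p k \<longleftrightarrow> i = k" if "i < m" "k < m" for i k
    using inj\<pi>[of "i - 2" "k - 2"] that by (auto simp: p_def m_def)
  have surj: "\<exists>i<m. p i = k" if "k < m'" for k
  proof (cases "k < 2")
    case True
    then show ?thesis by (intro exI[of _ k]) (simp add: p_def m_def)
  next
    case False
    then have "k - 2 \<in> \<pi> ` {..<n}" using bij that by (simp add: bij_betw_def m'_def)
    then obtain i where "i < n" "\<pi> i = k - 2" by auto
    then show ?thesis using False by (intro exI[of _ "i + 2"]) (simp add: p_def m_def)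
  qed
  have small: "p i = 0 \<longleftrightarrow> i = 0" "p i = 1 \<longleftrightarrow> i = 1" "2 \<le> p i \<longleftrightarrow> 2 \<le> i" for i
    by (auto simp: p_def)
  have coeff: "gadget_coeff a' (p i) (p j) = gadget_coeff a i j" if ij: "i < m" "j < m" for i j
  proof -
    have "a' (p i - 2) (p j - 2) \<longleftrightarrow> a (i - 2) (j - 2)" if "2 \<le> i" "2 \<le> j"
      using that ij E[of "i - 2" "j - 2"] by (simp add: p_def m_def)
    then show ?thesis
      unfolding gadget_coeff_def inj[OF ij] small by auto
  qed
  have rhs: "gadget_rhs (p i) = gadget_rhs i" and obj: "gadget_obj (p i) = gadget_obj i" for i
    unfolding gadget_rhs_def gadget_obj_def small by auto
  let ?f = "map_indices p"
  have inj_f: "inj_on ?f (Collect ?N)"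
  proof (rule inj_onI)
    fix x y assume "x \<in> Collect ?N" "y \<in> Collect ?N" "?f x = ?f y"
    then show "x = y" by (cases x; cases y) (simp_all add: inj)
  qed
  have img: "?f ` Collect ?N = Collect ?N'"
  proof
    show "?f ` Collect ?N \<subseteq> Collect ?N'"
    proof (clarify)
      fix x assume "?N x"
      then show "?N' (?f x)" by (cases x) (simp_all add: p)
    qed
    show "Collect ?N' \<subseteq> ?f ` Collect ?N"
    proof
      fix y assume "y \<in> Collect ?N'"
      then have y: "?N' y" by simp
      have "\<exists>x. ?N x \<and> ?f x = y"
      proof (cases y)
        case (Position i j)
        then obtain i' j' where "i' < m" "p i' = i" "j' < m" "p j' = j"
          using y surj[of i] surj[of j] by auto
        then show ?thesis using Position by (intro exI[of _ "Position i' j'"]) simp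
      next
        case (Position_Twin i j)
        then obtain i' j' where "i' < m" "p i' = i" "j' < m" "p j' = j"
          using y surj[of i] surj[of j] by auto
        then show ?thesis using Position_Twin y by (intro exI[of _ "Position_Twin i' j'"]) simp
      next
        case (Row i)
        then obtain i' where "i' < m" "p i' = i" using y surj[of i] by auto
        then show ?thesis using Row by (intro exI[of _ "Row i'"]) simp
      next
        case (Column i)
        then obtain i' where "i' < m" "p i' = i" using y surj[of i] by auto
        then show ?thesis using Column by (intro exI[of _ "Column i'"]) simp
      next
        case (Column_Twin i)
        then obtain i' where "i' < m" "p i' = i" using y surj[of i] by auto
        then show ?thesis using Column_Twin y by (intro exI[of _ "Column_Twin i'"]) simp
      qed (use y in \<open>auto intro!: exI[of _ y]\<close>)
      then show "y \<in> ?f ` Collect ?N" by blast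
    qed
  qed
  have arc: "gadget_arc a' (?f x) (?f y) \<longleftrightarrow> gadget_arc a x y" if "?N x" "?N y" for x y
    using that by (cases x; cases y) (simp_all add: inj coeff rhs obj)
  have adj: "{?f x, ?f y} \<in> edges (gadget_graph S m' a') \<longleftrightarrow> {x, y} \<in> edges (gadget_graph S m a)"
    if "?N x" "?N y" for x y
  proof -
    have "?N' (?f x)" "?N' (?f y)" using img that by auto
    then show ?thesis
      using that arc by (simp add: edge_gadget_graph_iff m gadget_adj_def)
  qed
  have "is_graph_iso ?f (gadget_graph S m a) (gadget_graph S m' a')"
    using inj_f img adj by (simp add: is_graph_iso_def nodes_gadget_graph m bij_betw_def)
  moreover have "ilp_node_label (?f x) = ilp_node_label x" for x by (cases x) simp_all
  ultimately show ?thesis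
    unfolding lgraph_isomorphic_def m_def m'_def by (auto simp: label_gadget_graph)
qed

theorem gadget_isomorphic_iff:
  assumes "\<And>i. i < n \<Longrightarrow> \<not> a i i" "\<And>i. i < n' \<Longrightarrow> \<not> a' i i"
  shows "lgraph_isomorphic (gadget_graph S (n + 2) a) (gadget_graph S (n' + 2) a') \<longleftrightarrow>
    index_isomorphic n a (\<lambda>_. ()) n' a' (\<lambda>_. ())"
  using gadget_iso_imp_index_isomorphic[of n a n' a' S] index_isomorphic_imp_gadget_iso[of n a n' a' S]
    assms by blast

section \<open>Numbering the nodes of the gadget\<close>

text \<open>A node is described by its kind \<open>t\<close>, its sign \<open>s\<close> (\<open>1\<close> for twins and negative coefficients)
  and two indices \<open>i, j < R\<close>, written as the digits of a number; coefficients use \<open>j\<close>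
  for their absolute value.\<close>

definition code :: "nat \<Rightarrow> nat \<Rightarrow> nat \<Rightarrow> nat \<Rightarrow> nat \<Rightarrow> nat" where
  "code R t s i j = ((t * 2 + s) * R + i) * R + j"

definition kind :: "nat \<Rightarrow> nat \<Rightarrow> nat" where "kind R p = p div R div R div 2"
definition sign_bit :: "nat \<Rightarrow> nat \<Rightarrow> nat" where "sign_bit R p = p div R div R mod 2"
definition fst_index :: "nat \<Rightarrow> nat \<Rightarrow> nat" where "fst_index R p = p div R mod R"
definition snd_index :: "nat \<Rightarrow> nat \<Rightarrow> nat" where "snd_index R p = p mod R"

lemma decode:
  assumes "s < 2" "i < R" "j < R"
  shows "kind R (code R t s i j) = t" "sign_bit R (code R t s i j) = s"
    "fst_index R (code R t s i j) = i" "snd_index R (code R t s i j) = j"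
proof -
  have "code R t s i j div R = (t * 2 + s) * R + i" "code R t s i j mod R = j"
    unfolding code_def using index_pair_div[OF assms(3)] by auto
  moreover have "((t * 2 + s) * R + i) div R = t * 2 + s" "((t * 2 + s) * R + i) mod R = i"
    using index_pair_div[OF assms(2)] by auto
  moreover have "(t * 2 + s) div 2 = t" "(t * 2 + s) mod 2 = s"
    using index_pair_div[OF assms(1)] by auto
  ultimately show "kind R (code R t s i j) = t" "sign_bit R (code R t s i j) = s"
    "fst_index R (code R t s i j) = i" "snd_index R (code R t s i j) = j"
    by (simp_all only: kind_def sign_bit_def fst_index_def snd_index_def)
qed

lemma code_decode: "code R (kind R p) (sign_bit R p) (fst_index R p) (snd_index R p) = p"
  unfolding code_def kind_def sign_bit_def fst_index_def snd_index_def by simp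

lemma sign_bit_less: "sign_bit R p < 2"
  by (simp add: sign_bit_def)

text \<open>Six kinds and two signs make the leading digit \<open>t * 2 + s\<close> less than
  12.\<close>

lemma code_less:
  assumes "t < 6" "s < 2" "i < R" "j < R"
  shows "code R t s i j < 12 * R * R"
proof -
  have "t * 2 + s \<le> 11" using assms by linarith
  then have "(t * 2 + s) * R + i < 12 * R"
    using mult_le_mono1[of "t * 2 + s" 11 R] assms(3) by linarith
  then have "Suc ((t * 2 + s) * R + i) * R \<le> 12 * R * R" by (intro mult_le_mono1) simp
  then show ?thesis using assms(4) by (simp add: code_def)
qed

definition valid_code :: "bool \<Rightarrow> nat \<Rightarrow> nat \<Rightarrow> nat \<Rightarrow> bool" where
  "valid_code S m R p \<longleftrightarrow> (let t = kind R p; s = sign_bit R p; i = fst_index R p; j = snd_index R p in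
     (S \<or> s = 0) \<and>
     (t = 0 \<and> i < m \<and> j < m \<or>
      t = 1 \<and> s = 0 \<and> i < m \<and> j = 0 \<or>
      t = 2 \<and> i = 0 \<and> j < m \<or>
      t = 3 \<and> i = 0 \<and> 1 \<le> j \<and> j \<le> 3 \<or>
      t = 4 \<and> s = 0 \<and> i = 0 \<and> 1 \<le> j \<and> j \<le> 2 \<or>
      t = 5 \<and> i = 0 \<and> 1 \<le> j \<and> j \<le> 2))"

definition make_node :: "nat \<Rightarrow> nat \<Rightarrow> nat \<Rightarrow> nat \<Rightarrow> ilp_node" where
  "make_node t s i j = (let u = (if s = 0 then real j else - real j) in
     if t = 0 then if s = 0 then Position i j else Position_Twin i j
     else if t = 1 then Row i
     else if t = 2 then if s = 0 then Column j else Column_Twin j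
     else if t = 3 then Coeff_A u
     else if t = 4 then Coeff_b u
     else Coeff_c u)"

definition node_of_code :: "nat \<Rightarrow> nat \<Rightarrow> ilp_node" where
  "node_of_code R p = make_node (kind R p) (sign_bit R p) (fst_index R p) (snd_index R p)"

definition code_arc :: "(nat \<Rightarrow> nat \<Rightarrow> bool) \<Rightarrow> nat \<Rightarrow> nat \<Rightarrow> nat \<Rightarrow> bool" where
  "code_arc a R p q \<longleftrightarrow> (let t = kind R p; s = sign_bit R p; i = fst_index R p; j = snd_index R p;
       t' = kind R q; s' = sign_bit R q; i' = fst_index R q; j' = snd_index R q in
     t = 0 \<and> t' = 1 \<and> i = i' \<or>
     t = 0 \<and> t' = 2 \<and> s = s' \<and> j = j' \<or>
     t = 0 \<and> t' = 3 \<and> s = s' \<and> j' = gadget_coeff a i j \<or>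
     t = 0 \<and> t' = 0 \<and> s = 0 \<and> s' = 1 \<and> i = i' \<and> j = j' \<or>
     t = 1 \<and> t' = 4 \<and> j' = gadget_rhs i \<or>
     t = 2 \<and> t' = 5 \<and> s = s' \<and> j' = gadget_obj j \<or>
     t = 2 \<and> t' = 2 \<and> s = 0 \<and> s' = 1 \<and> j = j')"

text \<open>Every kind owns a block of 8 names: the sign bit counts 4 and absolute values are at
  most 3. Nodes that are not coefficients get one name per kind, so twins share it.\<close>

definition code_label :: "nat \<Rightarrow> nat \<Rightarrow> nat" where
  "code_label R p = 8 * kind R p + (if 3 \<le> kind R p then 4 * sign_bit R p + snd_index R p else 0)"

definition coeff_name :: "real \<Rightarrow> nat" where
  "coeff_name u = (if u < 0 then 4 else 0) + nat \<lfloor>\<bar>u\<bar>\<rfloor>"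

fun label_name :: "ilp_label \<Rightarrow> nat" where
  "label_name Position_Label = 0"
| "label_name Row_Label = 8"
| "label_name Column_Label = 16"
| "label_name (Coeff_A_Label u) = 24 + coeff_name u"
| "label_name (Coeff_b_Label u) = 32 + coeff_name u"
| "label_name (Coeff_c_Label u) = 40 + coeff_name u"

lemma valid_code_cases:
  assumes "valid_code S m R p"
  obtains "kind R p = 0" "S \<or> sign_bit R p = 0" "fst_index R p < m" "snd_index R p < m"
  | "kind R p = 1" "sign_bit R p = 0" "fst_index R p < m" "snd_index R p = 0"
  | "kind R p = 2" "S \<or> sign_bit R p = 0" "fst_index R p = 0" "snd_index R p < m"
  | "kind R p = 3" "S \<or> sign_bit R p = 0" "fst_index R p = 0" "1 \<le> snd_index R p" "snd_index R p \<le> 3"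
  | "kind R p = 4" "sign_bit R p = 0" "fst_index R p = 0" "1 \<le> snd_index R p" "snd_index R p \<le> 2"
  | "kind R p = 5" "S \<or> sign_bit R p = 0" "fst_index R p = 0" "1 \<le> snd_index R p" "snd_index R p \<le> 2"
proof -
  have s: "S \<or> sign_bit R p = 0" using assms by (simp add: valid_code_def Let_def)
  from assms[unfolded valid_code_def Let_def, THEN conjunct2] show thesis
  proof (elim disjE, goal_cases)
    case 1 then show ?case using s by (intro that(1)) simp_all
  next
    case 2 then show ?case by (intro that(2)) simp_all
  next
    case 3 then show ?case using s by (intro that(3)) simp_all
  next
    case 4 then show ?case using s by (intro that(4)) simp_all
  next
    case 5 then show ?case by (intro that(5)) simp_all
  next
    case 6 then show ?case using s by (intro that(6)) simp_all
  qed
qed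

lemma label_node_of_code:
  assumes "valid_code S m R p"
  shows "label_name (ilp_node_label (node_of_code R p)) = code_label R p"
proof -
  have s: "sign_bit R p = 0 \<or> sign_bit R p = 1" using sign_bit_less[of R p] by linarith
  show ?thesis
    by (rule valid_code_cases[OF assms]; rule disjE[OF s])
      (simp_all add: node_of_code_def make_node_def code_label_def coeff_name_def)
qed

lemma arc_node_of_code:
  assumes "valid_code S m R p" "valid_code S m R q"
  shows "gadget_arc a (node_of_code R p) (node_of_code R q) \<longleftrightarrow> code_arc a R p q"
proof -
  have s: "sign_bit R p = 0 \<or> sign_bit R p = 1" "sign_bit R q = 0 \<or> sign_bit R q = 1"
    using sign_bit_less[of R p] sign_bit_less[of R q] by linarith+
  have ne: "real k \<noteq> - real l" "- real k \<noteq> real l" if "0 < l" for k l using that by linarith+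
  have pos: "0 < gadget_obj k" for k by (simp add: gadget_obj_def)
  show ?thesis
    by (rule valid_code_cases[OF assms(1)]; rule valid_code_cases[OF assms(2)];
        rule disjE[OF s(1)]; rule disjE[OF s(2)])
      (simp_all add: node_of_code_def make_node_def code_arc_def ne pos gadget_coeff_pos)
qed

fun node_code :: "nat \<Rightarrow> ilp_node \<Rightarrow> nat" where
  "node_code R (Position i j) = code R 0 0 i j"
| "node_code R (Position_Twin i j) = code R 0 1 i j"
| "node_code R (Row i) = code R 1 0 i 0"
| "node_code R (Column j) = code R 2 0 0 j"
| "node_code R (Column_Twin j) = code R 2 1 0 j"
| "node_code R (Coeff_A u) = code R 3 (of_bool (u < 0)) 0 (nat \<lfloor>\<bar>u\<bar>\<rfloor>)"
| "node_code R (Coeff_b u) = code R 4 0 0 (nat \<lfloor>\<bar>u\<bar>\<rfloor>)"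
| "node_code R (Coeff_c u) = code R 5 (of_bool (u < 0)) 0 (nat \<lfloor>\<bar>u\<bar>\<rfloor>)"

lemma node_code_make_node:
  assumes "valid_code S m R p"
  shows "node_code R (node_of_code R p) = p"
proof -
  have s: "sign_bit R p = 0 \<or> sign_bit R p = 1" using sign_bit_less[of R p] by linarith
  have "node_code R (node_of_code R p) = code R (kind R p) (sign_bit R p) (fst_index R p) (snd_index R p)"
    by (rule valid_code_cases[OF assms]; rule disjE[OF s])
      (simp_all add: node_of_code_def make_node_def)
  then show ?thesis by (simp only: code_decode)
qed

lemma gadget_node_of_code:
  assumes "valid_code S m R p"
  shows "gadget_node S m (node_of_code R p)"
proof -
  have s: "sign_bit R p = 0 \<or> sign_bit R p = 1" using sign_bit_less[of R p] by linarith
  have j3: "j = 1 \<or> j = 2 \<or> j = 3" if "1 \<le> j" "j \<le> 3" for j :: nat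
    using that by linarith
  have j2: "j = 1 \<or> j = 2" if "1 \<le> j" "j \<le> 2" for j :: nat
    using that by linarith
  show ?thesis
    using assms
  proof (cases rule: valid_code_cases)
    case 4
    then show ?thesis using s j3[OF 4(4,5)] by (elim disjE) (simp_all add: node_of_code_def make_node_def)
  next
    case 5
    then show ?thesis using j2[OF 5(4,5)] by (elim disjE) (simp_all add: node_of_code_def make_node_def)
  next
    case 6
    then show ?thesis using s j2[OF 6(4,5)] by (elim disjE) (simp_all add: node_of_code_def make_node_def)
  qed (auto simp: node_of_code_def make_node_def)
qed

lemma node_of_code_node_code:
  assumes "m < R" "3 < R" "gadget_node S m x"
  shows "node_of_code R (node_code R x) = x" "valid_code S m R (node_code R x)" "node_code R x < 12 * R * R"
proof -
  have V: "valid_code S' m R (code R t s i j) \<longleftrightarrow> (S' \<or> s = 0) \<and>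
     (t = 0 \<and> i < m \<and> j < m \<or>
      t = 1 \<and> s = 0 \<and> i < m \<and> j = 0 \<or>
      t = 2 \<and> i = 0 \<and> j < m \<or>
      t = 3 \<and> i = 0 \<and> 1 \<le> j \<and> j \<le> 3 \<or>
      t = 4 \<and> s = 0 \<and> i = 0 \<and> 1 \<le> j \<and> j \<le> 2 \<or>
      t = 5 \<and> i = 0 \<and> 1 \<le> j \<and> j \<le> 2)" if "s < 2" "i < R" "j < R" for S' t s i j
    unfolding valid_code_def Let_def decode[OF that] ..
  have N: "node_of_code R (code R t s i j) = make_node t s i j" if "s < 2" "i < R" "j < R" for t s i j
    unfolding node_of_code_def decode[OF that] ..
  have "node_of_code R (node_code R x) = x \<and> valid_code S m R (node_code R x) \<and> node_code R x < 12 * R * R"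
  proof (cases x)
    case (Coeff_A u)
    then have "u = 1 \<or> u = 2 \<or> u = 3 \<or> S \<and> (u = -1 \<or> u = -2 \<or> u = -3)" using assms(3) by simp
    then show ?thesis using assms Coeff_A
      by (elim disjE conjE) (simp_all add: V N make_node_def code_less)
  next
    case (Coeff_b u)
    then have "u = 1 \<or> u = 2" using assms(3) by simp
    then show ?thesis using assms Coeff_b
      by (elim disjE) (simp_all add: V N make_node_def code_less)
  next
    case (Coeff_c u)
    then have "u = 1 \<or> u = 2 \<or> S \<and> (u = -1 \<or> u = -2)" using assms(3) by simp
    then show ?thesis using assms Coeff_c
      by (elim disjE conjE) (simp_all add: V N make_node_def code_less)
  qed (use assms in \<open>simp_all add: V N make_node_def code_less\<close>)
  then show "node_of_code R (node_code R x) = x" "valid_code S m R (node_code R x)"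
    "node_code R x < 12 * R * R" by auto
qed

lemma node_of_code_bij:
  assumes "m < R" "3 < R"
  shows "bij_betw (node_of_code R) {p. p < 12 * R * R \<and> valid_code S m R p} (Collect (gadget_node S m))"
  by (rule bij_betw_byWitness[where f' = "node_code R"])
    (auto simp: node_code_make_node gadget_node_of_code node_of_code_node_code[OF assms])

text \<open>The radix \<open>n + 4\<close> exceeds both the index bound \<open>n + 2\<close> and the
  largest absolute value 3, also for \<open>n = 0\<close>. Filtering an initial segment of the
  numbers gives a listing without repetitions that a single loop can produce.\<close>

definition gadget_codes :: "bool \<Rightarrow> nat \<Rightarrow> nat list" where
  "gadget_codes S n = filter (valid_code S (n + 2) (n + 4)) [0..<12 * (n + 4) * (n + 4)]"

definition gadget_word :: "bool \<Rightarrow> nat \<Rightarrow> (nat \<Rightarrow> nat \<Rightarrow> bool) \<Rightarrow> nat list" where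
  "gadget_word S n a = (let ps = gadget_codes S n; N = length ps; R = n + 4 in
     [N] @ map (\<lambda>k. of_bool (code_arc a R (ps ! (k div N)) (ps ! (k mod N)) \<or>
         code_arc a R (ps ! (k mod N)) (ps ! (k div N)))) [0..<N * N] @
       map (\<lambda>k. code_label R (ps ! k)) [0..<N])"

lemma numbering_gadget:
  "numbering (map (node_of_code (n + 4)) (gadget_codes S n)) (gadget_graph S (n + 2) a)"
proof -
  have set: "set (gadget_codes S n) = {p. p < 12 * (n + 4) * (n + 4) \<and> valid_code S (n + 2) (n + 4) p}"
    by (auto simp: gadget_codes_def)
  have "bij_betw (node_of_code (n + 4)) (set (gadget_codes S n)) (Collect (gadget_node S (n + 2)))"
    unfolding set by (rule node_of_code_bij) simp_all
  moreover have "distinct (gadget_codes S n)" by (simp add: gadget_codes_def)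
  ultimately show ?thesis
    by (simp add: numbering_def distinct_map bij_betw_def nodes_gadget_graph)
qed

lemma gadget_word_eq:
  "gadget_word S n a =
    lgraph_word label_name (gadget_graph S (n + 2) a) (map (node_of_code (n + 4)) (gadget_codes S n))"
proof -
  let ?ps = "gadget_codes S n" and ?R = "n + 4" and ?X = "gadget_graph S (n + 2) a"
  let ?xs = "map (node_of_code ?R) ?ps"
  let ?N = "length ?ps"
  have v: "valid_code S (n + 2) ?R (?ps ! k)" "gadget_node S (n + 2) (node_of_code ?R (?ps ! k))"
    if "k < ?N" for k
  proof -
    have "?ps ! k \<in> set ?ps" using that by simp
    then show "valid_code S (n + 2) ?R (?ps ! k)" unfolding gadget_codes_def by simp
    have "node_of_code ?R (?ps ! k) \<in> set ?xs" using that by simp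
    then show "gadget_node S (n + 2) (node_of_code ?R (?ps ! k))"
      using numbering_gadget[of n S a] by (simp add: numbering_def nodes_gadget_graph del: set_map)
  qed
  have "edge_at ?X ?xs (k div ?N) (k mod ?N) \<longleftrightarrow>
      code_arc a ?R (?ps ! (k div ?N)) (?ps ! (k mod ?N)) \<or> code_arc a ?R (?ps ! (k mod ?N)) (?ps ! (k div ?N))"
    if "k < ?N * ?N" for k
    using div_mod_less[OF that] v arc_node_of_code[of S "n + 2" ?R]
    by (simp add: edge_gadget_graph_iff gadget_adj_def)
  then have "adjacency_word ?X ?xs = ?N # map (\<lambda>k. of_bool (code_arc a ?R (?ps ! (k div ?N)) (?ps ! (k mod ?N)) \<or>
         code_arc a ?R (?ps ! (k mod ?N)) (?ps ! (k div ?N)))) [0..<?N * ?N]"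
    unfolding adjacency_word_eq by simp
  moreover have "map (\<lambda>x. label_name (label ?X x)) ?xs = map (\<lambda>k. code_label ?R (?ps ! k)) [0..<?N]"
    by (rule nth_equalityI) (simp_all add: label_gadget_graph label_node_of_code[OF v(1)])
  ultimately show ?thesis
    unfolding gadget_word_def lgraph_word_def Let_def by simp
qed

text \<open>\<open>coeff_name\<close> rounds and so is not injective on all reals; on the
  coefficients of gadgets, nonzero integers of absolute value at most 3, its values differ.\<close>

lemma inj_label_name:
  "inj_on label_name (label (gadget_graph S (n + 2) a) ` nodes (gadget_graph S (n + 2) a) \<union>
    label (gadget_graph S (n' + 2) a') ` nodes (gadget_graph S (n' + 2) a'))"
proof -
  define U :: "real set" where "U = {1, 2, 3, -1, -2, -3}"
  define D where "D = {Position_Label, Row_Label, Column_Label} \<union>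
    (Coeff_A_Label ` U \<union> Coeff_b_Label ` U \<union> Coeff_c_Label ` U)"
  have "ilp_node_label x \<in> D" if "gadget_node S m x" for m x
    using that by (cases x) (auto simp: D_def U_def)
  then have sub: "label (gadget_graph S (n + 2) a) ` nodes (gadget_graph S (n + 2) a) \<union>
    label (gadget_graph S (n' + 2) a') ` nodes (gadget_graph S (n' + 2) a') \<subseteq> D"
    by (auto simp: label_gadget_graph nodes_gadget_graph)
  have "inj_on label_name D"
    unfolding D_def U_def by (auto simp: inj_on_def coeff_name_def)
  then show ?thesis using sub by (rule inj_on_subset)
qed

lemma gadget_pair_word:
  "lgraph_pair_word (gadget_graph S (n + 2) a) (gadget_graph S (n' + 2) a')
    (gadget_word S n a @ gadget_word S n' a')"
  unfolding lgraph_pair_word_iff gadget_word_eq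
  using inj_label_name numbering_gadget by blast

section \<open>Reducing graph isomorphism to ILP graphs\<close>

text \<open>Arrays 3 and 4 hold the position of the current graph in the input and its number of nodes,
  array 2 the loop counter and array 5 the list of node codes.\<close>

abbreviation (input) "radix_exp \<equiv> Add (Scalar 4) (Const 4)"

definition kind_exp :: "aexp \<Rightarrow> aexp" where
  "kind_exp p = Div (Div (Div p radix_exp) radix_exp) (Const 2)"

definition sign_exp :: "aexp \<Rightarrow> aexp" where
  "sign_exp p = EMod (Div (Div p radix_exp) radix_exp) (Const 2)"

definition fst_exp :: "aexp \<Rightarrow> aexp" where
  "fst_exp p = EMod (Div p radix_exp) radix_exp"

definition snd_exp :: "aexp \<Rightarrow> aexp" where
  "snd_exp p = EMod p radix_exp"

lemma val_digits:
  "s 4 0 = n \<Longrightarrow> val (kind_exp p) s = kind (n + 4) (val p s)"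
  "s 4 0 = n \<Longrightarrow> val (sign_exp p) s = sign_bit (n + 4) (val p s)"
  "s 4 0 = n \<Longrightarrow> val (fst_exp p) s = fst_index (n + 4) (val p s)"
  "s 4 0 = n \<Longrightarrow> val (snd_exp p) s = snd_index (n + 4) (val p s)"
  by (simp_all add: kind_exp_def sign_exp_def fst_exp_def snd_exp_def
      kind_def sign_bit_def fst_index_def snd_index_def)

definition all_exp :: "aexp list \<Rightarrow> aexp" where
  "all_exp es = foldr EAnd es (Const 1)"

definition any_exp :: "aexp list \<Rightarrow> aexp" where
  "any_exp es = foldr EOr es (Const 0)"

lemma val_all_exp: "val (all_exp es) s \<noteq> 0 \<longleftrightarrow> (\<forall>e \<in> set es. val e s \<noteq> 0)"
  by (induction es) (auto simp: all_exp_def)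

lemma val_any_exp: "val (any_exp es) s \<noteq> 0 \<longleftrightarrow> (\<exists>e \<in> set es. val e s \<noteq> 0)"
  by (induction es) (auto simp: any_exp_def)

definition less_exp :: "aexp \<Rightarrow> aexp \<Rightarrow> aexp" where
  "less_exp e1 e2 = Sub e2 e1"

lemma val_less_exp: "val (less_exp e1 e2) s \<noteq> 0 \<longleftrightarrow> val e1 s < val e2 s"
  by (auto simp: less_exp_def)

definition valid_exp :: "bool \<Rightarrow> aexp \<Rightarrow> aexp" where
  "valid_exp S p = (let t = kind_exp p; s = sign_exp p; i = fst_exp p; j = snd_exp p;
       m = Add (Scalar 4) (Const 2) in
     all_exp [if S then Const 1 else EEq s (Const 0), any_exp
       [all_exp [EEq t (Const 0), less_exp i m, less_exp j m],
        all_exp [EEq t (Const 1), EEq s (Const 0), less_exp i m, EEq j (Const 0)],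
        all_exp [EEq t (Const 2), EEq i (Const 0), less_exp j m],
        all_exp [EEq t (Const 3), EEq i (Const 0), ELeq (Const 1) j, ELeq j (Const 3)],
        all_exp [EEq t (Const 4), EEq s (Const 0), EEq i (Const 0), ELeq (Const 1) j, ELeq j (Const 2)],
        all_exp [EEq t (Const 5), EEq i (Const 0), ELeq (Const 1) j, ELeq j (Const 2)]]])"

lemma val_valid_exp:
  assumes "s 4 0 = n"
  shows "val (valid_exp S p) s \<noteq> 0 \<longleftrightarrow> valid_code S (n + 2) (n + 4) (val p s)"
proof -
  have "val (valid_exp S p) s \<noteq> 0 \<longleftrightarrow> (S \<or> sign_bit (n + 4) (val p s) = 0) \<and>
     (kind (n + 4) (val p s) = 0 \<and> fst_index (n + 4) (val p s) < n + 2 \<and> snd_index (n + 4) (val p s) < n + 2 \<or>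
      kind (n + 4) (val p s) = 1 \<and> sign_bit (n + 4) (val p s) = 0 \<and> fst_index (n + 4) (val p s) < n + 2 \<and> snd_index (n + 4) (val p s) = 0 \<or>
      kind (n + 4) (val p s) = 2 \<and> fst_index (n + 4) (val p s) = 0 \<and> snd_index (n + 4) (val p s) < n + 2 \<or>
      kind (n + 4) (val p s) = 3 \<and> fst_index (n + 4) (val p s) = 0 \<and> 1 \<le> snd_index (n + 4) (val p s) \<and> snd_index (n + 4) (val p s) \<le> 3 \<or>
      kind (n + 4) (val p s) = 4 \<and> sign_bit (n + 4) (val p s) = 0 \<and> fst_index (n + 4) (val p s) = 0 \<and> 1 \<le> snd_index (n + 4) (val p s) \<and> snd_index (n + 4) (val p s) \<le> 2 \<or>
      kind (n + 4) (val p s) = 5 \<and> fst_index (n + 4) (val p s) = 0 \<and> 1 \<le> snd_index (n + 4) (val p s) \<and> snd_index (n + 4) (val p s) \<le> 2)"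
    unfolding valid_exp_def Let_def val_all_exp val_any_exp list.set ball_simps bex_simps
      val_less_exp val_digits[of s, OF assms] val.simps val_EEq val_ELeq assms
    by (simp add: val_digits[of s, OF assms])
  then show ?thesis unfolding valid_code_def Let_def .
qed

text \<open>Conjunctions are products, and all their operands are evaluated. For an index below 2
  truncated subtraction makes the last operand read some irrelevant cell, whose value is then
  multiplied by 0.\<close>

definition coeff_exp :: "aexp \<Rightarrow> aexp \<Rightarrow> aexp" where
  "coeff_exp i j = EIf (EAnd (EEq i j) i) (Const 3)
     (EIf (EOr (EAnd (EEq i (Const 0)) (EEq j (Const 1)))
          (all_exp [ELeq (Const 2) i, ELeq (Const 2) j,
             Cell 0 (Add (Add (Scalar 3) (Const 1))
               (Add (Mult (Sub i (Const 2)) (Scalar 4)) (Sub j (Const 2))))]))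
        (Const 2) (Const 1))"

text \<open>Cell \<open>b\<close> holds the node count, and the matrix follows row by row. Reading
  the memory rather than the word gives a meaning to malformed words too, the one that the program
  sees.\<close>

definition input_adj :: "(nat \<Rightarrow> nat) \<Rightarrow> nat \<Rightarrow> nat \<Rightarrow> nat \<Rightarrow> bool" where
  "input_adj M b i j \<longleftrightarrow> M (b + 1 + (i * M b + j)) \<noteq> 0"

lemma val_coeff_exp:
  assumes "s 3 0 = b" "s 4 0 = s 0 b"
  shows "val (coeff_exp i j) s = gadget_coeff (input_adj (s 0) b) (val i s) (val j s)"
proof -
  have "s 0 (b + 1 + ((val i s - 2) * s 0 b + (val j s - 2))) \<noteq> 0 \<longleftrightarrow>
      input_adj (s 0) b (val i s - 2) (val j s - 2)"
    by (simp only: input_adj_def)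
  then show ?thesis
    unfolding coeff_exp_def val_EIf val_EOr val_all_exp list.set ball_simps val.simps val_EEq val_ELeq assms
    by (auto simp: gadget_coeff_def)
qed

definition arc_exp :: "aexp \<Rightarrow> aexp \<Rightarrow> aexp" where
  "arc_exp p q = (let t = kind_exp p; s = sign_exp p; i = fst_exp p; j = snd_exp p;
       t' = kind_exp q; s' = sign_exp q; i' = fst_exp q; j' = snd_exp q in
     any_exp
       [all_exp [EEq t (Const 0), EEq t' (Const 1), EEq i i'],
        all_exp [EEq t (Const 0), EEq t' (Const 2), EEq s s', EEq j j'],
        all_exp [EEq t (Const 0), EEq t' (Const 3), EEq s s', EEq j' (coeff_exp i j)],
        all_exp [EEq t (Const 0), EEq t' (Const 0), EEq s (Const 0), EEq s' (Const 1), EEq i i', EEq j j'],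
        all_exp [EEq t (Const 1), EEq t' (Const 4), EEq j' (EIf i (Const 2) (Const 1))],
        all_exp [EEq t (Const 2), EEq t' (Const 5), EEq s s', EEq j' (EIf (EEq j (Const 1)) (Const 2) (Const 1))],
        all_exp [EEq t (Const 2), EEq t' (Const 2), EEq s (Const 0), EEq s' (Const 1), EEq j j']])"

lemma val_arc_exp:
  assumes "s 3 0 = b" "s 4 0 = s 0 b"
  shows "val (arc_exp p q) s \<noteq> 0 \<longleftrightarrow> code_arc (input_adj (s 0) b) (s 0 b + 4) (val p s) (val q s)"
proof -
  have rhs: "(if i \<noteq> 0 then 2 else 1) = gadget_rhs i" for i by (simp add: gadget_rhs_def)
  have obj: "(if of_bool (j = 1) \<noteq> (0 :: nat) then 2 else 1) = gadget_obj j" for j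
    by (simp add: gadget_obj_def)
  show ?thesis
    unfolding arc_exp_def Let_def val_all_exp val_any_exp list.set ball_simps bex_simps
      val_digits[of s, OF assms(2)] val.simps val_EEq val_EIf val_coeff_exp[OF assms] rhs obj
      code_arc_def of_bool_eq_0_iff not_not
    by (simp add: gadget_obj_def)
qed

definition label_exp :: "aexp \<Rightarrow> aexp" where
  "label_exp p = Add (Mult (Const 8) (kind_exp p))
     (EIf (ELeq (Const 3) (kind_exp p)) (Add (Mult (Const 4) (sign_exp p)) (snd_exp p)) (Const 0))"

lemma val_label_exp:
  "s 4 0 = n \<Longrightarrow> val (label_exp p) s = code_label (n + 4) (val p s)"
  by (simp add: label_exp_def code_label_def val_digits)

text \<open>Kinds go up to 5 and the part within a block is at most 7, so \<open>8 * 5 + 7\<close>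
  suffices.\<close>

lemma code_label_le:
  assumes "valid_code S m R p"
  shows "code_label R p \<le> 47"
  using assms by (cases rule: valid_code_cases)
    (use sign_bit_less[of R p] in \<open>auto simp: code_label_def\<close>)

definition loop_append :: "aexp \<Rightarrow> nat \<Rightarrow> aexp \<Rightarrow> cmd" where
  "loop_append cnt a e = for_loop 2 cnt (Cond (Const 1) (append_to a e) Skip)"

text \<open>The program is run once per input graph. Resetting the length of array 5 discards the
  codes of the previous run, and the last assignment moves array 3 past the matrix just
  read.\<close>

definition emit_gadget :: "bool \<Rightarrow> cmd" where
  "emit_gadget S =
     Seq (assign 4 (Cell 0 (Scalar 3)))
    (Seq (assign 5 (Const 0))
    (Seq (for_loop 2 (Mult (Mult (Const 12) radix_exp) radix_exp)
           (Cond (valid_exp S (Scalar 2)) (append_to 5 (Scalar 2)) Skip))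
    (Seq (append_to 1 (Scalar 5))
    (Seq (loop_append (Mult (Scalar 5) (Scalar 5)) 1
           (let p = Cell 5 (Add (Div (Scalar 2) (Scalar 5)) (Const 1));
                q = Cell 5 (Add (EMod (Scalar 2) (Scalar 5)) (Const 1))
            in EOr (arc_exp p q) (arc_exp q p)))
    (Seq (loop_append (Scalar 5) 1 (label_exp (Cell 5 (Add (Scalar 2) (Const 1)))))
         (assign 3 (Add (Add (Scalar 3) (Const 1)) (Mult (Scalar 4) (Scalar 4)))))))))"

lemma list_at_cong: "s a = s' a \<Longrightarrow> list_at a s = list_at a s'"
  by (simp add: list_at_def)

text \<open>\<open>B\<close> bounds the candidate codes and hence the number of nodes, so
  \<open>B * B\<close> covers the loop over the matrix and \<open>2 * B\<close> the two linear
  loops; 50 leaves room for label names up to 47. The second bound on \<open>K\<close> is for the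
  final value of array 3.\<close>

lemma timed_emit_gadget:
  fixes s :: memory and S :: bool
  defines "b \<equiv> s 3 0" and "n \<equiv> s 0 (s 3 0)"
  defines "B \<equiv> 12 * (n + 4) * (n + 4)"
  assumes s: "bounded_memory K s"
    and K: "s 1 0 + B * B + 2 * B + 50 < K" "b + 1 + n * n + 1 < K"
  shows "timed K (emit_gadget S) s (\<lambda>s'. s' 0 = s 0 \<and> s' 3 0 = b + 1 + n * n \<and>
    list_at 1 s' = list_at 1 s @ gadget_word S n (input_adj (s 0) b))"
proof -
  define ps where "ps = gadget_codes S n"
  define N where "N = length ps"
  let ?a = "input_adj (s 0) b" and ?R = "n + 4"
  let ?arc = "\<lambda>k. of_bool (code_arc ?a ?R (ps ! (k div N)) (ps ! (k mod N)) \<or>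
         code_arc ?a ?R (ps ! (k mod N)) (ps ! (k div N))) :: nat"
  have NB: "N \<le> B"
    unfolding N_def ps_def gadget_codes_def B_def by (metis length_filter_le length_upt diff_zero)
  then have NNB: "N * N \<le> B * B" by (rule mult_le_mono) (rule NB)
  have log: "log_size x \<le> K" if "x + 1 \<le> K" for x
    using log_size_le_Suc[of x] that by simp
  have K1: "log_size 1 \<le> K" by (rule log) (use K in simp)
  let ?base = "\<lambda>s'. s' 0 = s 0 \<and> s' 3 0 = b \<and> s' 4 0 = n"
  show ?thesis
    unfolding emit_gadget_def
  proof (rule timed_Seq)
    show "timed K (assign 4 (Cell 0 (Scalar 3))) s (\<lambda>s'. ?base s' \<and> s' 1 = s 1)"
      by (rule timed_Store) (use s in \<open>auto simp: b_def n_def bounded_memory_def\<close>)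
  next
    fix s1 assume s1: "bounded_memory K s1" "?base s1 \<and> s1 1 = s 1"
    let ?Q1 = "\<lambda>s'. ?base s' \<and> s' 1 = s 1 \<and> s' 5 0 = 0"
    let ?Q2 = "\<lambda>s'. ?base s' \<and> s' 1 = s 1 \<and> list_at 5 s' = ps"
    let ?Q3 = "\<lambda>s'. ?base s' \<and> list_at 5 s' = ps \<and> list_at 1 s' = list_at 1 s @ [N]"
    let ?Q4 = "\<lambda>s'. ?base s' \<and> list_at 5 s' = ps \<and>
      list_at 1 s' = list_at 1 s @ [N] @ map ?arc [0..<N * N]"
    let ?Q5 = "\<lambda>s'. ?base s' \<and> list_at 1 s' = list_at 1 s @ gadget_word S n ?a"
    show "timed K (Seq (assign 5 (Const 0))
      (Seq (for_loop 2 (Mult (Mult (Const 12) radix_exp) radix_exp)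
             (Cond (valid_exp S (Scalar 2)) (append_to 5 (Scalar 2)) Skip))
      (Seq (append_to 1 (Scalar 5))
      (Seq (loop_append (Mult (Scalar 5) (Scalar 5)) 1
             (let p = Cell 5 (Add (Div (Scalar 2) (Scalar 5)) (Const 1));
                  q = Cell 5 (Add (EMod (Scalar 2) (Scalar 5)) (Const 1))
              in EOr (arc_exp p q) (arc_exp q p)))
      (Seq (loop_append (Scalar 5) 1 (label_exp (Cell 5 (Add (Scalar 2) (Const 1)))))
           (assign 3 (Add (Add (Scalar 3) (Const 1)) (Mult (Scalar 4) (Scalar 4)))))))))
      s1 (\<lambda>s'. s' 0 = s 0 \<and> s' 3 0 = b + 1 + n * n \<and>
        list_at 1 s' = list_at 1 s @ gadget_word S n ?a)"
    proof (intro timed_Seq)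
      show "timed K (assign 5 (Const 0)) s1 ?Q1"
        by (rule timed_Store) (use s1 K log[of 0] in auto)
    next
      fix s' assume s': "bounded_memory K s'" "?Q1 s'"
      show "timed K (for_loop 2 (Mult (Mult (Const 12) radix_exp) radix_exp)
             (Cond (valid_exp S (Scalar 2)) (append_to 5 (Scalar 2)) Skip)) s' ?Q2"
      proof (rule timed_filter_loop[where N = B and F = "\<lambda>k. k" and P = "valid_code S (n + 2) (n + 4)"])
        fix s2 assume ag: "agree_except {5, 2} s' s2"
        show "val (Mult (Mult (Const 12) radix_exp) radix_exp) s2 = B"
          using s' by (simp add: agree_exceptD[OF ag] B_def)
        { fix k assume k: "k < B" "s2 2 0 = k"
          show "(val (valid_exp S (Scalar 2)) s2 \<noteq> 0) = valid_code S (n + 2) (n + 4) k \<and>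
              (valid_code S (n + 2) (n + 4) k \<longrightarrow> val (Scalar 2) s2 = k \<and> log_size k \<le> K)"
            using s' k K log[of k] val_valid_exp[of s2 n S "Scalar 2"]
            by (simp add: agree_exceptD[OF ag]) }
        assume "list_at 5 s2 = list_at 5 s' @ map (\<lambda>k. k) (filter (valid_code S (n + 2) (n + 4)) [0..<B])"
        then show "?Q2 s2"
          using s' by (simp add: agree_exceptD[OF ag] ps_def gadget_codes_def B_def list_at_def)
      qed (use s' K in auto)
    next
      fix s' assume s': "bounded_memory K s'" "?Q2 s'"
      then have l: "s' 5 0 = N" using length_list_at[of 5 s'] by (simp add: N_def)
      show "timed K (append_to 1 (Scalar 5)) s' ?Q3"
      proof (rule timed_append)
        fix s2 assume ag: "agree_except {1} s' s2" and "list_at 1 s2 = list_at 1 s' @ [val (Scalar 5) s']"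
        then show "?Q3 s2"
          using s' l list_at_cong[of s2 5 s'] list_at_cong[of s' 1 s] by (simp add: agree_exceptD[OF ag])
      qed (use s' l K NB log[of N] in auto)
    next
      fix s' assume s': "bounded_memory K s'" "?Q3 s'"
      then have l: "s' 5 0 = N" "s' 1 0 = s 1 0 + 1"
        using length_list_at[of 5 s'] length_list_at[of 1 s'] by (simp_all add: N_def)
      show "timed K (loop_append (Mult (Scalar 5) (Scalar 5)) 1
             (let p = Cell 5 (Add (Div (Scalar 2) (Scalar 5)) (Const 1));
                  q = Cell 5 (Add (EMod (Scalar 2) (Scalar 5)) (Const 1))
              in EOr (arc_exp p q) (arc_exp q p))) s' ?Q4"
        unfolding loop_append_def
      proof (rule timed_append_loop[where N = "N * N" and F = ?arc])
        fix s2 assume ag: "agree_except {1, 2} s' s2"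
        show "val (Mult (Scalar 5) (Scalar 5)) s2 = N * N"
          using l by (simp add: agree_exceptD[OF ag])
        { fix k assume k: "k < N * N" "s2 2 0 = k"
          have kN: "k div N < N" "k mod N < N" using div_mod_less[OF k(1)] by auto
          have at: "s' 5 (Suc i) = ps ! i" if "i < N" for i
            using nth_list_at[of i s' 5] that s' l by simp
          have b: "s2 3 0 = b" "s2 4 0 = s2 0 b" "s2 0 = s 0" "s 0 b = n"
            using s' by (auto simp: agree_exceptD[OF ag] b_def n_def)
          show "val (let p = Cell 5 (Add (Div (Scalar 2) (Scalar 5)) (Const 1));
                  q = Cell 5 (Add (EMod (Scalar 2) (Scalar 5)) (Const 1))
              in EOr (arc_exp p q) (arc_exp q p)) s2 = ?arc k \<and> log_size (?arc k) \<le> K"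
          proof
            show "log_size (?arc k) \<le> K" by (rule log) (use K in auto)
            show "val (let p = Cell 5 (Add (Div (Scalar 2) (Scalar 5)) (Const 1));
                  q = Cell 5 (Add (EMod (Scalar 2) (Scalar 5)) (Const 1))
              in EOr (arc_exp p q) (arc_exp q p)) s2 = ?arc k"
              unfolding Let_def val_EOr val_arc_exp[OF b(1,2)] b(3,4)
              using k kN at l by (simp add: agree_exceptD[OF ag])
          qed }
        assume "list_at 1 s2 = list_at 1 s' @ map ?arc [0..<N * N]"
        then show "?Q4 s2"
          using s' l list_at_cong[of s2 5 s'] by (simp add: agree_exceptD[OF ag])
      qed (use s' l K NB NNB in auto)
    next
      fix s' assume s': "bounded_memory K s'" "?Q4 s'"
      then have l: "s' 5 0 = N" "s' 1 0 = s 1 0 + 1 + N * N"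
        using length_list_at[of 5 s'] length_list_at[of 1 s'] by (simp_all add: N_def)
      show "timed K (loop_append (Scalar 5) 1 (label_exp (Cell 5 (Add (Scalar 2) (Const 1))))) s' ?Q5"
        unfolding loop_append_def
      proof (rule timed_append_loop[where N = N and F = "\<lambda>k. code_label ?R (ps ! k)"])
        fix s2 assume ag: "agree_except {1, 2} s' s2"
        show "val (Scalar 5) s2 = N"
          using l by (simp add: agree_exceptD[OF ag])
        { fix k assume k: "k < N" "s2 2 0 = k"
          have at: "s' 5 (Suc k) = ps ! k"
            using nth_list_at[of k s' 5] k s' l by simp
          have "ps ! k \<in> set ps" using k by (simp add: N_def)
          then have "valid_code S (n + 2) ?R (ps ! k)" by (simp add: ps_def gadget_codes_def)
          then have "code_label ?R (ps ! k) \<le> 47" by (rule code_label_le)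
          moreover have "s2 4 0 = n" using s' by (simp add: agree_exceptD[OF ag])
          ultimately show "val (label_exp (Cell 5 (Add (Scalar 2) (Const 1)))) s2 = code_label ?R (ps ! k) \<and>
              log_size (code_label ?R (ps ! k)) \<le> K"
            using K log at k by (simp add: val_label_exp agree_exceptD[OF ag]) }
        assume "list_at 1 s2 = list_at 1 s' @ map (\<lambda>k. code_label ?R (ps ! k)) [0..<N]"
        then show "?Q5 s2"
          using s' by (simp add: agree_exceptD[OF ag] gadget_word_def Let_def ps_def N_def)
      qed (use s' l K NB NNB in auto)
    next
      fix s' assume s': "bounded_memory K s'" "?Q5 s'"
      show "timed K (assign 3 (Add (Add (Scalar 3) (Const 1)) (Mult (Scalar 4) (Scalar 4)))) s'
        (\<lambda>s'. s' 0 = s 0 \<and> s' 3 0 = b + 1 + n * n \<and>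
          list_at 1 s' = list_at 1 s @ gadget_word S n ?a)"
        by (rule timed_Store) (use s' K log[of "b + 1 + n * n"] in \<open>auto simp: list_at_def\<close>)
    qed
  qed
qed

lemma init_memory_Suc: "i < length w \<Longrightarrow> init_memory w 0 (Suc i) = w ! i"
  by (simp add: init_memory_def)

lemma init_memory_0: "init_memory w 0 0 = length w"
  by (simp add: init_memory_def)

lemma init_memory_other: "a \<noteq> 0 \<Longrightarrow> init_memory w a i = 0"
  by (simp add: init_memory_def)

text \<open>A word that is not an instance may announce graphs much larger than itself.\<close>

definition size_guard :: "aexp \<Rightarrow> aexp" where
  "size_guard i = EAnd (ELeq (Cell 0 (Const 1)) (Scalar 0)) (ELeq (Cell 0 i) (Scalar 0))"

lemma val_size_guard:
  "s 0 = init_memory w 0 \<Longrightarrow> val (size_guard i) s \<noteq> 0 \<longleftrightarrow>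
    init_memory w 0 1 \<le> length w \<and> init_memory w 0 (val i s) \<le> length w"
  by (simp add: size_guard_def init_memory_0)

text \<open>The first graph starts in cell 1 and takes \<open>1 + n * n\<close> cells, so the second
  starts in cell \<open>2 + n * n\<close>. In an instance no node count exceeds the length of the
  word, so the empty output only concerns words outside the promise.\<close>

definition gadget_reduction :: "bool \<Rightarrow> nat list \<Rightarrow> nat list" where
  "gadget_reduction S w = (let M = init_memory w 0; n = M 1; b = 2 + n * n; n' = M b in
     if n \<le> length w \<and> n' \<le> length w
     then gadget_word S n (input_adj M 1) @ gadget_word S n' (input_adj M b) else [])"

definition gadget_program :: "bool \<Rightarrow> cmd" where
  "gadget_program S = Seq (assign 3 (Const 1))
     (Cond (size_guard (Add (Const 2) (Mult (Cell 0 (Const 1)) (Cell 0 (Const 1)))))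
       (Seq (emit_gadget S) (emit_gadget S)) Skip)"

lemma length_gadget_word:
  "length (gadget_word S n a) \<le>
    1 + (12 * (n + 4) * (n + 4)) * (12 * (n + 4) * (n + 4)) + 12 * (n + 4) * (n + 4)"
proof -
  have "length (gadget_codes S n) \<le> 12 * (n + 4) * (n + 4)"
    unfolding gadget_codes_def by (metis length_filter_le length_upt diff_zero)
  from this mult_le_mono[OF this this] show ?thesis
    unfolding gadget_word_def Let_def by simp
qed

text \<open>With \<open>L\<close> the size of the input, \<open>1000 (L + 4)\<^sup>4\<close> crudely bounds the number of iterations
  of every loop and every number stored that is not copied from the input.\<close>

definition memory_bound :: "nat poly" where
  "memory_bound = [:1000:] * [:4, 1:] ^ 4"

lemma poly_memory_bound:
  "poly memory_bound L = 1000 * (((L + 4) * (L + 4)) * ((L + 4) * (L + 4)))"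
  by (simp add: memory_bound_def power4_eq_xxxx algebra_simps)

lemma square_add_4: "(L + 4) * (L + 4) \<le> ((L + 4) * (L + 4)) * ((L + 4) * (L + 4 :: nat))"
  "L + 16 \<le> (L + 4) * (L + 4)"
  by (simp_all add: algebra_simps)

text \<open>With \<open>y\<close> the square of \<open>L + 4\<close>, the bound \<open>K\<close> is
  \<open>1000 * (y * y)\<close>. All sizes are estimated in terms of \<open>y\<close> and
  \<open>y * y\<close>, which makes every comparison with \<open>K\<close> linear in these two
  quantities.\<close>

lemma gadget_reduction_poly_time: "poly_time_computable (gadget_reduction S)"
proof (rule poly_time_computableI)
  fix w
  define L where "L = word_size w"
  define K where "K = poly memory_bound (word_size w)"
  define y where "y = (L + 4) * (L + 4)"
  have K: "K = 1000 * (y * y)" unfolding K_def poly_memory_bound y_def L_def ..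
  have y: "L + 16 \<le> y" "y \<le> y * y" unfolding y_def by (simp_all only: square_add_4)
  show "word_size w < poly memory_bound (word_size w)"
    unfolding K_def[symmetric] using K y L_def by linarith
  have wl: "length w \<le> L" unfolding L_def by (rule length_le_word_size)
  define s where "s = init_memory w"
  have bs: "bounded_memory K s"
    unfolding s_def by (rule bounded_init_memory) (use K y L_def in linarith)
  have k1: "log_size 1 \<le> K" using log_size_le_Suc[of 1] K y by linarith
  define n where "n = s 0 1"
  define b where "b = 2 + n * n"
  define n' where "n' = s 0 b"
  define B where "B m = 12 * (m + 4) * (m + 4)" for m :: nat
  have size: "B m \<le> 12 * y" "B m * B m \<le> 144 * (y * y)" "m * m \<le> y" if "m \<le> length w" for m
  proof -
    have "(m + 4) * (m + 4) \<le> y" unfolding y_def by (rule mult_le_mono) (use that wl in auto)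
    then show 1: "B m \<le> 12 * y" unfolding B_def mult.assoc by (rule mult_le_mono2)
    show "B m * B m \<le> 144 * (y * y)" using mult_le_mono[OF 1 1] by simp
    show "m * m \<le> y" unfolding y_def by (rule mult_le_mono) (use that wl in auto)
  qed
  let ?W = "gadget_word S n (input_adj (s 0) 1)" and ?W' = "gadget_word S n' (input_adj (s 0) b)"
  have len: "length ?W \<le> 1 + B n * B n + B n" "length ?W' \<le> 1 + B n' * B n' + B n'"
    unfolding B_def by (rule length_gadget_word)+
  have f: "gadget_reduction S w = (if n \<le> length w \<and> n' \<le> length w then ?W @ ?W' else [])"
    unfolding gadget_reduction_def Let_def n'_def b_def n_def s_def ..
  have out0: "list_at 1 s = []" by (simp add: list_at_def s_def init_memory_other)
  show "timed (poly memory_bound (word_size w)) (gadget_program S) (init_memory w)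
      (\<lambda>s. list_at 1 s = gadget_reduction S w \<and> s 1 0 \<le> poly memory_bound (word_size w))"
    unfolding K_def[symmetric] s_def[symmetric] gadget_program_def
  proof (rule timed_Seq)
    show "timed K (assign 3 (Const 1)) s (\<lambda>s'. s' 0 = s 0 \<and> s' 1 = s 1 \<and> s' 3 0 = 1)"
      by (rule timed_Store) (use bs k1 in auto)
    fix s1 assume b1: "bounded_memory K s1" and s1: "s1 0 = s 0 \<and> s1 1 = s 1 \<and> s1 3 0 = 1"
    have g: "val (size_guard (Add (Const 2) (Mult (Cell 0 (Const 1)) (Cell 0 (Const 1))))) s1 \<noteq> 0
        \<longleftrightarrow> n \<le> length w \<and> n' \<le> length w"
    proof -
      have "s1 0 = init_memory w 0" using s1 by (simp add: s_def)
      from val_size_guard[of s1 w "Add (Const 2) (Mult (Cell 0 (Const 1)) (Cell 0 (Const 1)))", OF this] show ?thesis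
        using s1 by (simp add: n_def n'_def b_def s_def)
    qed
    have o1: "list_at 1 s1 = []" using out0 s1 list_at_cong[of s1 1 s] by simp
    show "timed K (Cond (size_guard (Add (Const 2) (Mult (Cell 0 (Const 1)) (Cell 0 (Const 1)))))
       (Seq (emit_gadget S) (emit_gadget S)) Skip) s1
      (\<lambda>s. list_at 1 s = gadget_reduction S w \<and> s 1 0 \<le> K)"
    proof (rule timed_Cond[OF b1])
      assume "val (size_guard (Add (Const 2) (Mult (Cell 0 (Const 1)) (Cell 0 (Const 1))))) s1 \<noteq> 0"
      then have n: "n \<le> length w" "n' \<le> length w" using g by auto
      note sz = size[OF n(1)] size[OF n(2)]
      show "timed K (Seq (emit_gadget S) (emit_gadget S)) s1
        (\<lambda>s. list_at 1 s = gadget_reduction S w \<and> s 1 0 \<le> K)"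
      proof (rule timed_Seq)
        have n1: "s1 0 (s1 3 0) = n" using s1 by (simp add: n_def)
        have s13: "s1 3 0 = 1" using s1 by simp
        have l1: "s1 1 0 = 0" using o1 length_list_at[of 1 s1] by simp
        show "timed K (emit_gadget S) s1 (\<lambda>s'. s' 0 = s 0 \<and> s' 3 0 = b \<and> list_at 1 s' = ?W)"
        proof (rule timed_mono[OF timed_emit_gadget[OF b1]])
          show "s1 1 0 + 12 * (s1 0 (s1 3 0) + 4) * (s1 0 (s1 3 0) + 4) *
              (12 * (s1 0 (s1 3 0) + 4) * (s1 0 (s1 3 0) + 4)) +
              2 * (12 * (s1 0 (s1 3 0) + 4) * (s1 0 (s1 3 0) + 4)) + 50 < K"
            unfolding n1 l1 B_def[symmetric] using sz K y by linarith
          show "s1 3 0 + 1 + s1 0 (s1 3 0) * s1 0 (s1 3 0) + 1 < K"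
            unfolding n1 unfolding s13 using sz K y by linarith
        qed (use s1 o1 n1 in \<open>simp add: b_def\<close>)
        fix s2 assume b2: "bounded_memory K s2" and s2: "s2 0 = s 0 \<and> s2 3 0 = b \<and> list_at 1 s2 = ?W"
        have n2: "s2 0 (s2 3 0) = n'" using s2 by (simp add: n'_def)
        have s23: "s2 3 0 = b" using s2 by simp
        have l2: "s2 1 0 = length ?W" using s2 length_list_at[of 1 s2] by simp
        show "timed K (emit_gadget S) s2 (\<lambda>s. list_at 1 s = gadget_reduction S w \<and> s 1 0 \<le> K)"
        proof (rule timed_mono[OF timed_emit_gadget[OF b2]])
          show "s2 1 0 + 12 * (s2 0 (s2 3 0) + 4) * (s2 0 (s2 3 0) + 4) *
              (12 * (s2 0 (s2 3 0) + 4) * (s2 0 (s2 3 0) + 4)) +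
              2 * (12 * (s2 0 (s2 3 0) + 4) * (s2 0 (s2 3 0) + 4)) + 50 < K"
            unfolding n2 l2 B_def[symmetric] using len(1) sz K y by linarith
          have "b \<le> 2 + y" using sz by (simp add: b_def)
          then show "s2 3 0 + 1 + s2 0 (s2 3 0) * s2 0 (s2 3 0) + 1 < K"
            unfolding n2 unfolding s23 using sz K y by linarith
          fix s3 assume "s3 0 = s2 0 \<and> s3 3 0 = s2 3 0 + 1 + s2 0 (s2 3 0) * s2 0 (s2 3 0) \<and>
            list_at 1 s3 = list_at 1 s2 @ gadget_word S (s2 0 (s2 3 0)) (input_adj (s2 0) (s2 3 0))"
          then have *: "list_at 1 s3 = ?W @ ?W'" unfolding n2 using s2 by simp
          then have "s3 1 0 = length ?W + length ?W'" using length_list_at[of 1 s3] by simp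
          then have "s3 1 0 \<le> K" using len sz K y by linarith
          then show "list_at 1 s3 = gadget_reduction S w \<and> s3 1 0 \<le> K"
            using * f n by simp
        qed
      qed
    next
      assume "val (size_guard (Add (Const 2) (Mult (Cell 0 (Const 1)) (Cell 0 (Const 1))))) s1 = 0"
      then have "gadget_reduction S w = []" using f g by auto
      then show "timed K Skip s1 (\<lambda>s. list_at 1 s = gadget_reduction S w \<and> s 1 0 \<le> K)"
        using b1 o1 length_list_at[of 1 s1] by (intro timed_Skip) auto
    qed
  qed
qed

section \<open>Correctness of the reduction to gadget graphs\<close>

lemma input_adj_word:
  assumes "init_memory w 0 b = length xs"
    and "\<And>i. i < length xs * length xs \<Longrightarrow> init_memory w 0 (b + 1 + i) = adjacency_word G xs ! Suc i"
    and "i < length xs" "j < length xs"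
  shows "input_adj (init_memory w 0) b i j \<longleftrightarrow> edge_at G xs i j"
  unfolding input_adj_def assms(1) assms(2)[OF index_pair_less[OF assms(3,4)]]
    adjacency_word_nth[OF assms(3,4)] by simp

lemma no_loop: "simple_graph G \<Longrightarrow> {x, x} \<notin> edges G"
  by (auto simp: simple_graph_def)

text \<open>The class enters only as a home for all gadgets of one kind, so ILP graphs and reduced
  ILP graphs are treated alike.\<close>

lemma graph_isomorphism_reduces_to_gadgets:
  assumes C: "\<And>n a. gadget_graph S (n + 2) a \<in> C"
  shows "poly_reducible graph_isomorphism_problem (isomorphism_problem_on C)"
  unfolding poly_reducible_def
proof (intro exI[of _ "gadget_reduction S"] conjI ballI gadget_reduction_poly_time)
  fix w assume "w \<in> fst graph_isomorphism_problem"
  then obtain G H :: "nat graph" and xs ys where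
    G: "simple_graph G" "numbering xs G" and H: "simple_graph H" "numbering ys H"
    and w: "w = adjacency_word G xs @ adjacency_word H ys"
    by (rule graph_isomorphism_problem_instance)
  let ?M = "init_memory w 0" and ?n = "length xs" and ?n' = "length ys"
  let ?b = "2 + ?n * ?n"
  have n: "?M 1 = ?n" using init_memory_Suc[of 0 w] by (simp add: w nth_append)
  have n': "?M ?b = ?n'" using init_memory_Suc[of "1 + ?n * ?n" w] by (simp add: w nth_append)
  have le: "?n \<le> length w" "?n' \<le> length w"
  proof -
    have "length w = 2 + ?n * ?n + ?n' * ?n'" by (simp add: w)
    then show "?n \<le> length w" "?n' \<le> length w"
      using le_square[of ?n] le_square[of ?n'] by linarith+
  qed
  have a: "input_adj ?M 1 i j \<longleftrightarrow> edge_at G xs i j" if "i < ?n" "j < ?n" for i j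
  proof (rule input_adj_word[OF n _ that])
    fix i assume "i < ?n * ?n"
    then show "?M (1 + 1 + i) = adjacency_word G xs ! Suc i"
      using init_memory_Suc[of "Suc i" w] by (simp add: w nth_append)
  qed
  have a': "input_adj ?M ?b i j \<longleftrightarrow> edge_at H ys i j" if "i < ?n'" "j < ?n'" for i j
  proof (rule input_adj_word[OF n' _ that])
    fix i assume "i < ?n' * ?n'"
    then show "?M (?b + 1 + i) = adjacency_word H ys ! Suc i"
      using init_memory_Suc[of "2 + ?n * ?n + i" w] by (simp add: w nth_append)
  qed
  let ?X = "gadget_graph S (?n + 2) (input_adj ?M 1)" and ?Y = "gadget_graph S (?n' + 2) (input_adj ?M ?b)"
  have f: "gadget_reduction S w = gadget_word S ?n (input_adj ?M 1) @ gadget_word S ?n' (input_adj ?M ?b)"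
    using le unfolding gadget_reduction_def Let_def n n' by simp
  have p: "lgraph_pair_word ?X ?Y (gadget_reduction S w)"
    unfolding f by (rule gadget_pair_word)
  have "lgraph_isomorphic ?X ?Y \<longleftrightarrow>
      index_isomorphic ?n (input_adj ?M 1) (\<lambda>_. ()) ?n' (input_adj ?M ?b) (\<lambda>_. ())"
    by (rule gadget_isomorphic_iff) (use a a' no_loop[OF G(1)] no_loop[OF H(1)] in blast)+
  also have "\<dots> \<longleftrightarrow> graph_isomorphic G H"
    unfolding graph_isomorphic_iff_index[OF G(2) H(2)]
    by (rule index_isomorphic_cong) (use a a' in auto)
  finally show "gadget_reduction S w \<in> fst (isomorphism_problem_on C)"
    "gadget_reduction S w \<in> snd (isomorphism_problem_on C) \<longleftrightarrow> w \<in> snd graph_isomorphism_problem"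
    using isomorphism_problem_on_word[OF C C p] graph_isomorphism_problem_word(2)[OF G H]
    unfolding w by simp_all
qed

section \<open>Reducing labelled graphs to graphs\<close>

definition pendant_word :: "nat \<Rightarrow> (nat \<Rightarrow> nat \<Rightarrow> bool) \<Rightarrow> (nat \<Rightarrow> nat) \<Rightarrow> nat \<Rightarrow> nat list" where
  "pendant_word n E t R = (let m = n * R; node = (\<lambda>p. (p div R, p mod R)) in
     [m] @ map (\<lambda>k. of_bool (pendant_arc E t (node (k div m)) (node (k mod m)) \<or>
       pendant_arc E t (node (k mod m)) (node (k div m)))) [0..<m * m])"

lemma numbering_pendant:
  assumes "0 < R"
  shows "numbering (map (\<lambda>p. (p div R, p mod R)) [0..<n * R]) (pendant_graph n E t R)"
proof -
  have "inj_on (\<lambda>p. (p div R, p mod R)) {0..<n * R}"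
    by (rule inj_onI) (metis Pair_inject div_mult_mod_eq)
  moreover have "(\<lambda>p. (p div R, p mod R)) ` {0..<n * R} = {..<n} \<times> {..<R}"
  proof
    show "(\<lambda>p. (p div R, p mod R)) ` {0..<n * R} \<subseteq> {..<n} \<times> {..<R}"
      using assms by (auto simp: less_mult_imp_div_less)
    show "{..<n} \<times> {..<R} \<subseteq> (\<lambda>p. (p div R, p mod R)) ` {0..<n * R}"
    proof
      fix q assume "q \<in> {..<n} \<times> {..<R}"
      then obtain x k where q: "q = (x, k)" "x < n" "k < R" by auto
      have "x * R + k < Suc x * R" using q by simp
      also have "\<dots> \<le> n * R" using q by (intro mult_le_mono1) simp
      finally show "q \<in> (\<lambda>p. (p div R, p mod R)) ` {0..<n * R}"
        using q index_pair_div[OF q(3), of x] by (intro image_eqI[of _ _ "x * R + k"]) simp_all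
    qed
  qed
  ultimately show ?thesis
    by (simp add: numbering_def distinct_map pendant_graph_def)
qed

lemma pendant_word_eq:
  assumes "0 < R"
  shows "pendant_word n E t R =
    adjacency_word (pendant_graph n E t R) (map (\<lambda>p. (p div R, p mod R)) [0..<n * R])"
proof -
  let ?xs = "map (\<lambda>p. (p div R, p mod R)) [0..<n * R]" and ?m = "n * R"
  let ?node = "\<lambda>p. (p div R, p mod R)"
  have E: "edge_at (pendant_graph n E t R) ?xs (k div ?m) (k mod ?m) \<longleftrightarrow>
      pendant_arc E t (?node (k div ?m)) (?node (k mod ?m)) \<or>
      pendant_arc E t (?node (k mod ?m)) (?node (k div ?m))" if "k < ?m * ?m" for k
  proof -
    have l: "k div ?m < ?m" "k mod ?m < ?m" using div_mod_less[OF that] by auto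
    then have at: "?xs ! (k div ?m) = ?node (k div ?m)" "?xs ! (k mod ?m) = ?node (k mod ?m)"
      by simp_all
    have "?node p \<in> {..<n} \<times> {..<R}" if "p < ?m" for p
      using that assms by (simp add: less_mult_imp_div_less)
    from doubleton_mem_iff[OF this[OF l(1)] this[OF l(2)]] show ?thesis
      unfolding at pendant_graph_def graph.simps .
  qed
  have "map (\<lambda>k. of_bool (edge_at (pendant_graph n E t R) ?xs (k div ?m) (k mod ?m)) :: nat) [0..<?m * ?m] =
      map (\<lambda>k. of_bool (pendant_arc E t (?node (k div ?m)) (?node (k mod ?m)) \<or>
        pendant_arc E t (?node (k mod ?m)) (?node (k div ?m)))) [0..<?m * ?m]"
    by (rule map_cong[OF refl], rule arg_cong[where f = of_bool], rule E) simp
  then show ?thesis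
    unfolding adjacency_word_eq pendant_word_def Let_def length_map length_upt diff_zero
    by (simp only: append_Cons append_Nil)
qed

text \<open>Arrays 3 and 4 as before; array 7 lists the label names of both graphs, array 8 tabulates
  \<open>last_match\<close>, and array 9 holds the position of the labels of the current graph in the former.\<close>

abbreviation (input) "block_exp \<equiv> Add (Scalar 7) (Const 2)"

text \<open>With \<open>N\<close> labels in all and \<open>d\<close> the content of array 9, row
  \<open>d + x\<close> of the table ends at list position \<open>(d + x) * N + N - 1\<close>. The
  length in cell 0 shifts this by one, so the rank is read at
  \<open>(d + x) * N + N\<close>.\<close>

definition pendant_arc_exp :: "aexp \<Rightarrow> aexp \<Rightarrow> aexp" where
  "pendant_arc_exp p q = (let x = Div p block_exp; k = EMod p block_exp;
       y = Div q block_exp; l = EMod q block_exp in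
     any_exp
       [all_exp [EEq k (Const 0), EEq l (Const 0),
          Cell 0 (Add (Add (Scalar 3) (Const 1)) (Add (Mult x (Scalar 4)) y))],
        all_exp [EEq x y, EEq k (Const 0), less_exp (Const 0) l,
          ELeq l (Add (Cell 8 (Add (Mult (Add (Scalar 9) x) (Scalar 7)) (Scalar 7))) (Const 2))]])"

lemma val_pendant_arc_exp:
  assumes "s 3 0 = b" "s 4 0 = s 0 b" "s 7 0 = length L" "s 9 0 = d"
    and "\<And>x. x < length L \<Longrightarrow> s 8 (x * length L + length L) = rank L x"
    and "d + val p s div (length L + 2) < length L"
  shows "val (pendant_arc_exp p q) s \<noteq> 0 \<longleftrightarrow>
    pendant_arc (input_adj (s 0) b) (\<lambda>x. rank L (d + x) + 2)
      (val p s div (length L + 2), val p s mod (length L + 2))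
      (val q s div (length L + 2), val q s mod (length L + 2))"
  unfolding pendant_arc_exp_def Let_def val_all_exp val_any_exp list.set ball_simps bex_simps
    val.simps val_EEq val_ELeq val_EMod val_less_exp assms(1-4) assms(5)[OF assms(6)]
    pendant_arc.simps input_adj_def
  by (simp only: of_bool_eq_0_iff not_not simp_thms)

text \<open>Array 3 has to skip the \<open>n\<close> labels after the matrix as well. Advancing
  array 9 by \<open>n\<close> makes the second run look up the ranks of the labels of the second
  graph.\<close>

definition emit_pendant :: cmd where
  "emit_pendant = (let m = Mult (Scalar 4) block_exp; p = Div (Scalar 2) m; q = EMod (Scalar 2) m in
     Seq (assign 4 (Cell 0 (Scalar 3)))
    (Seq (append_to 1 m)
    (Seq (loop_append (Mult m m) 1 (EOr (pendant_arc_exp p q) (pendant_arc_exp q p)))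
    (Seq (assign 9 (Add (Scalar 9) (Scalar 4)))
         (assign 3 (Add (Add (Scalar 3) (Const 1)) (Add (Mult (Scalar 4) (Scalar 4)) (Scalar 4))))))))"

lemma timed_emit_pendant:
  fixes s :: memory and L :: "nat list"
  defines "b \<equiv> s 3 0" and "n \<equiv> s 0 (s 3 0)" and "d \<equiv> s 9 0"
  defines "m \<equiv> n * (length L + 2)"
  assumes s: "bounded_memory K s"
    and L: "list_at 7 s = L" "list_at 8 s = map (last_match L) [0..<length L * length L]"
      "d + n \<le> length L"
    and K: "s 1 0 + m * m + m + 10 < K" "b + 1 + n * n + n + 1 < K" "length L < K"
  shows "timed K emit_pendant s (\<lambda>s'. s' 0 = s 0 \<and> s' 7 = s 7 \<and> s' 8 = s 8 \<and>
    s' 3 0 = b + 1 + n * n + n \<and> s' 9 0 = d + n \<and>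
    list_at 1 s' = list_at 1 s @
      pendant_word n (input_adj (s 0) b) (\<lambda>x. rank L (d + x) + 2) (length L + 2))"
proof -
  let ?R = "length L + 2"
  let ?E = "input_adj (s 0) b" and ?t = "\<lambda>x. rank L (d + x) + 2"
  let ?node = "\<lambda>p. (p div ?R, p mod ?R)"
  let ?arc = "\<lambda>k. of_bool (pendant_arc ?E ?t (?node (k div m)) (?node (k mod m)) \<or>
       pendant_arc ?E ?t (?node (k mod m)) (?node (k div m))) :: nat"
  let ?me = "Mult (Scalar 4) block_exp"
  let ?p = "Div (Scalar 2) ?me" and ?q = "EMod (Scalar 2) ?me"
  have log: "log_size x \<le> K" if "x + 1 \<le> K" for x
    using log_size_le_Suc[of x] that by simp
  have pw: "pendant_word n ?E ?t ?R = [m] @ map ?arc [0..<m * m]"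
    by (simp only: pendant_word_def Let_def m_def)
  have log01: "log_size (of_bool P) \<le> K" for P
  proof (rule log)
    have "of_bool P \<le> (1 :: nat)" by simp
    then show "of_bool P + 1 \<le> K" using K(1) by linarith
  qed
  have s7: "s 7 0 = length L" using L(1) length_list_at[of 7 s] by simp
  have rank: "s 8 (x * length L + length L) = rank L x" if x: "x < length L" for x
  proof -
    have s8: "s 8 0 = length L * length L" using L(2) length_list_at[of 8 s] by simp
    have lt: "x * length L + (length L - 1) < length L * length L"
      by (rule index_pair_less[OF x]) (use x in simp)
    have "s 8 (Suc (x * length L + (length L - 1))) = rank L x"
      using nth_list_at[of "x * length L + (length L - 1)" s 8] lt
      unfolding s8 L(2) rank_def by simp
    moreover have "Suc (x * length L + (length L - 1)) = x * length L + length L" using x by simp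
    ultimately show ?thesis by (simp only:)
  qed
  let ?base = "\<lambda>s'. s' 0 = s 0 \<and> s' 7 = s 7 \<and> s' 8 = s 8 \<and> s' 3 0 = b \<and> s' 4 0 = n"
  let ?Q1 = "\<lambda>s'. ?base s' \<and> s' 9 0 = d \<and> s' 1 = s 1"
  let ?Q2 = "\<lambda>s'. ?base s' \<and> s' 9 0 = d \<and> list_at 1 s' = list_at 1 s @ [m]"
  let ?Q3 = "\<lambda>s'. ?base s' \<and> s' 9 0 = d \<and> list_at 1 s' = list_at 1 s @ pendant_word n ?E ?t ?R"
  let ?Q4 = "\<lambda>s'. ?base s' \<and> s' 9 0 = d + n \<and> list_at 1 s' = list_at 1 s @ pendant_word n ?E ?t ?R"
  show ?thesis
    unfolding emit_pendant_def Let_def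
  proof (intro timed_Seq)
    show "timed K (assign 4 (Cell 0 (Scalar 3))) s ?Q1"
      by (rule timed_Store) (use s in \<open>auto simp: b_def n_def d_def bounded_memory_def\<close>)
  next
    fix s' assume s': "bounded_memory K s'" "?Q1 s'"
    show "timed K (append_to 1 ?me) s' ?Q2"
    proof (rule timed_append)
      have v: "val ?me s' = m" using s' s7 by (simp add: m_def)
      show "log_size (val ?me s') \<le> K" unfolding v by (rule log) (use K in simp)
      fix s2 assume ag: "agree_except {1} s' s2" and "list_at 1 s2 = list_at 1 s' @ [val ?me s']"
      then show "?Q2 s2"
        using s' v list_at_cong[of s' 1 s] by (simp add: agree_exceptD[OF ag])
    qed (use s' K in auto)
  next
    fix s' assume s': "bounded_memory K s'" "?Q2 s'"
    then have l: "s' 1 0 = s 1 0 + 1"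
      using length_list_at[of 1 s'] by simp
    show "timed K (loop_append (Mult ?me ?me) 1 (EOr (pendant_arc_exp ?p ?q) (pendant_arc_exp ?q ?p))) s' ?Q3"
      unfolding loop_append_def
    proof (rule timed_append_loop[where N = "m * m" and F = ?arc])
      fix s2 assume ag: "agree_except {1, 2} s' s2"
      have vm: "val ?me s2 = m" using s' s7 by (simp add: agree_exceptD[OF ag] m_def)
      then show "val (Mult ?me ?me) s2 = m * m" by simp
      { fix k assume k: "k < m * m" "s2 2 0 = k"
        have km: "k div m < m" "k mod m < m" using div_mod_less[OF k(1)] by auto
        have vp: "val ?p s2 = k div m" "val ?q s2 = k mod m"
          using vm k(2) by simp_all
        have c: "s2 3 0 = b" "s2 4 0 = s2 0 b" "s2 7 0 = length L" "s2 9 0 = d" "s2 0 = s 0"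
          "\<And>x. x < length L \<Longrightarrow> s2 8 (x * length L + length L) = rank L x"
          using s' s7 rank by (auto simp: agree_exceptD[OF ag] b_def n_def)
        have bnd: "d + x div ?R < length L" if "x < m" for x
          using less_mult_imp_div_less[of x n ?R] that L(3) by (simp add: m_def)
        have "val (pendant_arc_exp ?p ?q) s2 \<noteq> 0 \<longleftrightarrow>
            pendant_arc (input_adj (s2 0) b) ?t (?node (val ?p s2)) (?node (val ?q s2))"
          by (rule val_pendant_arc_exp[OF c(1-4,6)]) (use bnd km vp in simp_all)
        moreover have "val (pendant_arc_exp ?q ?p) s2 \<noteq> 0 \<longleftrightarrow>
            pendant_arc (input_adj (s2 0) b) ?t (?node (val ?q s2)) (?node (val ?p s2))"
          by (rule val_pendant_arc_exp[OF c(1-4,6)]) (use bnd km vp in simp_all)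
        ultimately show "val (EOr (pendant_arc_exp ?p ?q) (pendant_arc_exp ?q ?p)) s2 = ?arc k \<and>
            log_size (?arc k) \<le> K"
          unfolding val_EOr vp c(5) using log01 by (simp only: simp_thms) }
      assume "list_at 1 s2 = list_at 1 s' @ map ?arc [0..<m * m]"
      then have "list_at 1 s2 = list_at 1 s @ pendant_word n ?E ?t ?R"
        using s' unfolding pw by (simp only: append_assoc)
      moreover have "?base s2 \<and> s2 9 0 = d" using s' by (simp add: agree_exceptD[OF ag])
      ultimately show "?Q3 s2" by (simp only: simp_thms)
    qed (use s' l K in auto)
  next
    fix s' assume s': "bounded_memory K s'" "?Q3 s'"
    show "timed K (assign 9 (Add (Scalar 9) (Scalar 4))) s' ?Q4"
      by (rule timed_Store) (use s' K L(3) log[of "d + n"] in \<open>auto simp: list_at_def\<close>)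
  next
    fix s' assume s': "bounded_memory K s'" "?Q4 s'"
    show "timed K (assign 3 (Add (Add (Scalar 3) (Const 1)) (Add (Mult (Scalar 4) (Scalar 4)) (Scalar 4)))) s'
      (\<lambda>s'. s' 0 = s 0 \<and> s' 7 = s 7 \<and> s' 8 = s 8 \<and>
        s' 3 0 = b + 1 + n * n + n \<and> s' 9 0 = d + n \<and>
        list_at 1 s' = list_at 1 s @ pendant_word n ?E ?t ?R)"
      by (rule timed_Store) (use s' K log[of "b + 1 + n * n + n"] in \<open>auto simp: list_at_def add.assoc\<close>)
  qed
qed

text \<open>Each graph occupies a count, a matrix and its labels, which gives the offsets
  \<open>2 + n * n\<close> and \<open>b\<close>. Both graphs share \<open>L\<close>, so their ranks
  are comparable and the width \<open>R\<close> is common. The form \<open>0 + x\<close> matches the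
  offset \<open>d + x\<close> of the program.\<close>

definition label_reduction :: "nat list \<Rightarrow> nat list" where
  "label_reduction w = (let M = init_memory w 0; n = M 1; b = 2 + n * n + n; n' = M b;
       L = map (\<lambda>x. M (2 + n * n + x)) [0..<n] @ map (\<lambda>x. M (b + 1 + n' * n' + x)) [0..<n'];
       R = length L + 2 in
     if n \<le> length w \<and> n' \<le> length w
     then pendant_word n (input_adj M 1) (\<lambda>x. rank L (0 + x) + 2) R @
       pendant_word n' (input_adj M b) (\<lambda>x. rank L (n + x) + 2) R
     else [])"

definition second_exp :: aexp where
  "second_exp = (let n = Cell 0 (Const 1) in Add (Add (Const 2) (Mult n n)) n)"

text \<open>The length of array 8 is also the address of its last entry, so
  \<open>Cell 8 (Scalar 8)\<close> is the value of \<open>last_match\<close> at the previous pair;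
  the table thus replaces the recursion.\<close>

definition label_table :: cmd where
  "label_table =
     Seq (assign 4 (Cell 0 (Const 1)))
    (Seq (assign 6 (Cell 0 second_exp))
    (Seq (loop_append (Scalar 4) 7 (Cell 0 (Add (Add (Const 2) (Mult (Scalar 4) (Scalar 4))) (Scalar 2))))
    (Seq (loop_append (Scalar 6) 7
           (Cell 0 (Add (Add (Add second_exp (Const 1)) (Mult (Scalar 6) (Scalar 6))) (Scalar 2))))
         (loop_append (Mult (Scalar 7) (Scalar 7)) 8
           (let x = Div (Scalar 2) (Scalar 7); y = EMod (Scalar 2) (Scalar 7) in
             EIf (EEq (Cell 7 (Add x (Const 1))) (Cell 7 (Add y (Const 1)))) y (Cell 8 (Scalar 8)))))))"

definition label_program :: cmd where
  "label_program = Cond (size_guard second_exp)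
     (Seq label_table (Seq (assign 3 (Const 1)) (Seq emit_pendant emit_pendant))) Skip"

lemma val_second_exp: "val second_exp s = 2 + s 0 1 * s 0 1 + s 0 1"
  by (simp add: second_exp_def Let_def)

lemma timed_label_table:
  fixes s :: memory
  defines "n \<equiv> s 0 1"
  defines "b \<equiv> 2 + n * n + n"
  defines "n' \<equiv> s 0 b"
  defines "L \<equiv> map (\<lambda>x. s 0 (2 + n * n + x)) [0..<n] @ map (\<lambda>x. s 0 (b + 1 + n' * n' + x)) [0..<n']"
  assumes s: "bounded_memory K s" and z: "s 7 0 = 0" "s 8 0 = 0"
    and K: "(n + n') * (n + n') + n + n' + 10 < K"
  shows "timed K label_table s (\<lambda>s'. s' 0 = s 0 \<and> s' 1 = s 1 \<and> s' 9 = s 9 \<and>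
    list_at 7 s' = L \<and> list_at 8 s' = map (last_match L) [0..<length L * length L])"
proof -
  let ?L1 = "map (\<lambda>x. s 0 (2 + n * n + x)) [0..<n]"
  let ?L2 = "map (\<lambda>x. s 0 (b + 1 + n' * n' + x)) [0..<n']"
  let ?N = "length L"
  have N: "?N = n + n'" by (simp add: L_def)
  have log: "log_size x \<le> K" if "x + 1 \<le> K" for x
    using log_size_le_Suc[of x] that by simp
  have cell: "log_size (s 0 i) \<le> K" for i using s by (simp add: bounded_memory_def)
  let ?base = "\<lambda>s'. s' 0 = s 0 \<and> s' 1 = s 1 \<and> s' 9 = s 9"
  let ?Q1 = "\<lambda>s'. ?base s' \<and> s' 4 0 = n \<and> s' 7 = s 7 \<and> s' 8 = s 8"
  let ?Q2 = "\<lambda>s'. ?base s' \<and> s' 4 0 = n \<and> s' 6 0 = n' \<and> s' 7 = s 7 \<and> s' 8 = s 8"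
  let ?Q3 = "\<lambda>s'. ?base s' \<and> s' 6 0 = n' \<and> list_at 7 s' = ?L1 \<and> s' 8 = s 8"
  let ?Q4 = "\<lambda>s'. ?base s' \<and> list_at 7 s' = L \<and> s' 8 = s 8"
  have e7: "list_at 7 s = []" "list_at 8 s = []" using z by (simp_all add: list_at_def)
  show ?thesis
    unfolding label_table_def
  proof (intro timed_Seq)
    show "timed K (assign 4 (Cell 0 (Const 1))) s ?Q1"
      by (rule timed_Store) (use s cell[of 1] in \<open>auto simp: n_def\<close>)
  next
    fix s' assume s': "bounded_memory K s'" "?Q1 s'"
    have v: "val (Cell 0 second_exp) s' = n'"
      using s' by (simp add: val_second_exp n'_def b_def n_def)
    show "timed K (assign 6 (Cell 0 second_exp)) s' ?Q2"
      by (rule timed_Store) (use s' v cell[of b] in \<open>auto simp: n'_def\<close>)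
  next
    fix s' assume s': "bounded_memory K s'" "?Q2 s'"
    show "timed K (loop_append (Scalar 4) 7
        (Cell 0 (Add (Add (Const 2) (Mult (Scalar 4) (Scalar 4))) (Scalar 2)))) s' ?Q3"
      unfolding loop_append_def
    proof (rule timed_append_loop[where N = n and F = "\<lambda>x. s 0 (2 + n * n + x)"])
      fix s2 assume ag: "agree_except {7, 2} s' s2"
      show "val (Scalar 4) s2 = n" using s' by (simp add: agree_exceptD[OF ag])
      { fix k assume "k < n" "s2 2 0 = k"
        then show "val (Cell 0 (Add (Add (Const 2) (Mult (Scalar 4) (Scalar 4))) (Scalar 2))) s2 =
            s 0 (2 + n * n + k) \<and> log_size (s 0 (2 + n * n + k)) \<le> K"
          using s' cell by (simp add: agree_exceptD[OF ag]) }
      assume "list_at 7 s2 = list_at 7 s' @ ?L1"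
      then show "?Q3 s2"
        using s' e7 list_at_cong[of s' 7 s] by (simp add: agree_exceptD[OF ag])
    qed (use s' z K in auto)
  next
    fix s' assume s': "bounded_memory K s'" "?Q3 s'"
    then have l: "s' 7 0 = n" using length_list_at[of 7 s'] by simp
    let ?e = "Cell 0 (Add (Add (Add second_exp (Const 1)) (Mult (Scalar 6) (Scalar 6))) (Scalar 2))"
    show "timed K (loop_append (Scalar 6) 7 ?e) s' ?Q4"
      unfolding loop_append_def
    proof (rule timed_append_loop[where N = n' and F = "\<lambda>x. s 0 (b + 1 + n' * n' + x)"])
      fix s2 assume ag: "agree_except {7, 2} s' s2"
      show "val (Scalar 6) s2 = n'" using s' by (simp add: agree_exceptD[OF ag])
      { fix k assume "k < n'" "s2 2 0 = k"
        then show "val ?e s2 = s 0 (b + 1 + n' * n' + k) \<and> log_size (s 0 (b + 1 + n' * n' + k)) \<le> K"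
          using s' cell by (simp add: agree_exceptD[OF ag] val_second_exp b_def n_def) }
      assume "list_at 7 s2 = list_at 7 s' @ ?L2"
      then show "?Q4 s2"
        using s' by (simp add: agree_exceptD[OF ag] L_def)
    qed (use s' l K in auto)
  next
    fix s' assume s': "bounded_memory K s'" "?Q4 s'"
    then have l: "s' 7 0 = ?N" using length_list_at[of 7 s'] by simp
    let ?e = "let x = Div (Scalar 2) (Scalar 7); y = EMod (Scalar 2) (Scalar 7) in
             EIf (EEq (Cell 7 (Add x (Const 1))) (Cell 7 (Add y (Const 1)))) y (Cell 8 (Scalar 8))"
    have NK: "?N * ?N + 1 < K" "?N < K" using K unfolding N by linarith+
    show "timed K (loop_append (Mult (Scalar 7) (Scalar 7)) 8 ?e) s'
      (\<lambda>s'. s' 0 = s 0 \<and> s' 1 = s 1 \<and> s' 9 = s 9 \<and> list_at 7 s' = L \<and>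
        list_at 8 s' = map (last_match L) [0..<?N * ?N])"
      unfolding loop_append_def
    proof (rule timed_append_loop[where N = "?N * ?N" and F = "last_match L"])
      have e8: "list_at 8 s' = []" using s' e7 list_at_cong[of s' 8 s] by simp
      fix s2 assume ag: "agree_except {8, 2} s' s2"
      show "val (Mult (Scalar 7) (Scalar 7)) s2 = ?N * ?N"
        using l by (simp add: agree_exceptD[OF ag])
      { fix k assume k: "k < ?N * ?N" "s2 2 0 = k" "list_at 8 s2 = list_at 8 s' @ map (last_match L) [0..<k]"
        have kN: "k div ?N < ?N" "k mod ?N < ?N" using div_mod_less[OF k(1)] by auto
        have at: "s2 7 (Suc i) = L ! i" if "i < ?N" for i
          using nth_list_at[of i s' 7] that s' l by (simp add: agree_exceptD[OF ag])
        have l2: "list_at 8 s2 = map (last_match L) [0..<k]" using k(3) e8 by simp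
        then have s8: "s2 8 0 = k" using length_list_at[of 8 s2] by simp
        \<comment> \<open>For the empty list the address is cell 0 itself, which holds the length 0;
          this agrees with the default value in \<open>last_match\<close>.\<close>
        have prev: "s2 8 (s2 8 0) = (if k = 0 then 0 else last_match L (k - 1))"
        proof (cases k)
          case (Suc j)
          then show ?thesis using nth_list_at[of j s2 8] s8 l2 by (simp del: upt_Suc)
        qed (use s8 in simp)
        have "val ?e s2 = (if s2 7 (Suc (k div ?N)) = s2 7 (Suc (k mod ?N)) then k mod ?N else s2 8 (s2 8 0))"
          using k(2) l by (simp add: Let_def agree_exceptD[OF ag])
        also have "\<dots> = last_match L k"
          unfolding at[OF kN(1)] at[OF kN(2)] prev by (subst last_match.simps) simp
        finally have v: "val ?e s2 = last_match L k" .
        have lm: "last_match L k < ?N" if "k < ?N * ?N" for k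
          using that
        proof (induction k)
          case 0
          then show ?case by (subst last_match.simps) simp
        next
          case (Suc k)
          then show ?case
            using div_mod_less[OF Suc.prems] by (subst last_match.simps) simp
        qed
        have "log_size (last_match L k) \<le> K"
          by (rule log) (use lm[OF k(1)] NK in linarith)
        with v show "val ?e s2 = last_match L k \<and> log_size (last_match L k) \<le> K" by blast }
      assume "list_at 8 s2 = list_at 8 s' @ map (last_match L) [0..<?N * ?N]"
      then show "s2 0 = s 0 \<and> s2 1 = s 1 \<and> s2 9 = s 9 \<and> list_at 7 s2 = L \<and>
        list_at 8 s2 = map (last_match L) [0..<?N * ?N]"
        using s' e8 list_at_cong[of s2 7 s'] by (simp add: agree_exceptD[OF ag])
    qed (use s' l z NK in auto)
  qed
qed

lemma length_pendant_word: "length (pendant_word n E t R) = 1 + (n * R) * (n * R)"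
  by (simp add: pendant_word_def Let_def)

lemma label_reduction_poly_time: "poly_time_computable label_reduction"
proof (rule poly_time_computableI)
  fix w
  define W where "W = word_size w"
  define K where "K = poly memory_bound (word_size w)"
  define y where "y = (W + 4) * (W + 4)"
  have K: "K = 1000 * (y * y)" unfolding K_def poly_memory_bound y_def W_def ..
  have y: "W + 16 \<le> y" "y \<le> y * y" unfolding y_def by (simp_all only: square_add_4)
  show "word_size w < poly memory_bound (word_size w)"
    unfolding K_def[symmetric] using K y W_def by linarith
  have wl: "length w \<le> W" unfolding W_def by (rule length_le_word_size)
  define s where "s = init_memory w"
  have bs: "bounded_memory K s"
    unfolding s_def by (rule bounded_init_memory) (use K y W_def in linarith)
  have k1: "log_size 1 \<le> K" using log_size_le_Suc[of 1] K y by linarith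
  define n where "n = s 0 1"
  define b where "b = 2 + n * n + n"
  define n' where "n' = s 0 b"
  define L where "L = map (\<lambda>x. s 0 (2 + n * n + x)) [0..<n] @ map (\<lambda>x. s 0 (b + 1 + n' * n' + x)) [0..<n']"
  have LN: "length L = n + n'" by (simp add: L_def)
  define R where "R = length L + 2"
  let ?V = "pendant_word n (input_adj (s 0) 1) (\<lambda>x. rank L (0 + x) + 2) R"
  let ?V' = "pendant_word n' (input_adj (s 0) b) (\<lambda>x. rank L (n + x) + 2) R"
  have f: "label_reduction w = (if n \<le> length w \<and> n' \<le> length w then ?V @ ?V' else [])"
    unfolding label_reduction_def Let_def R_def L_def n'_def b_def n_def s_def ..
  have out0: "list_at 1 s = []" "s 1 0 = 0" "s 7 0 = 0" "s 8 0 = 0" "s 9 0 = 0"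
    by (simp_all add: list_at_def s_def init_memory_other)
  have g: "val (size_guard second_exp) s \<noteq> 0 \<longleftrightarrow> n \<le> length w \<and> n' \<le> length w"
  proof -
    have "s 0 = init_memory w 0" by (simp add: s_def)
    from val_size_guard[of s w second_exp, OF this] show ?thesis
      by (simp add: val_second_exp n_def n'_def b_def s_def)
  qed
  show "timed (poly memory_bound (word_size w)) label_program (init_memory w)
      (\<lambda>s. list_at 1 s = label_reduction w \<and> s 1 0 \<le> poly memory_bound (word_size w))"
    unfolding K_def[symmetric] s_def[symmetric] label_program_def
  proof (rule timed_Cond[OF bs])
    assume "val (size_guard second_exp) s \<noteq> 0"
    then have nl: "n \<le> length w" "n' \<le> length w" using g by auto
    have nW: "n \<le> W" "n' \<le> W" using nl wl by linarith+
    have sq: "n * n \<le> y" "n' * n' \<le> y"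
      unfolding y_def by (rule mult_le_mono; use nW in linarith)+
    have NN: "(n + n') * (n + n') \<le> 4 * y"
    proof -
      have h: "n + n' \<le> 2 * (W + 4)" using nW by simp
      have "(2 * v) * (2 * v) = 4 * (v * v)" for v :: nat by simp
      then show ?thesis using mult_le_mono[OF h h] unfolding y_def by metis
    qed
    \<comment> \<open>As \<open>R\<close> is at most \<open>2 * (W + 4)\<close>, each pendant graph
      has at most \<open>2 * y\<close> nodes.\<close>
    have mR: "m * R \<le> 2 * y" "(m * R) * (m * R) \<le> 4 * (y * y)" if "m \<le> W" for m
    proof -
      have h: "m \<le> W + 4" "R \<le> 2 * (W + 4)" using nW that by (simp_all add: LN R_def)
      have "v * (2 * v) = 2 * (v * v)" for v :: nat by simp
      then show 1: "m * R \<le> 2 * y" using mult_le_mono[OF h] unfolding y_def by metis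
      from mult_le_mono[OF 1 1] show "(m * R) * (m * R) \<le> 4 * (y * y)" by simp
    qed
    note sz = sq NN mR[OF nW(1)] mR[OF nW(2)] nW y
    show "timed K (Seq label_table (Seq (assign 3 (Const 1)) (Seq emit_pendant emit_pendant))) s
      (\<lambda>s. list_at 1 s = label_reduction w \<and> s 1 0 \<le> K)"
    proof (intro timed_Seq)
      let ?base = "\<lambda>s'. s' 0 = s 0 \<and> list_at 7 s' = L \<and> list_at 8 s' = map (last_match L) [0..<length L * length L]"
      show "timed K label_table s (\<lambda>s'. ?base s' \<and> s' 1 = s 1 \<and> s' 9 = s 9)"
      proof (rule timed_mono[OF timed_label_table[OF bs out0(3,4)]])
        show "(s 0 1 + s 0 (2 + s 0 1 * s 0 1 + s 0 1)) * (s 0 1 + s 0 (2 + s 0 1 * s 0 1 + s 0 1)) +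
            s 0 1 + s 0 (2 + s 0 1 * s 0 1 + s 0 1) + 10 < K"
          unfolding n_def[symmetric] b_def[symmetric] n'_def[symmetric] using sz K by linarith
      qed (simp add: L_def n_def n'_def b_def)
      fix s' assume s': "bounded_memory K s'" "?base s' \<and> s' 1 = s 1 \<and> s' 9 = s 9"
      show "timed K (assign 3 (Const 1)) s' (\<lambda>s'. ?base s' \<and> s' 1 = s 1 \<and> s' 9 = s 9 \<and> s' 3 0 = 1)"
        by (rule timed_Store) (use s' k1 in \<open>auto simp: list_at_def\<close>)
    next
      fix s1 assume b1: "bounded_memory K s1"
        and s1: "(s1 0 = s 0 \<and> list_at 7 s1 = L \<and> list_at 8 s1 = map (last_match L) [0..<length L * length L]) \<and>
          s1 1 = s 1 \<and> s1 9 = s 9 \<and> s1 3 0 = 1"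
      have r1: "s1 3 0 = 1" "s1 0 = s 0" "s1 9 0 = 0" "s1 1 0 = 0" "list_at 1 s1 = []"
        using s1 out0 list_at_cong[of s1 1 s] by simp_all
      have n1: "s1 0 (s1 3 0) = n" using r1 by (simp add: n_def)
      show "timed K emit_pendant s1 (\<lambda>s'. s' 0 = s 0 \<and> s' 7 = s1 7 \<and> s' 8 = s1 8 \<and> s' 3 0 = b \<and>
          s' 9 0 = n \<and> list_at 1 s' = ?V)"
      proof (rule timed_mono[OF timed_emit_pendant[OF b1]])
        show "list_at 7 s1 = L" "list_at 8 s1 = map (last_match L) [0..<length L * length L]"
          using s1 by auto
        show "s1 9 0 + s1 0 (s1 3 0) \<le> length L" unfolding n1 unfolding r1 LN by simp
        show "s1 1 0 + s1 0 (s1 3 0) * (length L + 2) * (s1 0 (s1 3 0) * (length L + 2)) +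
            s1 0 (s1 3 0) * (length L + 2) + 10 < K"
          unfolding n1 unfolding R_def[symmetric] r1 using sz K by linarith
        show "s1 3 0 + 1 + s1 0 (s1 3 0) * s1 0 (s1 3 0) + s1 0 (s1 3 0) + 1 < K"
          unfolding n1 unfolding r1 using sz K by linarith
        show "length L < K" unfolding LN using sz K by linarith
        fix s2 assume "s2 0 = s1 0 \<and> s2 7 = s1 7 \<and> s2 8 = s1 8 \<and>
          s2 3 0 = s1 3 0 + 1 + s1 0 (s1 3 0) * s1 0 (s1 3 0) + s1 0 (s1 3 0) \<and>
          s2 9 0 = s1 9 0 + s1 0 (s1 3 0) \<and>
          list_at 1 s2 = list_at 1 s1 @ pendant_word (s1 0 (s1 3 0)) (input_adj (s1 0) (s1 3 0))
            (\<lambda>x. rank L (s1 9 0 + x) + 2) (length L + 2)"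
        then show "s2 0 = s 0 \<and> s2 7 = s1 7 \<and> s2 8 = s1 8 \<and> s2 3 0 = b \<and> s2 9 0 = n \<and> list_at 1 s2 = ?V"
          unfolding n1 unfolding r1 R_def b_def by simp
      qed
      fix s2 assume b2: "bounded_memory K s2" and s2: "s2 0 = s 0 \<and> s2 7 = s1 7 \<and> s2 8 = s1 8 \<and>
        s2 3 0 = b \<and> s2 9 0 = n \<and> list_at 1 s2 = ?V"
      have r2: "s2 3 0 = b" "s2 0 = s 0" "s2 9 0 = n" "list_at 1 s2 = ?V" using s2 by auto
      have n2: "s2 0 (s2 3 0) = n'" using r2 by (simp add: n'_def)
      have l2: "s2 1 0 = 1 + (n * R) * (n * R)"
        using length_list_at[of 1 s2] unfolding r2 length_pendant_word by simp
      have bb: "b \<le> 2 + y + W" unfolding b_def using sz by linarith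
      show "timed K emit_pendant s2 (\<lambda>s. list_at 1 s = label_reduction w \<and> s 1 0 \<le> K)"
      proof (rule timed_mono[OF timed_emit_pendant[OF b2]])
        show "list_at 7 s2 = L" "list_at 8 s2 = map (last_match L) [0..<length L * length L]"
          using s1 s2 list_at_cong[of s2 7 s1] list_at_cong[of s2 8 s1] by simp_all
        show "s2 9 0 + s2 0 (s2 3 0) \<le> length L" unfolding n2 unfolding r2 LN by simp
        show "s2 1 0 + s2 0 (s2 3 0) * (length L + 2) * (s2 0 (s2 3 0) * (length L + 2)) +
            s2 0 (s2 3 0) * (length L + 2) + 10 < K"
          unfolding n2 unfolding R_def[symmetric] l2 using sz K by linarith
        show "s2 3 0 + 1 + s2 0 (s2 3 0) * s2 0 (s2 3 0) + s2 0 (s2 3 0) + 1 < K"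
          unfolding n2 unfolding r2 using bb sz K by linarith
        show "length L < K" unfolding LN using sz K by linarith
        fix s3 assume "s3 0 = s2 0 \<and> s3 7 = s2 7 \<and> s3 8 = s2 8 \<and>
          s3 3 0 = s2 3 0 + 1 + s2 0 (s2 3 0) * s2 0 (s2 3 0) + s2 0 (s2 3 0) \<and>
          s3 9 0 = s2 9 0 + s2 0 (s2 3 0) \<and>
          list_at 1 s3 = list_at 1 s2 @ pendant_word (s2 0 (s2 3 0)) (input_adj (s2 0) (s2 3 0))
            (\<lambda>x. rank L (s2 9 0 + x) + 2) (length L + 2)"
        then have *: "list_at 1 s3 = ?V @ ?V'"
          unfolding n2 unfolding r2 R_def by simp
        then have "s3 1 0 = 1 + (n * R) * (n * R) + (1 + (n' * R) * (n' * R))"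
          using length_list_at[of 1 s3] by (simp only: length_append length_pendant_word)
        then have "s3 1 0 \<le> K" using sz K by linarith
        then show "list_at 1 s3 = label_reduction w \<and> s3 1 0 \<le> K"
          using * f nl by (simp only: if_True simp_thms)
      qed
    qed
  next
    assume "val (size_guard second_exp) s = 0"
    then have "label_reduction w = []" using f g by auto
    then show "timed K Skip s (\<lambda>s. list_at 1 s = label_reduction w \<and> s 1 0 \<le> K)"
      using bs out0 by (intro timed_Skip) auto
  qed
qed

text \<open>Edges are sets, so adjacency of positions is symmetric; the exclusion of loops and the
  bound on ranks supply what the locale \<open>pendant\<close> further asks for.\<close>

lemma isomorphism_on_reduces_to_graph_isomorphism:
  fixes C :: "('v, 'l) lgraph set"
  assumes no_loops: "\<And>G x. G \<in> C \<Longrightarrow> {x} \<notin> edges G"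
  shows "poly_reducible (isomorphism_problem_on C) graph_isomorphism_problem"
  unfolding poly_reducible_def
proof (intro exI[of _ label_reduction] conjI ballI label_reduction_poly_time)
  fix w assume "w \<in> fst (isomorphism_problem_on C)"
  then obtain G H where GC: "G \<in> C" and HC: "H \<in> C" and p: "lgraph_pair_word G H w"
    unfolding isomorphism_problem_on_def by auto
  then obtain \<phi> xs ys where inj: "inj_on \<phi> (label G ` nodes G \<union> label H ` nodes H)"
    and G: "numbering xs G" and H: "numbering ys H"
    and w': "w = lgraph_word \<phi> G xs @ lgraph_word \<phi> H ys"
    unfolding lgraph_pair_word_iff by blast
  let ?lx = "map (\<lambda>x. \<phi> (label G x)) xs" and ?ly = "map (\<lambda>x. \<phi> (label H x)) ys"
  have w: "w = adjacency_word G xs @ ?lx @ adjacency_word H ys @ ?ly"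
    by (simp add: w' lgraph_word_def)
  define M where "M = init_memory w 0"
  define n where "n = length xs"
  define n' where "n' = length ys"
  define b where "b = 2 + n * n + n"
  have M: "M (Suc i) = w ! i" if "i < length w" for i
    unfolding M_def by (rule init_memory_Suc[OF that])
  have lw: "length w = 2 + n * n + n + n' * n' + n'"
    by (simp add: w n_def n'_def)
  have w_lx: "w ! (1 + n * n + i) = ?lx ! i" if "i < n" for i
    using that by (simp add: w n_def nth_append)
  have w_G: "w ! i = adjacency_word G xs ! i" if "i \<le> n * n" for i
    using that by (simp add: w n_def nth_append)
  have w_H: "w ! (1 + n * n + n + i) = adjacency_word H ys ! i" if "i \<le> n' * n'" for i
    using that by (simp add: w n_def n'_def nth_append)
  have w_ly: "w ! (2 + n * n + n + n' * n' + i) = ?ly ! i" if "i < n'" for i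
    using that by (simp add: w n_def n'_def nth_append)
  have Mn: "M 1 = n" using M[of 0] w_G[of 0] by (simp add: lw n_def)
  have Mn': "M b = n'" using M[of "1 + n * n + n"] w_H[of 0] by (simp add: lw b_def n'_def)
  have le: "n \<le> length w" "n' \<le> length w" unfolding lw by simp_all
  have a: "input_adj M 1 i j \<longleftrightarrow> edge_at G xs i j" if "i < n" "j < n" for i j
    unfolding M_def
  proof (rule input_adj_word)
    show "init_memory w 0 1 = length xs" using Mn by (simp add: M_def n_def)
    fix i assume "i < length xs * length xs"
    then show "init_memory w 0 (1 + 1 + i) = adjacency_word G xs ! Suc i"
      using M[of "Suc i"] w_G[of "Suc i"] by (simp add: lw M_def n_def)
  qed (use that in \<open>simp_all add: n_def\<close>)
  have a': "input_adj M b i j \<longleftrightarrow> edge_at H ys i j" if "i < n'" "j < n'" for i j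
    unfolding M_def
  proof (rule input_adj_word)
    show "init_memory w 0 b = length ys" using Mn' by (simp add: M_def n'_def)
    fix i assume "i < length ys * length ys"
    then show "init_memory w 0 (b + 1 + i) = adjacency_word H ys ! Suc i"
      using M[of "1 + n * n + n + Suc i"] w_H[of "Suc i"] by (simp add: lw M_def b_def n'_def)
  qed (use that in \<open>simp_all add: n'_def\<close>)
  define L where "L = map (\<lambda>x. M (2 + n * n + x)) [0..<n] @ map (\<lambda>x. M (b + 1 + n' * n' + x)) [0..<n']"
  have L: "L = ?lx @ ?ly"
  proof -
    have "map (\<lambda>x. M (2 + n * n + x)) [0..<n] = ?lx"
    proof (rule nth_equalityI)
      fix i assume "i < length (map (\<lambda>x. M (2 + n * n + x)) [0..<n])"
      then show "map (\<lambda>x. M (2 + n * n + x)) [0..<n] ! i = ?lx ! i"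
        using M[of "1 + n * n + i"] w_lx[of i] by (simp add: lw)
    qed (simp add: n_def)
    moreover have "map (\<lambda>x. M (b + 1 + n' * n' + x)) [0..<n'] = ?ly"
    proof (rule nth_equalityI)
      fix i assume "i < length (map (\<lambda>x. M (b + 1 + n' * n' + x)) [0..<n'])"
      then show "map (\<lambda>x. M (b + 1 + n' * n' + x)) [0..<n'] ! i = ?ly ! i"
        using M[of "2 + n * n + n + n' * n' + i"] w_ly[of i] by (simp add: lw b_def)
    qed (simp add: n'_def)
    ultimately show ?thesis unfolding L_def by simp
  qed
  have LN: "length L = n + n'" by (simp add: L n_def n'_def)
  define R where "R = length L + 2"
  define t where "t x = rank L (0 + x) + 2" for x
  define t' where "t' x = rank L (n + x) + 2" for x
  let ?E = "input_adj M 1" and ?E' = "input_adj M b"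
  have f: "label_reduction w = pendant_word n ?E t R @ pendant_word n' ?E' t' R"
    using le unfolding label_reduction_def Let_def M_def[symmetric] Mn b_def[symmetric] Mn'
      L_def[symmetric] R_def[symmetric] t_def[symmetric, abs_def] t'_def[symmetric, abs_def] by simp
  have P: "pendant n ?E t R"
  proof
    show "?E x y \<longleftrightarrow> ?E y x" if "x < n" "y < n" for x y
      using a[OF that] a[OF that(2,1)] by (simp only: insert_commute)
    show "\<not> ?E x x" if "x < n" for x using a[OF that that] no_loops[OF GC] by simp
    show "t x < R" if "x < n" for x using rank_less[of x L] that by (simp add: t_def R_def LN)
  qed (simp add: t_def)
  have P': "pendant n' ?E' t' R"
  proof
    show "?E' x y \<longleftrightarrow> ?E' y x" if "x < n'" "y < n'" for x y
      using a'[OF that] a'[OF that(2,1)] by (simp only: insert_commute)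
    show "\<not> ?E' x x" if "x < n'" for x using a'[OF that that] no_loops[OF HC] by simp
    show "t' x < R" if "x < n'" for x using rank_less[of "n + x" L] that by (simp add: t'_def R_def LN)
  qed (simp add: t'_def)
  have R: "0 < R" by (simp add: R_def)
  have "graph_isomorphic (pendant_graph n ?E t R) (pendant_graph n' ?E' t' R) \<longleftrightarrow>
      index_isomorphic n ?E t n' ?E' t'"
    by (rule pendant_graph_isomorphic_iff[OF P P'])
  also have "\<dots> \<longleftrightarrow> index_isomorphic n (edge_at G xs) (\<lambda>i. ?lx ! i) n' (edge_at H ys) (\<lambda>i. ?ly ! i)"
  proof (rule index_isomorphic_cong[OF a a'])
    fix i j assume ij: "i < n" "j < n'"
    \<comment> \<open>Ranks refer to the joint list, so equal numbers of pendants in the two graphs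
      mean equal label names.\<close>
    have "t' j = t i \<longleftrightarrow> L ! (n + j) = L ! i"
      using rank_eq_iff[of "n + j" L i] ij by (simp add: t_def t'_def LN)
    also have "L ! (n + j) = ?ly ! j" unfolding L using ij by (simp add: n_def nth_append)
    also have "L ! i = ?lx ! i" unfolding L using ij by (simp add: n_def nth_append)
    finally show "t' j = t i \<longleftrightarrow> ?ly ! j = ?lx ! i" .
  qed
  also have "\<dots> \<longleftrightarrow> lgraph_isomorphic G H"
    unfolding lgraph_isomorphic_iff_index[OF G H inj] n_def n'_def ..
  finally have iso: "graph_isomorphic (pendant_graph n ?E t R) (pendant_graph n' ?E' t' R) \<longleftrightarrow>
    lgraph_isomorphic G H" .
  note gi = graph_isomorphism_problem_word[OF pendant.simple[OF P] numbering_pendant[OF R]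
      pendant.simple[OF P'] numbering_pendant[OF R]]
  show "label_reduction w \<in> fst graph_isomorphism_problem"
    unfolding f pendant_word_eq[OF R] by (rule gi(1))
  show "label_reduction w \<in> snd graph_isomorphism_problem \<longleftrightarrow> w \<in> snd (isomorphism_problem_on C)"
    unfolding f pendant_word_eq[OF R] gi(2) iso isomorphism_problem_on_word(2)[OF GC HC p] ..
qed

lemma reduced_ilp_graph_no_loop: "{x} \<notin> edges (reduced_ilp_graph A b c)"
  by (auto simp: reduced_ilp_graph_def Let_def singleton_insert_inj_eq)

text \<open>An edge between a position and its twin is added only for a nonzero coefficient, where
  the twin is a different node. All other edges join nodes built by different constructors.\<close>

lemma ilp_graph_no_loop: "{x} \<notin> edges (ilp_graph A b c)"
  using reduced_ilp_graph_no_loop[of x A b c]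
  by (auto simp: ilp_graph_def Let_def singleton_insert_inj_eq hat_position_def split: if_splits)

text \<open>Two facts about each class suffice: it contains all gadgets of its kind, and its graphs
  have no loops.\<close>

theorem theorem40:
  fixes normalized :: "real mat \<Rightarrow> real vec \<Rightarrow> bool"
  assumes "normalized \<in> {leading_unit_rows, coprime_integral_rows,
    \<lambda>A b. leading_unit_rows A b \<or> coprime_integral_rows A b}"
  shows "graph_isomorphism_complete (ilp_graphs normalized) \<and>
    graph_isomorphism_complete (reduced_ilp_graphs normalized)"
proof -
  have adm: "admissible_data normalized (gadget_A (n + 2) a) (gadget_b (n + 2)) (gadget_c (n + 2))" for n a
    by (rule admissible_data_gadget[OF assms]) simp
  have "gadget_graph True (n + 2) a \<in> ilp_graphs normalized" for n a
    using adm[of n a] unfolding gadget_graph_def ilp_graphs_def by auto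
  moreover have "gadget_graph False (n + 2) a \<in> reduced_ilp_graphs normalized" for n a
    using adm[of n a] unfolding gadget_graph_def reduced_ilp_graphs_def by auto
  moreover have "{x} \<notin> edges G" if "G \<in> ilp_graphs normalized" for G x
    using that ilp_graph_no_loop by (auto simp: ilp_graphs_def)
  moreover have "{x} \<notin> edges G" if "G \<in> reduced_ilp_graphs normalized" for G x
    using that reduced_ilp_graph_no_loop by (auto simp: reduced_ilp_graphs_def)
  ultimately show ?thesis
    unfolding graph_isomorphism_complete_def
    by (intro conjI isomorphism_on_reduces_to_graph_isomorphism graph_isomorphism_reduces_to_gadgets)
qed

end
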